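(* Let $G$ be a (simple) cubic graph with exactly one end, and suppose this end has degree $3$. If $G$ has a Hamilton cycle, then $G$ has at least two distinct Hamilton cycles.
   Context: Graphs are simple. A cubic graph is a graph in which every vertex has degree $3$ (here infinite, hence locally finite). For a locally finite connected graph $G$, $|G|$ denotes its Freudenthal compactification. A circle in $|G|$ is a homeomorphic image of the unit circle in $|G|$; it is a Hamilton circle if it contains all vertices and all ends of $G$. A Hamilton cycle of $G$ is the subgraph formed by the vertices and edges contained in a Hamilton circle of $|G|$. The degree of an end $\omega$ is the maximum number of pairwise edge-disjoint rays in $G$ belonging to $\omega$. *)

theory Defs
  imports "HOL-Analysis.Analysis"
begin

section \<open>Simple graphs\<close>

record 'a ugraph =
  verts :: "'a set"
  edges :: "'a set set"

definition simple_graph :: "'a ugraph \<Rightarrow> bool" where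
  "simple_graph G \<longleftrightarrow> (\<forall>e\<in>edges G. e \<subseteq> verts G \<and> card e = 2)"

definition degree :: "'a ugraph \<Rightarrow> 'a \<Rightarrow> enat" where
  "degree G v = (let I = {e \<in> edges G. v \<in> e} in if finite I then enat (card I) else \<infinity>)"

definition cubic :: "'a ugraph \<Rightarrow> bool" where
  "cubic G \<longleftrightarrow> (\<forall>v\<in>verts G. degree G v = 3)"

definition adj :: "'a ugraph \<Rightarrow> ('a \<times> 'a) set" where
  "adj G = {(u, v). {u, v} \<in> edges G}"

definition component :: "'a ugraph \<Rightarrow> 'a \<Rightarrow> 'a set" where
  "component G v = {w \<in> verts G. (v, w) \<in> (adj G)\<^sup>*}"

definition graph_components :: "'a ugraph \<Rightarrow> 'a set set" where
  "graph_components G = component G ` verts G"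

definition connected_graph :: "'a ugraph \<Rightarrow> bool" where
  "connected_graph G \<longleftrightarrow> (\<exists>v\<in>verts G. component G v = verts G)"

definition delete_verts :: "'a ugraph \<Rightarrow> 'a set \<Rightarrow> 'a ugraph" where
  "delete_verts G S = \<lparr>verts = verts G - S, edges = {e \<in> edges G. e \<inter> S = {}}\<rparr>"


section \<open>Rays and ends\<close>

text \<open>A ray, as a subgraph, has a unique vertex of degree one, so it corresponds to exactly one
  sequence of vertices.\<close>

definition ray :: "'a ugraph \<Rightarrow> (nat \<Rightarrow> 'a) \<Rightarrow> bool" where
  "ray G R \<longleftrightarrow> inj R \<and> range R \<subseteq> verts G \<and> (\<forall>n. {R n, R (Suc n)} \<in> edges G)"

definition ray_edges :: "(nat \<Rightarrow> 'a) \<Rightarrow> 'a set set" where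
  "ray_edges R = {{R n, R (Suc n)} | n. True}"

definition has_tail_in :: "(nat \<Rightarrow> 'a) \<Rightarrow> 'a set \<Rightarrow> bool" where
  "has_tail_in R C \<longleftrightarrow> (\<exists>m. \<forall>n\<ge>m. R n \<in> C)"

definition ray_equiv :: "'a ugraph \<Rightarrow> ((nat \<Rightarrow> 'a) \<times> (nat \<Rightarrow> 'a)) set" where
  "ray_equiv G = {(R, R'). ray G R \<and> ray G R' \<and>
     (\<forall>S. finite S \<and> S \<subseteq> verts G \<longrightarrow>
       (\<exists>C\<in>graph_components (delete_verts G S). has_tail_in R C \<and> has_tail_in R' C))}"

definition ends :: "'a ugraph \<Rightarrow> (nat \<Rightarrow> 'a) set set" where
  "ends G = {R. ray G R} // ray_equiv G"

text \<open>If there are arbitrarily large finite families of pairwise edge-disjoint rays in an end,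
  then there is an infinite one (Halin), so the supremum is the maximum.\<close>

definition end_degree :: "(nat \<Rightarrow> 'a) set \<Rightarrow> enat" where
  "end_degree \<omega> = Sup {enat (card F) | F. finite F \<and> F \<subseteq> \<omega> \<and>
     pairwise (\<lambda>R R'. disjnt (ray_edges R) (ray_edges R')) F}"


section \<open>The Freudenthal compactification\<close>

text \<open>The points of the 1-complex of a graph are given by barycentric coordinates:
  a vertex \<open>v\<close> has coordinate 1 at \<open>v\<close>, and the point at parameter \<open>t\<close> on the edge
  from \<open>u\<close> to \<open>v\<close> has coordinates \<open>1 - t\<close> at \<open>u\<close> and \<open>t\<close> at \<open>v\<close>.
  This needs no choice of an orientation for the edges.\<close>

datatype 'a gpoint = Point "'a \<Rightarrow> real" | End "(nat \<Rightarrow> 'a) set"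

definition vertex_point :: "'a \<Rightarrow> 'a \<Rightarrow> real" where
  "vertex_point v = (\<lambda>x. if x = v then 1 else 0)"

definition edge_point :: "'a \<Rightarrow> 'a \<Rightarrow> real \<Rightarrow> 'a \<Rightarrow> real" where
  "edge_point u v t = (\<lambda>x. if x = u then 1 - t else if x = v then t else 0)"

definition closed_edge :: "'a set \<Rightarrow> ('a \<Rightarrow> real) set" where
  "closed_edge e = {edge_point u v t | u v t. e = {u, v} \<and> t \<in> {0..1}}"

definition one_complex :: "'a ugraph \<Rightarrow> ('a \<Rightarrow> real) set" where
  "one_complex G = vertex_point ` verts G \<union> \<Union> (closed_edge ` edges G)"

text \<open>The identification (weak) topology of the 1-complex.\<close>

definition open_in_complex :: "'a ugraph \<Rightarrow> ('a \<Rightarrow> real) set \<Rightarrow> bool" where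
  "open_in_complex G W \<longleftrightarrow> W \<subseteq> one_complex G \<and>
     (\<forall>u v. {u, v} \<in> edges G \<longrightarrow>
        openin (top_of_set {0..1}) {t \<in> {0..1}. edge_point u v t \<in> W})"

text \<open>For a component \<open>C\<close> of \<open>G - S\<close>, the set \<open>end_nbhd G C\<close> consists of the subgraph \<open>C\<close>,
  the ends that live in \<open>C\<close>, and the inner points of the edges between \<open>S\<close> and \<open>C\<close>. Since
  every edge at a vertex of \<open>C\<close> has its other endvertex in \<open>C\<close> or in \<open>S\<close>, its points of the
  1-complex are precisely those with a positive coordinate at some vertex of \<open>C\<close>.\<close>

definition lives_in :: "(nat \<Rightarrow> 'a) set \<Rightarrow> 'a set \<Rightarrow> bool" where
  "lives_in \<omega> C \<longleftrightarrow> (\<forall>R\<in>\<omega>. has_tail_in R C)"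

definition end_nbhd :: "'a ugraph \<Rightarrow> 'a set \<Rightarrow> 'a gpoint set" where
  "end_nbhd G C = Point ` {p \<in> one_complex G. \<exists>v\<in>C. p v > 0}
     \<union> End ` {\<omega> \<in> ends G. lives_in \<omega> C}"

text \<open>For locally finite \<open>G\<close>, the neighbourhoods of an end may contain the inner points of the
  edges between \<open>S\<close> and \<open>C\<close> entirely; shorter end pieces of these edges give the same topology.\<close>

definition freudenthal :: "'a ugraph \<Rightarrow> 'a gpoint topology" where
  "freudenthal G = topology_generated_by
     ({Point ` W | W. open_in_complex G W} \<union>
      {end_nbhd G C | C \<omega> S. finite S \<and> S \<subseteq> verts G \<and> \<omega> \<in> ends G \<and>
         C \<in> graph_components (delete_verts G S) \<and> lives_in \<omega> C})"


section \<open>Hamilton circles and Hamilton cycles\<close>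

definition circle_in :: "'b topology \<Rightarrow> 'b set \<Rightarrow> bool" where
  "circle_in X K \<longleftrightarrow> K \<subseteq> topspace X \<and>
     subtopology X K homeomorphic_space top_of_set (sphere (0 :: complex) 1)"

definition hamilton_circle :: "'a ugraph \<Rightarrow> 'a gpoint set \<Rightarrow> bool" where
  "hamilton_circle G K \<longleftrightarrow> circle_in (freudenthal G) K \<and>
     (\<forall>v\<in>verts G. Point (vertex_point v) \<in> K) \<and> (\<forall>\<omega>\<in>ends G. End \<omega> \<in> K)"

definition subgraph_in :: "'a ugraph \<Rightarrow> 'a gpoint set \<Rightarrow> 'a ugraph" where
  "subgraph_in G K = \<lparr>verts = {v \<in> verts G. Point (vertex_point v) \<in> K},
     edges = {e \<in> edges G. Point ` closed_edge e \<subseteq> K}\<rparr>"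

definition hamilton_cycle :: "'a ugraph \<Rightarrow> 'a ugraph \<Rightarrow> bool" where
  "hamilton_cycle G H \<longleftrightarrow> (\<exists>K. hamilton_circle G K \<and> H = subgraph_in G K)"

end

(* Deleting the end from a Hamilton circle leaves a spanning double ray, i.e. a 2-factor L of G in
   which every finite nonempty vertex set is left by an edge. Since the end has degree 3, flows
   (Menger) give arbitrarily large finite vertex sets T with exactly three edges leaving T, and L
   uses two of them. Contract everything outside T: the result is a finite cubic multigraph in
   which L induces a Hamilton cycle avoiding one of the three edges, say f. If another Hamilton
   cycle of the contraction avoids f, it can replace L inside T. Otherwise the number of Hamilton
   cycles avoiding f is odd, and by Smith's theorem so is the number avoiding any other edge, in
   particular a fixed edge e of L. If this happens for all T, a compactness argument
   yields a 2-factor of G without the edge e, which is again a spanning double ray because it uses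
   only two edges of each of the 3-edge cuts. *)

theory Submission
  imports Defs
begin

section \<open>Degrees and cuts in multigraphs\<close>

text \<open>Parity is what allows \<open>e\<close> to take the place of \<open>f\<close>: by Smith's
  theorem evenly many Hamilton cycles of the contraction contain a given edge, so the number
  avoiding it has the parity of the number of all of them, whichever edge it is. The value 3 of the
  end degree serves twice: the contracted vertex gets degree 3, so the contraction is cubic; and a
  nonzero even number of at most three edges is two, so exactly one cut edge \<open>f\<close> is
  missed. The obstacle is connectedness, which limits do not preserve: a limit of Hamilton cycles
  could split into several double rays. Hence Hamiltonicity is always expressed by cuts: degree 2
  everywhere, and some edge leaves every finite nonempty vertex set (every proper one, in a
  contraction). Each such condition concerns finitely many edges, so it survives contraction and
  limits; splitting is excluded afterwards by a count at a 3-edge cut. On the topological side, a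
  graph with a single end has Hamilton circles that are lines closed up by one point, which
  translates circles into such edge sets and back.\<close>

definition deg :: "('e \<Rightarrow> 'v set) \<Rightarrow> 'e set \<Rightarrow> 'v \<Rightarrow> nat" where
  "deg m F v = card {e \<in> F. v \<in> m e}"

definition edge_cut :: "('e \<Rightarrow> 'v set) \<Rightarrow> 'e set \<Rightarrow> 'v set \<Rightarrow> 'e set" where
  "edge_cut m F W = {e \<in> F. m e \<inter> W \<noteq> {} \<and> \<not> m e \<subseteq> W}"

text \<open>An edge inside \<open>W\<close> counts twice in the degree sum, a crossing edge once.
  \<open>F\<close> may be infinite, since only edges meeting \<open>W\<close> contribute.\<close>

lemma even_sum_deg_iff_even_edge_cut:
  assumes W: "finite W" and two: "\<And>e. e \<in> F \<Longrightarrow> card (m e) = 2"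
    and fin: "\<And>v. v \<in> W \<Longrightarrow> finite {e \<in> F. v \<in> m e}"
  shows "even (\<Sum>v\<in>W. deg m F v) \<longleftrightarrow> even (card (edge_cut m F W))"
proof -
  define F' where "F' = (\<Union>v\<in>W. {e \<in> F. v \<in> m e})"
  have F': "finite F'" using W fin by (auto simp: F'_def)
  have fm: "finite (m e)" if "e \<in> F" for e
    using two[OF that] by (intro card_ge_0_finite) simp
  have "(\<Sum>v\<in>W. deg m F v) = (\<Sum>v\<in>W. \<Sum>e\<in>F'. if v \<in> m e then 1 else 0)"
  proof (rule sum.cong[OF refl])
    fix v assume "v \<in> W"
    then have "{e \<in> F. v \<in> m e} = {e \<in> F'. v \<in> m e}" by (auto simp: F'_def)
    then show "deg m F v = (\<Sum>e\<in>F'. if v \<in> m e then 1 else 0)"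
      using F' by (simp add: deg_def sum.If_cases Int_def)
  qed
  also have "\<dots> = (\<Sum>e\<in>F'. \<Sum>v\<in>W. if v \<in> m e then 1 else 0)" by (rule sum.swap)
  also have "\<dots> = (\<Sum>e\<in>F'. card (m e \<inter> W))"
    using W by (simp add: sum.If_cases Int_def conj_commute)
  finally have "even (\<Sum>v\<in>W. deg m F v) \<longleftrightarrow> even (card {e \<in> F'. odd (card (m e \<inter> W))})"
    using F' by (simp add: even_sum_iff)
  moreover have "{e \<in> F'. odd (card (m e \<inter> W))} = edge_cut m F W"
  proof (intro equalityI subsetI)
    fix e assume e: "e \<in> {e \<in> F'. odd (card (m e \<inter> W))}"
    then have "e \<in> F" by (auto simp: F'_def)
    have "m e \<inter> W \<noteq> {}" using e by (intro notI) simp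
    moreover have "\<not> m e \<subseteq> W"
    proof
      assume "m e \<subseteq> W"
      then have "m e \<inter> W = m e" by blast
      with e two[OF \<open>e \<in> F\<close>] show False by simp
    qed
    ultimately show "e \<in> edge_cut m F W" using \<open>e \<in> F\<close> by (simp add: edge_cut_def)
  next
    fix e assume e: "e \<in> edge_cut m F W"
    then have "e \<in> F" "m e \<inter> W \<noteq> {}" "m e \<inter> W \<subset> m e" by (auto simp: edge_cut_def)
    then have "0 < card (m e \<inter> W)" "card (m e \<inter> W) < 2"
      using fm[of e] psubset_card_mono[of "m e" "m e \<inter> W"] two[of e]
      by (auto simp: card_gt_0_iff)
    then have "card (m e \<inter> W) = 1" by linarith
    moreover have "e \<in> F'" using \<open>e \<in> F\<close> \<open>m e \<inter> W \<noteq> {}\<close> by (auto simp: F'_def)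
    ultimately show "e \<in> {e \<in> F'. odd (card (m e \<inter> W))}" by simp
  qed
  ultimately show ?thesis by simp
qed

lemma odd_deg_sym_diff:
  assumes "finite A" "finite B"
  shows "odd (deg m (sym_diff A B) v) \<longleftrightarrow> (odd (deg m A v) \<noteq> odd (deg m B v))"
proof -
  let ?s = "\<lambda>F. {e \<in> F. v \<in> m e}"
  have "?s (sym_diff A B) = sym_diff (?s A) (?s B)" by auto
  moreover have "card (sym_diff X Y) + 2 * card (X \<inter> Y) = card X + card Y"
    if "finite X" "finite Y" for X Y :: "'a set"
    using that card_Un_disjoint[of "X - Y" "Y - X"] card_Int_Diff[of X Y] card_Int_Diff[of Y X]
    by (auto simp: Int_commute)
  then have "card (sym_diff (?s A) (?s B)) + 2 * card (?s A \<inter> ?s B) = card (?s A) + card (?s B)"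
    using assms by simp
  ultimately have "deg m (sym_diff A B) v + 2 * card (?s A \<inter> ?s B) = deg m A v + deg m B v"
    by (simp add: deg_def)
  then have "even (deg m (sym_diff A B) v + 2 * card (?s A \<inter> ?s B)) \<longleftrightarrow> even (deg m A v + deg m B v)"
    by (rule arg_cong)
  then show ?thesis by simp
qed

lemma deg_diff:
  assumes "finite {e \<in> A. v \<in> m e}" "B \<subseteq> A"
  shows "deg m (A - B) v = deg m A v - deg m B v"
proof -
  have "{e \<in> A - B. v \<in> m e} = {e \<in> A. v \<in> m e} - {e \<in> B. v \<in> m e}" by auto
  moreover have "{e \<in> B. v \<in> m e} \<subseteq> {e \<in> A. v \<in> m e}" using assms(2) by auto
  ultimately show ?thesis using assms(1)
    by (simp add: deg_def card_Diff_subset finite_subset)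
qed

section \<open>Smith's theorem\<close>

text \<open>Hamilton cycles are encoded as the 2-factors that leave every proper nonempty vertex set.\<close>

definition hamiltonian_factor :: "('e \<Rightarrow> 'v set) \<Rightarrow> 'v set \<Rightarrow> 'e set \<Rightarrow> bool" where
  "hamiltonian_factor m V Q \<longleftrightarrow> (\<forall>v\<in>V. deg m Q v = 2) \<and>
     (\<forall>W. W \<subseteq> V \<and> W \<noteq> {} \<and> W \<noteq> V \<longrightarrow> edge_cut m Q W \<noteq> {})"

text \<open>Edges are abstract names whose endvertices are given by \<open>m\<close>, so that
  parallel edges created by a contraction stay distinct.\<close>

locale finite_multigraph =
  fixes V :: "'v set" and E :: "'e set" and m :: "'e \<Rightarrow> 'v set"
  assumes finite_V: "finite V" and finite_E: "finite E"
    and m_sub: "e \<in> E \<Longrightarrow> m e \<subseteq> V" and card_m: "e \<in> E \<Longrightarrow> card (m e) = 2"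
begin

lemma endpoint:
  assumes "e \<in> E"
  shows "\<exists>v\<in>V. v \<in> m e"
proof -
  have "m e \<noteq> {}" using card_m[OF assms] by auto
  then show ?thesis using m_sub[OF assms] by blast
qed

text \<open>No paths are built: the set \<open>R\<close> of vertices that can be paired with
  \<open>x\<close> is closed under the edges of \<open>Q\<close>, because adding an edge by
  symmetric difference moves the second odd vertex to its other end. As \<open>Q\<close> leaves
  every proper nonempty set, \<open>R\<close> is all of \<open>V\<close>. The form
  \<open>sym_diff {x} {y}\<close> covers \<open>x = y\<close>, with no odd vertex at all.\<close>

lemma T_join_pair:
  assumes Q: "Q \<subseteq> E" and conn: "\<And>W. W \<subseteq> V \<Longrightarrow> W \<noteq> {} \<Longrightarrow> W \<noteq> V \<Longrightarrow> edge_cut m Q W \<noteq> {}"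
    and xy: "x \<in> V" "y \<in> V"
  shows "\<exists>X\<subseteq>Q. \<forall>v. odd (deg m X v) \<longleftrightarrow> v \<in> sym_diff {x} {y}"
proof -
  define R where "R = {z \<in> V. \<exists>X\<subseteq>Q. \<forall>v. odd (deg m X v) \<longleftrightarrow> v \<in> sym_diff {x} {z}}"
  have "x \<in> R" using xy(1) by (auto simp: R_def deg_def intro!: exI[of _ "{}"])
  have "R = V"
  proof (rule ccontr)
    assume "R \<noteq> V"
    moreover have "R \<subseteq> V" "R \<noteq> {}" using \<open>x \<in> R\<close> unfolding R_def by blast+
    ultimately obtain e where e: "e \<in> edge_cut m Q R" using conn[of R] by blast
    then have "e \<in> Q" "e \<in> E" using Q by (auto simp: edge_cut_def)
    obtain a b where ab: "a \<in> R" "b \<notin> R" "a \<in> m e" "b \<in> m e"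
      using e by (auto simp: edge_cut_def)
    have me: "m e = {a, b}" using card_m[OF \<open>e \<in> E\<close>] ab by (auto simp: card_2_iff)
    obtain X where X: "X \<subseteq> Q" "\<And>v. odd (deg m X v) \<longleftrightarrow> v \<in> sym_diff {x} {a}"
      using ab(1) by (auto simp: R_def)
    have fX: "finite X" using X(1) Q finite_E by (meson finite_subset)
    have d1: "odd (deg m {e} v) \<longleftrightarrow> v \<in> {a, b}" for v
    proof -
      have "{e' \<in> {e}. v \<in> m e'} = (if v \<in> m e then {e} else {})" by auto
      then show ?thesis by (simp add: deg_def me)
    qed
    have "odd (deg m (sym_diff X {e}) v) \<longleftrightarrow> v \<in> sym_diff {x} {b}" for v
      using ab by (subst odd_deg_sym_diff[OF fX]) (auto simp: X(2) d1)
    moreover have "sym_diff X {e} \<subseteq> Q" using X(1) \<open>e \<in> Q\<close> by auto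
    moreover have "b \<in> V" using m_sub[OF \<open>e \<in> E\<close>] ab by auto
    ultimately have "b \<in> R" unfolding R_def by blast
    with ab show False by simp
  qed
  with xy show ?thesis by (auto simp: R_def)
qed

text \<open>Two vertices of \<open>T\<close> are split off at a time; under symmetric differences
  the sets of odd vertices add modulo 2.\<close>

lemma T_join:
  assumes Q: "Q \<subseteq> E" and conn: "\<And>W. W \<subseteq> V \<Longrightarrow> W \<noteq> {} \<Longrightarrow> W \<noteq> V \<Longrightarrow> edge_cut m Q W \<noteq> {}"
    and T: "T \<subseteq> V" "even (card T)"
  shows "\<exists>X\<subseteq>Q. \<forall>v. odd (deg m X v) \<longleftrightarrow> v \<in> T"
  using T
proof (induction "card T" arbitrary: T rule: less_induct)
  case less
  have fT: "finite T" by (rule finite_subset[OF less.prems(1) finite_V])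
  show ?case
  proof (cases "T = {}")
    case True
    then have "{} \<subseteq> Q \<and> (\<forall>v. odd (deg m {} v) \<longleftrightarrow> v \<in> T)" by (simp add: deg_def)
    then show ?thesis by blast
  next
    case False
    then obtain x where x: "x \<in> T" by blast
    have "T - {x} \<noteq> {}"
    proof
      assume "T - {x} = {}"
      with x have "T = {x}" by blast
      with less.prems show False by simp
    qed
    then obtain y where y: "y \<in> T" "y \<noteq> x" by blast
    have c: "card (T - {x, y}) = card T - 2" using x y fT by (simp add: card_Diff_subset)
    have c0: "card {x, y} \<le> card T" using x y fT by (intro card_mono) auto
    then have "card (T - {x, y}) < card T" "even (card (T - {x, y}))"
      using c y less.prems by auto
    then obtain X where X: "X \<subseteq> Q" "\<And>v. odd (deg m X v) \<longleftrightarrow> v \<in> T - {x, y}"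
      using less.hyps[of "T - {x, y}"] less.prems by blast
    obtain Y where Y: "Y \<subseteq> Q" "\<And>v. odd (deg m Y v) \<longleftrightarrow> v \<in> sym_diff {x} {y}"
      using T_join_pair[OF Q conn, of x y] x y less.prems by blast
    have "finite X" "finite Y" using X Y Q finite_E by (meson finite_subset)+
    then have "odd (deg m (sym_diff X Y) v) \<longleftrightarrow> v \<in> T" for v
      using x y by (subst odd_deg_sym_diff) (auto simp: X(2) Y(2))
    moreover have "sym_diff X Y \<subseteq> Q" using X Y by auto
    ultimately show ?thesis by blast
  qed
qed

text \<open>These are the perfect matchings inside \<open>Q\<close> that contain \<open>e\<close>.
  In a 2-factor they take every second edge of each cycle, so the cycle through \<open>e\<close>
  leaves no choice, while any other cycle of even length leaves two.\<close>

definition alternations :: "'e set \<Rightarrow> 'e \<Rightarrow> 'e set set" where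
  "alternations Q e = {X. X \<subseteq> Q \<and> (\<forall>v\<in>V. deg m X v = 1) \<and> e \<in> X}"

lemma finite_alternations:
  assumes "Q \<subseteq> E"
  shows "finite (alternations Q e)"
proof (rule finite_subset)
  show "alternations Q e \<subseteq> Pow E" using assms unfolding alternations_def by blast
qed (simp add: finite_E)

text \<open>Since \<open>v\<close> has degree 2, \<open>f\<close> and \<open>g\<close> are the only
  edges of \<open>Q\<close> there, and \<open>X\<close> uses exactly one of them.\<close>

lemma alternation_switch:
  assumes Q: "Q \<subseteq> E" and dQ: "deg m Q v = 2" and X: "X \<subseteq> Q" "deg m X v = 1"
    and f: "f \<in> Q" "v \<in> m f" and g: "g \<in> Q" "v \<in> m g" "f \<noteq> g"
  shows "g \<in> X \<longleftrightarrow> f \<notin> X"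
proof -
  have "finite Q" using Q finite_E finite_subset by blast
  then have "{e \<in> Q. v \<in> m e} = {f, g}"
    using dQ f g by (intro card_seteq[symmetric]) (auto simp: deg_def)
  moreover obtain h where h: "{e \<in> X. v \<in> m e} = {h}"
    using X(2) by (auto simp: deg_def card_1_singleton_iff)
  ultimately have "h \<in> {f, g}" "f \<in> X \<longleftrightarrow> f = h" "g \<in> X \<longleftrightarrow> g = h"
    using X(1) f(2) g(2) by auto
  then show ?thesis using g(3) by auto
qed

text \<open>By the switch at each vertex, no edge of \<open>Q\<close> leaves the set of vertices at
  which \<open>X\<close> and \<open>Y\<close> agree. This set contains an endvertex of
  \<open>e\<close>, so it is everything.\<close>

lemma alternation_unique:
  assumes Q: "Q \<subseteq> E" and H: "hamiltonian_factor m V Q"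
    and X: "X \<in> alternations Q e" and Y: "Y \<in> alternations Q e"
  shows "X = Y"
proof -
  define W where "W = {v \<in> V. \<forall>f\<in>Q. v \<in> m f \<longrightarrow> (f \<in> X \<longleftrightarrow> f \<in> Y)}"
  have X': "X \<subseteq> Q" "\<And>v. v \<in> V \<Longrightarrow> deg m X v = 1" "e \<in> X"
    and Y': "Y \<subseteq> Q" "\<And>v. v \<in> V \<Longrightarrow> deg m Y v = 1" "e \<in> Y"
    using X Y by (auto simp: alternations_def)
  have dQ: "deg m Q v = 2" if "v \<in> V" for v using H that by (simp add: hamiltonian_factor_def)
  have agree: "v \<in> W" if v: "v \<in> V" and f: "f \<in> Q" "v \<in> m f" "f \<in> X \<longleftrightarrow> f \<in> Y" for v f
  proof -
    have "g \<in> X \<longleftrightarrow> g \<in> Y" if "g \<in> Q" "v \<in> m g" for g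
      using alternation_switch[OF Q dQ[OF v] X'(1) X'(2)[OF v] f(1,2) that]
        alternation_switch[OF Q dQ[OF v] Y'(1) Y'(2)[OF v] f(1,2) that] f(3) by blast
    with v show ?thesis by (simp add: W_def)
  qed
  have "e \<in> E" using X' Q by blast
  then obtain a where "a \<in> m e" "a \<in> V" using endpoint by blast
  then have "W \<noteq> {}" using agree[of a e] X' Y' by blast
  moreover have "edge_cut m Q W = {}"
  proof (rule ccontr)
    assume "edge_cut m Q W \<noteq> {}"
    then obtain f a b where f: "f \<in> Q" "a \<in> m f" "a \<in> W" "b \<in> m f" "b \<notin> W"
      by (auto simp: edge_cut_def)
    then have "f \<in> X \<longleftrightarrow> f \<in> Y" by (simp add: W_def)
    moreover have "b \<in> V" using f m_sub[of f] Q by blast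
    ultimately show False using agree[of b f] f by blast
  qed
  moreover have "W \<subseteq> V" by (auto simp: W_def)
  ultimately have "W = V" using H unfolding hamiltonian_factor_def by blast
  have "f \<in> X \<longleftrightarrow> f \<in> Y" if "f \<in> Q" for f
  proof -
    have "f \<in> E" by (rule subsetD[OF Q that])
    then obtain a where "a \<in> m f" "a \<in> V" using endpoint[of f] by auto
    then have "a \<in> W" using \<open>W = V\<close> by simp
    then show ?thesis using \<open>a \<in> m f\<close> that unfolding W_def by blast
  qed
  then show ?thesis using X'(1) Y'(1) by blast
qed

text \<open>As \<open>card V\<close> is even, some subset of \<open>Q\<close> has odd degree at all
  vertices; odd degrees bounded by 2 are 1. Either this set or its complement in \<open>Q\<close>
  contains \<open>e\<close>.\<close>

lemma alternation_exists:
  assumes ev: "even (card V)" and Q: "Q \<subseteq> E" and H: "hamiltonian_factor m V Q" and e: "e \<in> Q"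
  shows "alternations Q e \<noteq> {}"
proof -
  have fQ: "finite Q" using Q finite_E finite_subset by blast
  have conn: "\<And>W. W \<subseteq> V \<Longrightarrow> W \<noteq> {} \<Longrightarrow> W \<noteq> V \<Longrightarrow> edge_cut m Q W \<noteq> {}"
    using H by (simp add: hamiltonian_factor_def)
  obtain X where X: "X \<subseteq> Q" "\<And>v. odd (deg m X v) \<longleftrightarrow> v \<in> V"
    using T_join[OF Q conn _ ev] by blast
  have dQ: "deg m Q v = 2" if "v \<in> V" for v using H that by (simp add: hamiltonian_factor_def)
  have dX: "deg m X v = 1" if "v \<in> V" for v
  proof -
    have "deg m X v \<le> deg m Q v" unfolding deg_def using X(1) fQ by (intro card_mono) auto
    moreover have "odd (deg m X v)" using X(2) that by blast
    ultimately show ?thesis using dQ[OF that] by (cases "deg m X v = 0 \<or> deg m X v = 2") auto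
  qed
  have "deg m (Q - X) v = 1" if "v \<in> V" for v
    using deg_diff[of Q v m X] fQ X(1) dX[OF that] dQ[OF that] by simp
  then have "(if e \<in> X then X else Q - X) \<in> alternations Q e"
    using dX X(1) e by (simp add: alternations_def)
  then show ?thesis by blast
qed

lemma even_card_involution:
  assumes "finite A" "\<And>x. x \<in> A \<Longrightarrow> f x \<in> A" "\<And>x. x \<in> A \<Longrightarrow> f (f x) = x" "\<And>x. x \<in> A \<Longrightarrow> f x \<noteq> x"
  shows "even (card A)"
  using assms
proof (induction "card A" arbitrary: A rule: less_induct)
  case less
  show ?case
  proof (cases "A = {}")
    case False
    then obtain x where x: "x \<in> A" by blast
    have fx: "f x \<in> A" "f x \<noteq> x" using less.prems x by blast+
    have sub: "{x, f x} \<subseteq> A" using x fx by blast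
    have c: "card (A - {x, f x}) = card A - 2" using sub fx by (simp add: card_Diff_subset)
    have c2: "2 \<le> card A" using card_mono[OF less.prems(1) sub] fx by simp
    have "even (card (A - {x, f x}))"
    proof (rule less.hyps)
      show "card (A - {x, f x}) < card A" using c c2 by simp
      show "f y \<in> A - {x, f x}" if "y \<in> A - {x, f x}" for y
        using less.prems(2,3)[of y] that less.prems(3)[OF x] by auto
    qed (use less.prems in auto)
    then show ?thesis using c c2 by simp
  qed simp
qed

text \<open>On a part of \<open>Q\<close> separated from \<open>e\<close>, the matching can be
  exchanged for its complement independently of the rest; this pairs off the alternations.\<close>

lemma even_alternations_disconnected:
  assumes Q: "Q \<subseteq> E" and dQ: "\<And>v. v \<in> V \<Longrightarrow> deg m Q v = 2"
    and H: "\<not> hamiltonian_factor m V Q" and e: "e \<in> Q"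
  shows "even (card (alternations Q e))"
proof -
  have fQ: "finite Q" using Q finite_E finite_subset by blast
  obtain W0 where W0: "W0 \<subseteq> V" "W0 \<noteq> {}" "W0 \<noteq> V" "edge_cut m Q W0 = {}"
    using H dQ by (auto simp: hamiltonian_factor_def)
  have in_or_out: "m f \<subseteq> W0 \<or> m f \<subseteq> V - W0" if "f \<in> Q" for f
    using W0(4) that m_sub[of f] Q unfolding edge_cut_def by blast
  \<comment> \<open>The side of the separation that misses \<open>e\<close>, so that the exchange
    keeps \<open>e\<close> in the matching.\<close>
  define W where "W = (if m e \<subseteq> W0 then V - W0 else W0)"
  have W: "W \<subseteq> V" "W \<noteq> {}" using W0 by (auto simp: W_def)
  have cl: "m f \<subseteq> W \<or> m f \<subseteq> V - W" if "f \<in> Q" for f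
    using in_or_out[OF that] W0(1) by (auto simp: W_def)
  have ne: "m f \<noteq> {}" if "f \<in> Q" for f using card_m[of f] that Q by force
  have eW: "\<not> m e \<subseteq> W" using ne[OF e] in_or_out[OF e] by (auto simp: W_def)
  define D where "D = {f \<in> Q. m f \<subseteq> W}"
  \<comment> \<open>Symmetric difference with \<open>D\<close> complements \<open>X\<close> at the
    vertices of \<open>W\<close> and changes nothing elsewhere.\<close>
  have fin: "{f \<in> sym_diff X D. v \<in> m f} = (if v \<in> W then {f \<in> Q - X. v \<in> m f} else {f \<in> X. v \<in> m f})"
    if "X \<subseteq> Q" for X v
    using that cl by (auto simp: D_def)
  show ?thesis
  proof (rule even_card_involution[of _ "\<lambda>X. sym_diff X D"])
    show "finite (alternations Q e)" using Q by (rule finite_alternations)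
    fix X assume "X \<in> alternations Q e"
    then have X: "X \<subseteq> Q" "\<And>v. v \<in> V \<Longrightarrow> deg m X v = 1" "e \<in> X" by (auto simp: alternations_def)
    have "deg m (Q - X) v = 1" if "v \<in> V" for v
      using deg_diff[of Q v m X] fQ X(1) X(2)[OF that] dQ[OF that] by simp
    then have "deg m (sym_diff X D) v = 1" if "v \<in> V" for v
      using that X(2)[OF that] fin[OF X(1), of v] by (simp add: deg_def)
    moreover have "sym_diff X D \<subseteq> Q" using X(1) by (auto simp: D_def)
    moreover have "e \<in> sym_diff X D" using X(3) eW by (auto simp: D_def)
    ultimately show "sym_diff X D \<in> alternations Q e" by (simp add: alternations_def)
    show "sym_diff (sym_diff X D) D = X" by auto
    obtain v where v: "v \<in> W" using W by blast
    then have "v \<in> V" using W by blast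
    then have "{f \<in> Q. v \<in> m f} \<noteq> {}" using dQ[of v] by (intro notI) (simp add: deg_def)
    then obtain f where "f \<in> Q" "v \<in> m f" by blast
    then have "f \<in> D" using cl[of f] v by (auto simp: D_def)
    then show "sym_diff X D \<noteq> X" by blast
  qed
qed

text \<open>The pairs \<open>(Q, X)\<close> of a 2-factor and an alternation of it are the ordered partitions
  \<open>(X, Q - X, E - Q)\<close> of the edges into perfect matchings; exchanging the last two shows that
  their number is even. A 2-factor contributes an odd number to it iff it is Hamiltonian.\<close>

theorem Smith:
  assumes cubic: "\<And>v. v \<in> V \<Longrightarrow> deg m E v = 3" and e: "e \<in> E"
  shows "even (card {Q. Q \<subseteq> E \<and> hamiltonian_factor m V Q \<and> e \<in> Q})"
proof -
  define \<Q> where "\<Q> = {Q. Q \<subseteq> E \<and> (\<forall>v\<in>V. deg m Q v = 2) \<and> e \<in> Q}"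
  have f\<Q>: "finite \<Q>" by (rule finite_subset[of _ "Pow E"]) (auto simp: \<Q>_def finite_E)
  \<comment> \<open>No edge leaves \<open>V\<close>, so the degree sum \<open>3 * card V\<close> is
    even; alternations of a Hamilton cycle exist only for even \<open>card V\<close>.\<close>
  have "edge_cut m E V = {}" using m_sub by (auto simp: edge_cut_def)
  then have "even (\<Sum>v\<in>V. deg m E v)"
    using even_sum_deg_iff_even_edge_cut[of V E m] finite_V finite_E card_m by simp
  then have ev: "even (card V)" using cubic by simp
  have "even (card (Sigma \<Q> (\<lambda>Q. alternations Q e)))"
  proof (rule even_card_involution[of _ "\<lambda>(Q, X). (X \<union> (E - Q), X)"])
    show "finite (Sigma \<Q> (\<lambda>Q. alternations Q e))"
      using f\<Q> by (intro finite_SigmaI) (auto simp: \<Q>_def intro: finite_alternations)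
    fix p assume "p \<in> Sigma \<Q> (\<lambda>Q. alternations Q e)"
    then obtain Q X where p: "p = (Q, X)" and Q: "Q \<subseteq> E" "\<And>v. v \<in> V \<Longrightarrow> deg m Q v = 2"
      and X: "X \<subseteq> Q" "\<And>v. v \<in> V \<Longrightarrow> deg m X v = 1" "e \<in> X"
      by (auto simp: \<Q>_def alternations_def)
    have "deg m (X \<union> (E - Q)) v = 2" if "v \<in> V" for v
    proof -
      have fQ: "finite Q" and fX: "finite X"
        using Q X finite_E by (meson finite_subset)+
      have "X \<union> (E - Q) = E - (Q - X)" using X Q by auto
      moreover have "deg m (Q - X) v = 1"
        using deg_diff[of Q v m X] fQ X(1) X(2)[OF that] Q(2)[OF that] by simp
      moreover have "Q - X \<subseteq> E" using Q by blast
      ultimately show ?thesis using deg_diff[of E v m "Q - X"] finite_E cubic[OF that] by simp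
    qed
    then show "(case p of (Q, X) \<Rightarrow> (X \<union> (E - Q), X)) \<in> Sigma \<Q> (\<lambda>Q. alternations Q e)"
      using X Q by (auto simp: p \<Q>_def alternations_def)
    show "(case (case p of (Q, X) \<Rightarrow> (X \<union> (E - Q), X)) of (Q, X) \<Rightarrow> (X \<union> (E - Q), X)) = p"
      using X Q by (auto simp: p)
    \<comment> \<open>A fixed point would give \<open>Q \<subseteq> X\<close>, but at an endvertex
      of \<open>e\<close> the degrees in \<open>X\<close> and \<open>Q\<close> are 1 and 2.\<close>
    obtain a where "a \<in> m e" "a \<in> V" using endpoint[OF e] by blast
    then have "deg m X a = 1" "deg m Q a = 2" using X Q by blast+
    then have "X \<noteq> Q" by auto
    then show "(case p of (Q, X) \<Rightarrow> (X \<union> (E - Q), X)) \<noteq> p" using X Q by (auto simp: p)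
  qed
  moreover have "card (Sigma \<Q> (\<lambda>Q. alternations Q e)) = (\<Sum>Q\<in>\<Q>. card (alternations Q e))"
    using f\<Q> by (subst card_SigmaI) (auto simp: \<Q>_def intro: finite_alternations)
  ultimately have "even (card {Q \<in> \<Q>. odd (card (alternations Q e))})"
    using f\<Q> by (simp add: even_sum_iff)
  moreover have "odd (card (alternations Q e)) \<longleftrightarrow> hamiltonian_factor m V Q" if "Q \<in> \<Q>" for Q
  proof
    assume "odd (card (alternations Q e))"
    then show "hamiltonian_factor m V Q"
      using even_alternations_disconnected[of Q e] that by (auto simp: \<Q>_def)
  next
    assume H: "hamiltonian_factor m V Q"
    have "Q \<subseteq> E" "e \<in> Q" using that by (auto simp: \<Q>_def)
    then obtain X where X: "X \<in> alternations Q e" using alternation_exists[OF ev _ H] by blast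
    then have "alternations Q e = {X}" using alternation_unique[OF \<open>Q \<subseteq> E\<close> H _ X] by blast
    then show "odd (card (alternations Q e))" by simp
  qed
  then have "{Q \<in> \<Q>. odd (card (alternations Q e))} = {Q \<in> \<Q>. hamiltonian_factor m V Q}" by blast
  ultimately have "even (card {Q \<in> \<Q>. hamiltonian_factor m V Q})" by simp
  moreover have "{Q \<in> \<Q>. hamiltonian_factor m V Q} = {Q. Q \<subseteq> E \<and> hamiltonian_factor m V Q \<and> e \<in> Q}"
    by (auto simp: \<Q>_def hamiltonian_factor_def)
  ultimately show ?thesis by simp
qed

text \<open>The number containing an edge is even, so the number avoiding it has the parity of the
  total, for every edge alike.\<close>

corollary Smith_avoiding:
  assumes cubic: "\<And>v. v \<in> V \<Longrightarrow> deg m E v = 3" and e: "e \<in> E" and f: "f \<in> E"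
  shows "even (card {Q. Q \<subseteq> E \<and> hamiltonian_factor m V Q \<and> e \<notin> Q}) \<longleftrightarrow>
    even (card {Q. Q \<subseteq> E \<and> hamiltonian_factor m V Q \<and> f \<notin> Q})"
proof -
  let ?H = "\<lambda>Q. Q \<subseteq> E \<and> hamiltonian_factor m V Q"
  have *: "even (card {Q. ?H Q \<and> e \<notin> Q}) \<longleftrightarrow> even (card {Q. ?H Q})" if "e \<in> E" for e
  proof -
    have "{Q. ?H Q} \<subseteq> Pow E" by blast
    then have fin: "finite {Q. ?H Q}" by (rule finite_subset) (simp add: finite_E)
    have "card {Q. ?H Q} = card ({Q. ?H Q \<and> e \<in> Q} \<union> {Q. ?H Q \<and> e \<notin> Q})"
      by (rule arg_cong[of _ _ card]) blast
    also have "\<dots> = card {Q. ?H Q \<and> e \<in> Q} + card {Q. ?H Q \<and> e \<notin> Q}"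
    proof (rule card_Un_disjoint)
      show "finite {Q. ?H Q \<and> e \<in> Q}" "finite {Q. ?H Q \<and> e \<notin> Q}"
        by (rule finite_subset[OF _ fin], blast)+
    qed blast
    finally show ?thesis using Smith[OF cubic that] by (simp add: conj_assoc)
  qed
  show ?thesis using *[OF e] *[OF f] by (simp only: conj_assoc)
qed

end

section \<open>Edge-disjoint rays and finite cuts\<close>

text \<open>Koenig's lemma, applied to the tree of shortest paths from \<open>S\<close>; the distance to \<open>S\<close> makes the
  resulting sequence injective.\<close>

lemma koenig_ray:
  fixes r :: "('a \<times> 'a) set"
  assumes S: "finite S" and fin: "\<And>v. finite (r `` {v})" and inf: "infinite (r\<^sup>* `` S)"
  obtains u :: "nat \<Rightarrow> 'a" where "u 0 \<in> S" "\<And>i. (u i, u (Suc i)) \<in> r" "inj u" "\<And>i. u (Suc i) \<notin> S"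
proof -
  define reach where "reach = r\<^sup>* `` S"
  define d where "d v = (LEAST n. \<exists>s\<in>S. (s, v) \<in> r ^^ n)" for v
  define T where "T = {(x, y) \<in> r. d y = Suc (d x)}"
  have ex: "\<exists>n. \<exists>s\<in>S. (s, v) \<in> r ^^ n" if "v \<in> reach" for v
    using that rtrancl_imp_relpow unfolding reach_def by fast
  have dI: "\<exists>s\<in>S. (s, v) \<in> r ^^ d v" if "v \<in> reach" for v
    unfolding d_def using ex[OF that] by (rule LeastI_ex)
  have d0: "d s = 0" if "s \<in> S" for s
    unfolding d_def using that by (intro Least_equality) auto
  \<comment> \<open>Shortest walks use only arcs of \<open>T\<close>, so \<open>T\<close> reaches
    from \<open>S\<close> everything that \<open>r\<close> reaches.\<close>
  have inT: "v \<in> T\<^sup>* `` S" if "v \<in> reach" "d v = n" for v n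
    using that
  proof (induction n arbitrary: v)
    case 0
    then show ?case using dI[of v] by auto
  next
    case (Suc n)
    then obtain s where s: "s \<in> S" "(s, v) \<in> r ^^ Suc n" using dI[of v] by auto
    then obtain w where w: "(s, w) \<in> r ^^ n" "(w, v) \<in> r" by auto
    have wr: "w \<in> reach" using relpow_imp_rtrancl[OF w(1)] s(1) unfolding reach_def by blast
    have "d w \<le> n" unfolding d_def using s(1) w(1) by (intro Least_le) blast
    moreover have "Suc n \<le> Suc (d w)"
    proof -
      obtain s' where s': "s' \<in> S" "(s', w) \<in> r ^^ d w" using dI[OF wr] by blast
      then have "(s', v) \<in> r ^^ Suc (d w)" using w(2) by auto
      then have "d v \<le> Suc (d w)" unfolding d_def[of v] using s'(1) by (intro Least_le) blast
      then show ?thesis using Suc.prems by simp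
    qed
    ultimately have dw: "d w = n" by simp
    have "w \<in> T\<^sup>* `` S" using Suc.IH[OF wr dw] .
    moreover have "(w, v) \<in> T" using w(2) dw Suc.prems by (simp add: T_def)
    ultimately show ?case by (auto intro: rtrancl_into_rtrancl)
  qed
  have "reach \<subseteq> (\<Union>s\<in>S. T\<^sup>* `` {s})" using inT by blast
  then have "\<exists>s\<in>S. infinite (T\<^sup>* `` {s})"
    using inf S unfolding reach_def[symmetric] by (meson finite_UN_I finite_subset)
  then obtain s where s: "s \<in> S" "infinite (T\<^sup>* `` {s})" by blast
  \<comment> \<open>Finitely many successors cover all that is reachable from \<open>x\<close>
    except \<open>x\<close> itself, so one of them inherits an infinite reach.\<close>
  have step: "\<exists>y. infinite (T\<^sup>* `` {y}) \<and> (x, y) \<in> T" if "infinite (T\<^sup>* `` {x})" for x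
  proof (rule ccontr)
    assume *: "\<not> ?thesis"
    have "T\<^sup>* `` {x} \<subseteq> {x} \<union> (\<Union>y\<in>T `` {x}. T\<^sup>* `` {y})"
      by (auto elim: converse_rtranclE)
    moreover have "finite (T `` {x})"
      by (rule finite_subset[OF _ fin[of x]]) (auto simp: T_def)
    then have "finite ({x} \<union> (\<Union>y\<in>T `` {x}. T\<^sup>* `` {y}))" using * by blast
    ultimately show False using that finite_subset by blast
  qed
  obtain u where u0: "u 0 = s" and u: "\<And>i. infinite (T\<^sup>* `` {u i})" "\<And>i. (u i, u (Suc i)) \<in> T"
  proof -
    define nx where "nx x = (SOME y. infinite (T\<^sup>* `` {y}) \<and> (x, y) \<in> T)" for x
    have nx: "infinite (T\<^sup>* `` {nx x}) \<and> (x, nx x) \<in> T" if "infinite (T\<^sup>* `` {x})" for x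
      unfolding nx_def by (rule someI_ex[OF step[OF that]])
    have "infinite (T\<^sup>* `` {(nx ^^ i) s})" for i
      by (induction i) (use s nx in auto)
    then show thesis using nx by (intro that[of "\<lambda>i. (nx ^^ i) s"]) auto
  qed
  have du: "d (u i) = i" for i
    by (induction i) (use u(2) d0[OF s(1)] u0 in \<open>auto simp: T_def\<close>)
  show thesis
  proof
    show "u 0 \<in> S" using u0 s by simp
    show "(u i, u (Suc i)) \<in> r" for i using u(2) by (auto simp: T_def)
    show "inj u" by (rule inj_on_inverseI[of _ d]) (simp add: du)
    show "u (Suc i) \<notin> S" for i using d0 du[of "Suc i"] by auto
  qed
qed

locale locally_finite_graph =
  fixes G :: "'a ugraph"
  assumes simple: "simple_graph G"
    and locally_finite: "v \<in> verts G \<Longrightarrow> finite {e \<in> edges G. v \<in> e}"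
begin

section \<open>Edges, neighbours and boundaries in locally finite graphs\<close>

abbreviation "V \<equiv> verts G"
abbreviation "E \<equiv> edges G"
abbreviation "boundary F W \<equiv> edge_cut (\<lambda>e. e) F W"

lemma edge_sub: "e \<in> E \<Longrightarrow> e \<subseteq> V" and card_edge: "e \<in> E \<Longrightarrow> card e = 2"
  using simple by (auto simp: simple_graph_def)

lemma edge_ends: "{u, v} \<in> E \<Longrightarrow> u \<in> V \<and> v \<in> V \<and> u \<noteq> v"
  using edge_sub[of "{u, v}"] card_edge[of "{u, v}"] by auto

lemma edge_cases:
  assumes "e \<in> E"
  obtains u v where "e = {u, v}" "u \<noteq> v" "u \<in> V" "v \<in> V"
  using card_edge[OF assms] edge_sub[OF assms] by (auto simp: card_2_iff)

lemma edge_cases_at: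
  assumes "e \<in> E" "u \<in> e"
  obtains v where "e = {u, v}" "u \<noteq> v" "u \<in> V" "v \<in> V"
  by (rule edge_cases[OF assms(1)]) (use assms(2) that in \<open>auto simp: insert_commute\<close>)

lemma finite_nbrs: "finite {w. {v, w} \<in> E}"
proof (cases "v \<in> V")
  case True
  have "(\<lambda>w. {v, w}) ` {w. {v, w} \<in> E} \<subseteq> {e \<in> E. v \<in> e}" by auto
  then have "finite ((\<lambda>w. {v, w}) ` {w. {v, w} \<in> E})"
    using locally_finite[OF True] finite_subset by blast
  moreover have "inj_on (\<lambda>w. {v, w}) {w. {v, w} \<in> E}" by (auto simp: inj_on_def doubleton_eq_iff)
  ultimately show ?thesis by (rule finite_imageD)
next
  case False
  then have "{w. {v, w} \<in> E} = {}" using edge_ends by blast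
  then show ?thesis by (simp only: finite.emptyI)
qed

lemma finite_boundary:
  assumes "finite W"
  shows "finite (boundary E W)"
proof -
  have "boundary E W \<subseteq> (\<Union>v\<in>W \<inter> V. {e \<in> E. v \<in> e})"
    using edge_sub by (auto simp: edge_cut_def)
  then show ?thesis by (rule finite_subset) (use assms locally_finite in auto)
qed

text \<open>Integral flows with capacity one out of \<open>S\<close>, given by their sets of arcs. Arcs into \<open>S\<close> are
  excluded, so the arcs leaving \<open>S\<close> give the value of the flow.\<close>

definition flow :: "'a set \<Rightarrow> ('a \<times> 'a) set \<Rightarrow> bool" where
  "flow S F \<longleftrightarrow> (\<forall>u v. (u, v) \<in> F \<longrightarrow> {u, v} \<in> E \<and> (v, u) \<notin> F \<and> v \<notin> S) \<and>
     (\<forall>v. v \<notin> S \<longrightarrow> card (F `` {v}) = card (F\<inverse> `` {v}))"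

definition flow_value :: "'a set \<Rightarrow> ('a \<times> 'a) set \<Rightarrow> nat" where
  "flow_value S F = card (F \<inter> S \<times> UNIV)"

lemma flowD:
  assumes "flow S F"
  shows "(u, v) \<in> F \<Longrightarrow> {u, v} \<in> E" "(u, v) \<in> F \<Longrightarrow> (v, u) \<notin> F" "(u, v) \<in> F \<Longrightarrow> v \<notin> S"
    "v \<notin> S \<Longrightarrow> card (F `` {v}) = card (F\<inverse> `` {v})"
  using assms by (auto simp: flow_def)

lemma finite_flow_Image:
  assumes "flow S F"
  shows "finite (F `` {v})" "finite (F\<inverse> `` {v})"
proof -
  have "F `` {v} \<subseteq> {w. {v, w} \<in> E}" "F\<inverse> `` {v} \<subseteq> {w. {v, w} \<in> E}"
    using flowD(1)[OF assms, of v] flowD(1)[OF assms, of _ v] by (auto simp: insert_commute[of v])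
  then show "finite (F `` {v})" "finite (F\<inverse> `` {v})"
    using finite_nbrs finite_subset by blast+
qed

lemma card_arcs_from:
  assumes "finite R" "\<And>v. finite (F `` {v})"
  shows "card (F \<inter> R \<times> UNIV) = (\<Sum>v\<in>R. card (F `` {v}))"
proof -
  have "F \<inter> R \<times> UNIV = Sigma R (\<lambda>v. F `` {v})" by auto
  then show ?thesis using assms by (simp add: card_SigmaI)
qed

lemma card_arcs_to:
  assumes "finite R" "\<And>v. finite (F\<inverse> `` {v})"
  shows "card (F \<inter> UNIV \<times> R) = (\<Sum>v\<in>R. card (F\<inverse> `` {v}))"
proof -
  have "(F \<inter> UNIV \<times> R)\<inverse> = F\<inverse> \<inter> R \<times> UNIV" by auto
  then have "card (F \<inter> UNIV \<times> R) = card (F\<inverse> \<inter> R \<times> UNIV)" by (metis card_inverse)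
  then show ?thesis using card_arcs_from[OF assms] by simp
qed

text \<open>There is no sink: whatever leaves \<open>S\<close> escapes to infinity, so the net flow
  out of each finite set around \<open>S\<close> equals the value.\<close>

lemma flow_conservation:
  assumes f: "flow S F" and R: "finite R" "S \<subseteq> R"
  shows "card (F \<inter> R \<times> (- R)) = flow_value S F + card (F \<inter> (- R) \<times> R)"
proof -
  have fS: "finite S" using R finite_subset by blast
  have fin: "finite (F \<inter> R \<times> UNIV)" "finite (F \<inter> UNIV \<times> R)"
  proof -
    have "F \<inter> R \<times> UNIV = Sigma R (\<lambda>v. F `` {v})" by auto
    then show "finite (F \<inter> R \<times> UNIV)" using R finite_flow_Image[OF f] by auto
    have "F \<inter> UNIV \<times> R = (Sigma R (\<lambda>v. F\<inverse> `` {v}))\<inverse>" by auto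
    then show "finite (F \<inter> UNIV \<times> R)" using R finite_flow_Image[OF f] by auto
  qed
  have S0: "card (F\<inverse> `` {v}) = 0" if "v \<in> S" for v
  proof -
    have "F\<inverse> `` {v} = {}" using flowD(3)[OF f] that by auto
    then show ?thesis by simp
  qed
  have split: "(\<Sum>v\<in>R. h v) = (\<Sum>v\<in>S. h v) + (\<Sum>v\<in>R - S. h v)" for h :: "'a \<Rightarrow> nat"
    using sum.subset_diff[OF R(2,1), of h] by simp
  have "card (F \<inter> R \<times> UNIV) = (\<Sum>v\<in>R. card (F `` {v}))"
    using R finite_flow_Image[OF f] by (simp add: card_arcs_from)
  also have "\<dots> = flow_value S F + (\<Sum>v\<in>R - S. card (F `` {v}))"
    using fS finite_flow_Image[OF f] by (simp add: split flow_value_def card_arcs_from)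
  also have "(\<Sum>v\<in>R - S. card (F `` {v})) = (\<Sum>v\<in>R - S. card (F\<inverse> `` {v}))"
    using flowD(4)[OF f] by (intro sum.cong) auto
  also have "\<dots> = (\<Sum>v\<in>R. card (F\<inverse> `` {v}))"
    using S0 by (simp add: split)
  also have "\<dots> = card (F \<inter> UNIV \<times> R)"
    using R finite_flow_Image[OF f] by (simp add: card_arcs_to)
  finally have "card (F \<inter> R \<times> UNIV) = flow_value S F + card (F \<inter> UNIV \<times> R)" .
  moreover have "card (F \<inter> R \<times> UNIV) = card (F \<inter> R \<times> R) + card (F \<inter> R \<times> (- R))"
    using fin(1) by (subst card_Un_disjoint[symmetric]) (auto intro: finite_subset[OF _ fin(1)] intro!: arg_cong[of _ _ card])
  moreover have "card (F \<inter> UNIV \<times> R) = card (F \<inter> R \<times> R) + card (F \<inter> (- R) \<times> R)"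
    using fin(2) by (subst card_Un_disjoint[symmetric]) (auto intro: finite_subset[OF _ fin(2)] intro!: arg_cong[of _ _ card])
  ultimately show ?thesis by simp
qed

section \<open>Removing rays from flows and augmenting flows along rays\<close>

definition arcs_of :: "(nat \<Rightarrow> 'a) \<Rightarrow> ('a \<times> 'a) set" where
  "arcs_of u = {(u i, u (Suc i)) | i. True}"

lemma arcs_of_at:
  assumes "inj u"
  shows "arcs_of u `` {u j} = {u (Suc j)}" "(arcs_of u)\<inverse> `` {u (Suc j)} = {u j}"
    "(arcs_of u)\<inverse> `` {u 0} = {}"
  using assms by (auto simp: arcs_of_def inj_eq)

lemma arcs_of_notin:
  assumes "v \<notin> range u"
  shows "arcs_of u `` {v} = {}" "(arcs_of u)\<inverse> `` {v} = {}"
  using assms by (auto simp: arcs_of_def)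

text \<open>Outside \<open>S\<close> the ray takes one arc in and one arc out at each of its
  vertices, so balance is kept. It never returns to \<open>S\<close>, so the value loses only its
  first arc.\<close>

lemma flow_remove_ray:
  assumes f: "flow S F" and S: "finite S"
    and u: "u 0 \<in> S" "\<And>i. (u i, u (Suc i)) \<in> F" "inj u" "\<And>i. u (Suc i) \<notin> S"
  shows "flow S (F - arcs_of u)" "flow_value S F = Suc (flow_value S (F - arcs_of u))"
proof -
  let ?F = "F - arcs_of u"
  show "flow S ?F"
    unfolding flow_def
  proof (intro conjI allI impI)
    fix v assume v: "v \<notin> S"
    have im: "?F `` {v} = F `` {v} - arcs_of u `` {v}" "?F\<inverse> `` {v} = F\<inverse> `` {v} - (arcs_of u)\<inverse> `` {v}"
      by auto
    show "card (?F `` {v}) = card (?F\<inverse> `` {v})"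
    proof (cases "v \<in> range u")
      case True
      then obtain j where j: "v = u (Suc j)" using v u(1) by (metis imageE not0_implies_Suc)
      have "u (Suc (Suc j)) \<in> F `` {v}" "u j \<in> F\<inverse> `` {v}" using u(2) j by auto
      then show ?thesis using flowD(4)[OF f v] finite_flow_Image[OF f]
        unfolding im unfolding j arcs_of_at[OF u(3)] by (simp add: card_Diff_singleton)
    next
      case False
      then show ?thesis using flowD(4)[OF f v] by (simp add: im arcs_of_notin)
    qed
  qed (use flowD[OF f] in auto)
  have "F \<inter> S \<times> UNIV = Sigma S (\<lambda>v. F `` {v})" by auto
  then have "finite (F \<inter> S \<times> UNIV)" using S finite_flow_Image[OF f] by auto
  moreover have "?F \<inter> S \<times> UNIV = F \<inter> S \<times> UNIV - {(u 0, u 1)}"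
  proof -
    have "(x, y) \<in> arcs_of u \<longleftrightarrow> (x, y) = (u 0, u 1)" if "x \<in> S" for x y
    proof
      assume "(x, y) \<in> arcs_of u"
      then obtain i where i: "x = u i" "y = u (Suc i)" by (auto simp: arcs_of_def)
      then show "(x, y) = (u 0, u 1)" using that u(4) by (cases i) auto
    qed (auto simp: arcs_of_def)
    then show ?thesis by auto
  qed
  moreover have "(u 0, u 1) \<in> F \<inter> S \<times> UNIV" using u(1) u(2)[of 0] by simp
  ultimately show "flow_value S F = Suc (flow_value S ?F)"
    unfolding flow_value_def by (metis card.remove)
qed

text \<open>The ray \<open>u\<close> acts as an augmenting path whose sink is at infinity. Its steps
  may use free edges or run against arcs of \<open>F\<close>, but not along them.\<close>

lemma flow_augment:
  assumes f: "flow S F" and S: "finite S"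
    and u: "u 0 \<in> S" "\<And>i. {u i, u (Suc i)} \<in> E" "\<And>i. (u i, u (Suc i)) \<notin> F" "inj u"
      "\<And>i. u (Suc i) \<notin> S"
  shows "\<exists>F'. flow S F' \<and> flow_value S F' = Suc (flow_value S F)"
proof -
  define P where "P = arcs_of u"
  \<comment> \<open>Steps of \<open>P\<close> against arcs of \<open>F\<close> cancel these arcs;
    the other steps become new arcs.\<close>
  define F' where "F' = (F - P\<inverse>) \<union> (P - F\<inverse>)"
  have Pa: "(y, x) \<notin> P" if "(x, y) \<in> P" for x y
    using that u(4) by (auto simp: P_def arcs_of_def inj_eq)
  have PE: "{x, y} \<in> E \<and> (x, y) \<notin> F \<and> y \<notin> S" if "(x, y) \<in> P" for x y
    using that u by (auto simp: P_def arcs_of_def)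
  have "flow S F'"
    unfolding flow_def
  proof (intro conjI allI impI)
    fix v assume v: "v \<notin> S"
    have im: "F' `` {v} = (F `` {v} - P\<inverse> `` {v}) \<union> (P `` {v} - F\<inverse> `` {v})"
      "F'\<inverse> `` {v} = (F\<inverse> `` {v} - P `` {v}) \<union> (P\<inverse> `` {v} - F `` {v})"
      by (auto simp: F'_def)
    show "card (F' `` {v}) = card (F'\<inverse> `` {v})"
    proof (cases "v \<in> range u")
      case True
      then obtain j where j: "v = u (Suc j)" using v u(1) by (metis imageE not0_implies_Suc)
      define a b where "a = u j" and "b = u (Suc (Suc j))"
      have P: "P `` {v} = {b}" "P\<inverse> `` {v} = {a}"
        unfolding P_def j a_def b_def by (rule arcs_of_at[OF u(4)])+
      have "a \<noteq> b" unfolding a_def b_def using u(4) by (simp add: inj_eq)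
      have ab: "b \<notin> F `` {v}" "a \<notin> F\<inverse> `` {v}" using u(3) by (auto simp: a_def b_def j)
      have fin: "finite (F `` {v})" "finite (F\<inverse> `` {v})" and eq: "card (F `` {v}) = card (F\<inverse> `` {v})"
        using finite_flow_Image[OF f] flowD(4)[OF f v] by auto
      \<comment> \<open>\<open>A\<close> and \<open>B\<close> stand for the out- and in-neighbours
        of \<open>v\<close>. The step from \<open>a\<close> cancels an outgoing arc or adds an
        incoming one, the step to \<open>b\<close> cancels an incoming arc or adds an outgoing one;
        all four combinations keep the balance.\<close>
      have c: "card (A - {a} \<union> ({b} - B)) = card (B - {b} \<union> ({a} - A))"
        if "finite A" "finite B" "card A = card B" "b \<notin> A" "a \<notin> B" for A B :: "'a set"
      proof -
        have "0 < card B" if "b \<in> B" using that \<open>finite B\<close> card_gt_0_iff by blast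
        moreover have "0 < card A" if "a \<in> A" using that \<open>finite A\<close> card_gt_0_iff by blast
        ultimately show ?thesis using that \<open>a \<noteq> b\<close>
          by (cases "a \<in> A"; cases "b \<in> B") (auto simp: card_Diff_singleton card_insert_if insert_Diff_if)
      qed
      show ?thesis unfolding im P by (rule c[OF fin eq ab])
    next
      case False
      then show ?thesis using flowD(4)[OF f v] by (simp add: im P_def arcs_of_notin)
    qed
  next
    fix x y assume xy: "(x, y) \<in> F'"
    then show "{x, y} \<in> E" "(y, x) \<notin> F'" "y \<notin> S"
      using PE Pa flowD(1-3)[OF f] unfolding F'_def by blast+
  qed
  moreover have "flow_value S F' = Suc (flow_value S F)"
  proof -
    have "F \<inter> S \<times> UNIV = Sigma S (\<lambda>v. F `` {v})" by auto
    then have fin: "finite (F \<inter> S \<times> UNIV)" using S finite_flow_Image[OF f] by auto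
    have P0: "P \<inter> S \<times> UNIV = {(u 0, u 1)}"
    proof -
      have "x = u 0 \<and> y = u 1" if "(x, y) \<in> P" "x \<in> S" for x y
      proof -
        obtain i where i: "x = u i" "y = u (Suc i)" using \<open>(x, y) \<in> P\<close> by (auto simp: P_def arcs_of_def)
        then show ?thesis using that u(5) by (cases i) auto
      qed
      moreover have "(u 0, u 1) \<in> P" by (auto simp: P_def arcs_of_def)
      ultimately show ?thesis using u(1) by blast
    qed
    have "P \<inter> F\<inverse> \<inter> S \<times> UNIV = {}" "F \<inter> P\<inverse> \<inter> S \<times> UNIV = {}"
      using flowD(3)[OF f] PE by blast+
    then have "F' \<inter> S \<times> UNIV = insert (u 0, u 1) (F \<inter> S \<times> UNIV)"
      using P0 unfolding F'_def by blast
    moreover have "(u 0, u 1) \<notin> F" using u(3)[of 0] by simp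
    ultimately show ?thesis using fin by (simp add: flow_value_def)
  qed
  ultimately show ?thesis by blast
qed

text \<open>Ford-Fulkerson with the sink at infinity. If the set \<open>R\<close> reachable in the
  residual graph is infinite, Koenig's lemma supplies an augmenting ray. If it is finite, every edge
  leaving \<open>R\<close> carries flow outwards and none carries it back, so the boundary is no
  larger than the flow value.\<close>

lemma flow_or_cut:
  assumes S: "finite S" "S \<subseteq> V"
  shows "(\<exists>F. flow S F \<and> flow_value S F = n) \<or>
    (\<exists>T. finite T \<and> S \<subseteq> T \<and> T \<subseteq> V \<and> card (boundary E T) < n)"
proof (induction n)
  case 0
  have "flow S {}" "flow_value S {} = 0" by (auto simp: flow_def flow_value_def)
  then show ?case by blast
next
  case (Suc n)
  show ?case
  proof (cases "\<exists>F. flow S F \<and> flow_value S F = n")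
    case False
    then obtain T where T: "finite T" "S \<subseteq> T" "T \<subseteq> V" "card (boundary E T) < n" using Suc by blast
    then have "card (boundary E T) < Suc n" by simp
    with T show ?thesis by blast
  next
    case True
    then obtain F where f: "flow S F" "flow_value S F = n" by blast
    define r where "r = {(x, y). {x, y} \<in> E \<and> (x, y) \<notin> F \<and> y \<notin> S}"
    define R where "R = r\<^sup>* `` S"
    have SR: "S \<subseteq> R" by (auto simp: R_def)
    have "y \<in> V" if "(x, y) \<in> r\<^sup>*" "x \<in> S" for x y
      using that by (induction rule: rtrancl_induct) (use S edge_ends in \<open>auto simp: r_def\<close>)
    then have RV: "R \<subseteq> V" unfolding R_def by blast
    have Rr: "y \<in> R" if "x \<in> R" "(x, y) \<in> r" for x y
      using that unfolding R_def by (auto intro: rtrancl_into_rtrancl)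
    show ?thesis
    proof (cases "finite R")
      case True
      have "F \<inter> (- R) \<times> R = {}"
      proof -
        have False if xy: "(x, y) \<in> F" "x \<notin> R" "y \<in> R" for x y
        proof -
          have "(y, x) \<in> r" using flowD(1,2)[OF f(1) xy(1)] SR xy by (auto simp: r_def insert_commute)
          then show False using Rr xy by blast
        qed
        then show ?thesis by blast
      qed
      then have c: "card (F \<inter> R \<times> (- R)) = n"
        using flow_conservation[OF f(1) True SR] f(2) by simp
      have "boundary E R \<subseteq> (\<lambda>(x, y). {x, y}) ` (F \<inter> R \<times> (- R))"
      proof
        fix e assume e: "e \<in> boundary E R"
        then obtain x where x: "e \<in> E" "x \<in> e" "x \<in> R" "\<not> e \<subseteq> R" by (auto simp: edge_cut_def)
        then obtain y where y: "e = {x, y}" by (metis edge_cases_at)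
        then have "y \<notin> R" using x by auto
        then have "(x, y) \<in> F" using Rr[of x y] x y SR by (auto simp: r_def)
        then show "e \<in> (\<lambda>(x, y). {x, y}) ` (F \<inter> R \<times> (- R))" using x y \<open>y \<notin> R\<close> by force
      qed
      moreover have "finite (F \<inter> R \<times> (- R))"
      proof (rule finite_subset)
        show "F \<inter> R \<times> (- R) \<subseteq> Sigma R (\<lambda>v. F `` {v})" by auto
      qed (use True finite_flow_Image[OF f(1)] in auto)
      ultimately have "card (boundary E R) \<le> n" using c by (metis surj_card_le)
      then show ?thesis using True SR RV by (meson le_imp_less_Suc)
    next
      case False
      have "finite (r `` {v})" for v
        by (rule finite_subset[OF _ finite_nbrs[of v]]) (auto simp: r_def)
      then obtain u where "u 0 \<in> S" "\<And>i. (u i, u (Suc i)) \<in> r" "inj u" "\<And>i. u (Suc i) \<notin> S"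
        using koenig_ray[OF S(1), of r] False unfolding R_def by blast
      then show ?thesis using flow_augment[OF f(1) S(1), of u] f(2) by (auto simp: r_def)
    qed
  qed
qed

text \<open>A flow of positive value reaches infinitely many vertices along its own arcs, since
  nothing would flow out of a finite reachable set. Koenig's lemma then gives a directed ray, which
  is removed before the induction goes on.\<close>

lemma flow_rays:
  assumes "flow S F" "flow_value S F = n" "finite S" "S \<subseteq> V"
  shows "\<exists>\<R>. finite \<R> \<and> card \<R> = n \<and> (\<forall>R\<in>\<R>. ray G R \<and> arcs_of R \<subseteq> F) \<and>
    pairwise (\<lambda>R R'. disjnt (ray_edges R) (ray_edges R')) \<R>"
  using assms(1,2)
proof (induction n arbitrary: F)
  case 0
  then show ?case by (intro exI[of _ "{}"]) auto
next
  case (Suc n)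
  define Q where "Q = F\<^sup>* `` S"
  have "infinite Q"
  proof
    assume fin: "finite Q"
    have "F \<inter> Q \<times> (- Q) = {}" by (auto simp: Q_def intro: rtrancl_into_rtrancl)
    moreover have "S \<subseteq> Q" by (auto simp: Q_def)
    ultimately have "flow_value S F = 0"
      using flow_conservation[OF Suc.prems(1) fin] by simp
    then show False using Suc.prems by simp
  qed
  then obtain u where u: "u 0 \<in> S" "\<And>i. (u i, u (Suc i)) \<in> F" "inj u" "\<And>i. u (Suc i) \<notin> S"
    using koenig_ray[OF assms(3), of F] finite_flow_Image[OF Suc.prems(1)] unfolding Q_def by blast
  define F' where "F' = F - arcs_of u"
  have "flow S F'" "flow_value S F' = n"
    using flow_remove_ray[OF Suc.prems(1) assms(3) u] Suc.prems(2) by (auto simp: F'_def)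
  then obtain \<R> where \<R>: "finite \<R>" "card \<R> = n" "\<And>R. R \<in> \<R> \<Longrightarrow> ray G R \<and> arcs_of R \<subseteq> F'"
    "pairwise (\<lambda>R R'. disjnt (ray_edges R) (ray_edges R')) \<R>"
    using Suc.IH[of F'] by blast
  have uE: "{u i, u (Suc i)} \<in> E" for i using u(2) flowD(1)[OF Suc.prems(1)] by blast
  then have "range u \<subseteq> V" using edge_ends by blast
  then have ru: "ray G u" using u(3) uE by (simp add: ray_def)
  have dj: "disjnt (ray_edges u) (ray_edges R)" if "R \<in> \<R>" for R
  proof -
    \<comment> \<open>The arcs are distinct, and a flow never contains both orientations of an
      edge.\<close>
    have False if "{u i, u (Suc i)} = {R j, R (Suc j)}" for i j
    proof -
      have R: "(R j, R (Suc j)) \<in> F" "(R j, R (Suc j)) \<notin> arcs_of u"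
        using \<R>(3)[OF \<open>R \<in> \<R>\<close>] by (auto simp: F'_def arcs_of_def)
      moreover have "(u i, u (Suc i)) \<in> arcs_of u" by (auto simp: arcs_of_def)
      ultimately show False using that u(2)[of i] flowD(2)[OF Suc.prems(1), of "u i" "u (Suc i)"]
        by (auto simp: doubleton_eq_iff)
    qed
    then show ?thesis by (auto simp: disjnt_def ray_edges_def)
  qed
  have "u \<notin> \<R>"
  proof
    assume "u \<in> \<R>"
    from dj[OF this] show False by (auto simp: disjnt_def ray_edges_def)
  qed
  moreover have "pairwise (\<lambda>R R'. disjnt (ray_edges R) (ray_edges R')) (insert u \<R>)"
    using \<R>(4) dj by (auto simp: pairwise_insert disjnt_sym)
  moreover have "arcs_of u \<subseteq> F" using u(2) by (auto simp: arcs_of_def)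
  moreover have "arcs_of R \<subseteq> F" if "R \<in> \<R>" for R using \<R>(3)[OF that] by (auto simp: F'_def)
  ultimately show ?case using \<R>(1-3) ru
    by (intro exI[of _ "insert u \<R>"]) auto
qed

text \<open>The edge version of Menger's theorem between \<open>S\<close> and infinity. The rays are
  not tied to a particular end, as the graph to which this is applied has only one.\<close>

theorem disjoint_rays_or_cut:
  assumes "finite S" "S \<subseteq> V"
  shows "(\<exists>\<R>. finite \<R> \<and> card \<R> = n \<and> (\<forall>R\<in>\<R>. ray G R) \<and>
      pairwise (\<lambda>R R'. disjnt (ray_edges R) (ray_edges R')) \<R>) \<or>
    (\<exists>T. finite T \<and> S \<subseteq> T \<and> T \<subseteq> V \<and> card (boundary E T) < n)"
  using flow_or_cut[OF assms, of n]
proof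
  assume "\<exists>F. flow S F \<and> flow_value S F = n"
  then obtain F where "flow S F" "flow_value S F = n" by blast
  from flow_rays[OF this assms] obtain \<R> where "finite \<R>" "card \<R> = n" "\<forall>R\<in>\<R>. ray G R"
    "pairwise (\<lambda>R R'. disjnt (ray_edges R) (ray_edges R')) \<R>" by auto
  then show ?thesis by (intro disjI1 exI[of _ \<R>] conjI)
qed (rule disjI2)

text \<open>Each ray starts in the finite set \<open>T\<close> and must leave it through a boundary
  edge; disjoint rays use different ones.\<close>

lemma card_disjoint_rays_le_cut:
  assumes \<R>: "finite \<R>" "\<And>R. R \<in> \<R> \<Longrightarrow> ray G R \<and> R 0 \<in> T"
    "pairwise (\<lambda>R R'. disjnt (ray_edges R) (ray_edges R')) \<R>"
    and T: "finite T"
  shows "card \<R> \<le> card (boundary E T)"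
proof -
  have "\<exists>e. e \<in> ray_edges R \<and> e \<in> boundary E T" if "R \<in> \<R>" for R
  proof -
    have R: "inj R" "\<And>n. {R n, R (Suc n)} \<in> E" "R 0 \<in> T" using \<R>(2)[OF that] by (auto simp: ray_def)
    have "\<exists>n. R n \<notin> T"
      using range_inj_infinite[OF R(1)] finite_subset[OF _ T, of "range R"] by blast
    define n where "n = (LEAST n. R n \<notin> T)"
    have n: "R n \<notin> T" "\<And>k. k < n \<Longrightarrow> R k \<in> T"
      unfolding n_def using LeastI_ex[OF \<open>\<exists>n. R n \<notin> T\<close>] not_less_Least by auto
    then obtain k where k: "n = Suc k" using R(3) by (cases n) auto
    then have "{R k, R (Suc k)} \<in> boundary E T" using n R(2) by (auto simp: edge_cut_def)
    then show ?thesis by (auto simp: ray_edges_def)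
  qed
  then obtain g where g: "\<And>R. R \<in> \<R> \<Longrightarrow> g R \<in> ray_edges R \<and> g R \<in> boundary E T" by metis
  have "inj_on g \<R>"
  proof (rule inj_onI, rule ccontr)
    fix R R' assume R: "R \<in> \<R>" "R' \<in> \<R>" "g R = g R'" "R \<noteq> R'"
    then have "disjnt (ray_edges R) (ray_edges R')" using \<R>(3) by (auto simp: pairwise_def)
    then show False using g[OF R(1)] g[OF R(2)] R(3) by (auto simp: disjnt_def)
  qed
  then show ?thesis using g finite_boundary[OF T] by (intro card_inj_on_le[of g]) auto
qed

end

section \<open>One-ended cubic graphs\<close>

lemma sym_adj: "sym (adj G)"
  by (auto simp: adj_def sym_def insert_commute)

lemma component_eq:
  assumes "w \<in> component G v"
  shows "component G w = component G v"
proof -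
  have vw: "(v, w) \<in> (adj G)\<^sup>*" using assms by (simp add: component_def)
  then have "(w, v) \<in> (adj G)\<^sup>*" using sym_rtrancl[OF sym_adj] by (meson symD)
  with vw show ?thesis unfolding component_def by (blast intro: rtrancl_trans)
qed

text \<open>A ray meets the finite set \<open>S\<close> only finitely often, and a tail that avoids
  \<open>S\<close> is connected.\<close>

lemma ray_tail_component:
  assumes R: "ray G R" and S: "finite S"
  obtains C where "C \<in> graph_components (delete_verts G S)" "has_tail_in R C"
proof -
  let ?D = "delete_verts G S"
  have injR: "inj R" and RE: "\<And>n. {R n, R (Suc n)} \<in> edges G" and RV: "\<And>n. R n \<in> verts G"
    using R by (auto simp: ray_def)
  have "finite (R -` S)" using S injR by (rule finite_vimageI)
  then obtain m where "\<forall>n\<in>R -` S. n < m" unfolding finite_nat_set_iff_bounded by blast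
  then have m: "R n \<notin> S" if "n \<ge> m" for n using that by (auto simp: not_le[symmetric])
  have "(R m, R n) \<in> (adj ?D)\<^sup>*" if "n \<ge> m" for n
    using that
  proof (induction n rule: dec_induct)
    case (step n)
    have "(R n, R (Suc n)) \<in> adj ?D"
      using m[of n] m[of "Suc n"] RE[of n] step by (simp add: adj_def delete_verts_def)
    with step show ?case by auto
  qed simp
  then have "R n \<in> component ?D (R m)" if "n \<ge> m" for n
    using that m[of n] RV[of n] by (simp add: component_def delete_verts_def)
  then have "has_tail_in R (component ?D (R m))" by (auto simp: has_tail_in_def)
  moreover have "component ?D (R m) \<in> graph_components ?D"
    using m[of m] RV[of m] by (auto simp: graph_components_def delete_verts_def)
  ultimately show thesis using that by blast
qed

section \<open>Compactness of the space of subsets\<close>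

lemma compact_UNIV_bool_fun: "compact (UNIV :: ('e \<Rightarrow> bool) set)"
proof -
  have "compact_space (product_topology (\<lambda>i::'e. euclidean :: bool topology) UNIV)"
    unfolding compact_space_product_topology by (simp add: compact_space_def finite_imp_compact)
  then show ?thesis by (simp add: euclidean_product_topology compact_space_def)
qed

text \<open>Choices \<open>X S\<close> indexed by the finite sets \<open>S\<close> have a cluster
  point \<open>L\<close> in the compact space of all subsets (Tychonoff). Agreement with
  \<open>L\<close> on a finite \<open>\<Phi>\<close> defines a neighbourhood of \<open>L\<close>,
  which therefore contains the choice for some larger \<open>S'\<close>; \<open>anti\<close> carries
  the property down to \<open>S\<close>.\<close>

lemma compactness_sets:
  fixes P :: "'a set \<Rightarrow> 'e set \<Rightarrow> bool"
  assumes ex: "\<And>S. finite S \<Longrightarrow> \<exists>X. P S X"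
    and anti: "\<And>S S' X. S \<subseteq> S' \<Longrightarrow> P S' X \<Longrightarrow> P S X"
  obtains L where "\<And>S \<Phi>. finite S \<Longrightarrow> finite \<Phi> \<Longrightarrow> \<exists>X. P S X \<and> X \<inter> \<Phi> = L \<inter> \<Phi>"
proof -
  define X where "X S = (SOME X. P S X)" for S
  have X: "P S (X S)" if "finite S" for S unfolding X_def by (rule someI_ex[OF ex[OF that]])
  define F where "F = filtermap (\<lambda>S e. e \<in> X S) (finite_subsets_at_top UNIV)"
  have "F \<noteq> bot" by (simp add: F_def filtermap_bot_iff)
  then obtain x where x: "inf (nhds x) F \<noteq> bot"
    using compact_UNIV_bool_fun unfolding compact_filter by force
  show thesis
  proof
    fix S :: "'a set" and \<Phi> :: "'e set"
    assume S: "finite S" and \<Phi>: "finite \<Phi>"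
    have "open (PiE UNIV (\<lambda>e. if e \<in> \<Phi> then {x e} else UNIV))"
      by (rule open_PiE) (use \<Phi> in \<open>auto simp: open_discrete\<close>)
    then have "eventually (\<lambda>y. y \<in> PiE UNIV (\<lambda>e. if e \<in> \<Phi> then {x e} else UNIV)) (nhds x)"
      by (rule eventually_nhds_in_open) auto
    moreover have "y e = x e" if "y \<in> PiE UNIV (\<lambda>e. if e \<in> \<Phi> then {x e} else UNIV)" "e \<in> \<Phi>" for y e
      using PiE_mem[OF that(1), of e] that(2) by simp
    ultimately have ev1: "eventually (\<lambda>y. \<forall>e\<in>\<Phi>. y e = x e) (nhds x)"
      by (auto elim!: eventually_mono)
    have "eventually (\<lambda>S'. finite S' \<and> S \<subseteq> S') (finite_subsets_at_top UNIV)"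
      using S by (auto simp: eventually_finite_subsets_at_top)
    then have ev2: "eventually (\<lambda>y. \<exists>S'. finite S' \<and> S \<subseteq> S' \<and> y = (\<lambda>e. e \<in> X S')) F"
      unfolding F_def eventually_filtermap by (rule eventually_mono) auto
    have "eventually (\<lambda>y. (\<forall>e\<in>\<Phi>. y e = x e) \<and> (\<exists>S'. finite S' \<and> S \<subseteq> S' \<and> y = (\<lambda>e. e \<in> X S')))
        (inf (nhds x) F)"
      by (rule eventually_conj[OF filter_leD[OF inf_le1 ev1] filter_leD[OF inf_le2 ev2]])
    then obtain y S' where y: "\<forall>e\<in>\<Phi>. y e = x e" "finite S'" "S \<subseteq> S'" "y = (\<lambda>e. e \<in> X S')"
      by (elim eventually_happens'[OF x, THEN exE] conjE exE)
    then have "P S (X S')" using X anti by blast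
    moreover have "X S' \<inter> \<Phi> = {e. x e} \<inter> \<Phi>" using y by auto
    ultimately show "\<exists>X. P S X \<and> X \<inter> \<Phi> = {e. x e} \<inter> \<Phi>" by blast
  qed
qed

locale one_ended_cubic =
  fixes G :: "'a ugraph" and \<omega> :: "(nat \<Rightarrow> 'a) set"
  assumes simple_G: "simple_graph G" and cubic_G: "cubic G"
    and ends_G: "ends G = {\<omega>}" and end_degree_3: "end_degree \<omega> = 3"

sublocale one_ended_cubic \<subseteq> locally_finite_graph G
proof
  show "simple_graph G" by (rule simple_G)
  fix v assume "v \<in> verts G"
  then have "degree G v = 3" using cubic_G by (simp add: cubic_def)
  then show "finite {e \<in> edges G. v \<in> e}" by (auto simp: degree_def Let_def split: if_splits)
qed

context one_ended_cubic
begin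

lemma deg_E: "v \<in> V \<Longrightarrow> deg (\<lambda>e. e) E v = 3"
proof -
  assume "v \<in> V"
  then have "degree G v = 3" using cubic_G by (simp add: cubic_def)
  then show ?thesis
    by (auto simp: degree_def Let_def deg_def numeral_eq_enat split: if_splits)
qed

lemma ray_equiv_refl: "ray G R \<Longrightarrow> (R, R) \<in> ray_equiv G"
  unfolding ray_equiv_def using ray_tail_component[of G R] by blast

text \<open>There is only one equivalence class of rays, so any ray may represent it.\<close>

lemma ray_in_end:
  assumes "ray G R"
  shows "R \<in> \<omega>" "\<omega> = ray_equiv G `` {R}"
proof -
  have "ray_equiv G `` {R} \<in> ends G" using assms unfolding ends_def by (auto intro: quotientI)
  then show "\<omega> = ray_equiv G `` {R}" using ends_G by auto
  then show "R \<in> \<omega>" using ray_equiv_refl[OF assms] by auto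
qed

lemma exists_ray: "\<exists>R. ray G R"
proof -
  have "\<omega> \<in> ends G" using ends_G by simp
  then show ?thesis by (auto simp: ends_def quotient_def)
qed

lemma end_rays: "R \<in> \<omega> \<Longrightarrow> ray G R"
  using exists_ray ray_in_end(2) by (auto simp: ray_equiv_def)

lemma infinite_V: "infinite V"
proof -
  obtain R where "ray G R" using exists_ray by blast
  then have "inj R" "range R \<subseteq> V" by (auto simp: ray_def)
  then show ?thesis using range_inj_infinite finite_subset by blast
qed

text \<open>Equivalent rays share a tail component, so the component found for one ray serves the
  whole end.\<close>

lemma end_lives:
  assumes S: "finite S" "S \<subseteq> V"
  obtains C where "C \<in> graph_components (delete_verts G S)" "lives_in \<omega> C" "C \<subseteq> V - S"
proof -
  obtain R where R: "ray G R" using exists_ray by blast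
  obtain C where C: "C \<in> graph_components (delete_verts G S)" "has_tail_in R C"
    using ray_tail_component[OF R S(1)] by blast
  have "has_tail_in R' C" if "R' \<in> \<omega>" for R'
  proof -
    have "(R, R') \<in> ray_equiv G" using ray_in_end(2)[OF R] that by blast
    then obtain C' where C': "C' \<in> graph_components (delete_verts G S)" "has_tail_in R C'" "has_tail_in R' C'"
      using S by (auto simp: ray_equiv_def)
    obtain k l where "\<And>n. n \<ge> k \<Longrightarrow> R n \<in> C" "\<And>n. n \<ge> l \<Longrightarrow> R n \<in> C'"
      using C(2) C'(2) unfolding has_tail_in_def by blast
    then have "R (max k l) \<in> C \<inter> C'" by simp
    moreover obtain a b where "C = component (delete_verts G S) a" "C' = component (delete_verts G S) b"
      using C(1) C'(1) by (auto simp: graph_components_def)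
    ultimately have "C = C'" using component_eq by (metis IntD1 IntD2)
    with C' show ?thesis by simp
  qed
  then have "lives_in \<omega> C" by (simp add: lives_in_def)
  moreover have "C \<subseteq> V - S" using C(1) by (auto simp: graph_components_def component_def delete_verts_def)
  ultimately show thesis using that C(1) by blast
qed

section \<open>Three-edge cuts from the degree of the end\<close>

definition disjoint_ray_family :: "(nat \<Rightarrow> 'a) set \<Rightarrow> bool" where
  "disjoint_ray_family \<R> \<longleftrightarrow> finite \<R> \<and> (\<forall>R\<in>\<R>. ray G R) \<and>
    pairwise (\<lambda>R R'. disjnt (ray_edges R) (ray_edges R')) \<R>"

lemma end_degree_eq: "end_degree \<omega> = Sup {enat (card \<R>) | \<R>. disjoint_ray_family \<R>}"
proof -
  have "finite \<R> \<and> \<R> \<subseteq> \<omega> \<and> pairwise (\<lambda>R R'. disjnt (ray_edges R) (ray_edges R')) \<R> \<longleftrightarrow>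
    disjoint_ray_family \<R>" for \<R>
    using end_rays ray_in_end(1) by (auto simp: disjoint_ray_family_def)
  then show ?thesis unfolding end_degree_def by simp
qed

lemma card_disjoint_ray_family_le: "disjoint_ray_family \<R> \<Longrightarrow> card \<R> \<le> 3"
proof -
  assume "disjoint_ray_family \<R>"
  then have "enat (card \<R>) \<le> end_degree \<omega>" unfolding end_degree_eq by (intro Sup_upper) blast
  then show ?thesis by (simp add: end_degree_3 numeral_eq_enat)
qed

lemma three_disjoint_rays: "\<exists>\<R>. disjoint_ray_family \<R> \<and> 3 \<le> card \<R>"
proof (rule ccontr)
  assume "\<nexists>\<R>. disjoint_ray_family \<R> \<and> 3 \<le> card \<R>"
  then have "card \<R> \<le> 2" if "disjoint_ray_family \<R>" for \<R> using that by force
  then have "end_degree \<omega> \<le> enat 2" unfolding end_degree_eq by (intro Sup_least) auto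
  then show False by (simp add: end_degree_3 numeral_eq_enat)
qed

text \<open>Four disjoint rays would exceed the end degree, so a cut of at most three edges exists
  around any finite set. Enclosing also the first vertices of three disjoint rays makes three edges
  necessary.\<close>

lemma three_cuts:
  assumes "finite S" "S \<subseteq> V"
  obtains T where "finite T" "S \<subseteq> T" "T \<subseteq> V" "card (boundary E T) = 3"
proof -
  obtain \<R> where \<R>: "disjoint_ray_family \<R>" "3 \<le> card \<R>" using three_disjoint_rays by blast
  define S' where "S' = S \<union> (\<lambda>R. R 0) ` \<R>"
  have S': "finite S'" "S' \<subseteq> V"
    using assms \<R>(1) by (auto simp: S'_def disjoint_ray_family_def ray_def image_subset_iff)
  have "card \<R>' \<noteq> 4" if "disjoint_ray_family \<R>'" for \<R>'
    using card_disjoint_ray_family_le[OF that] by simp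
  then obtain T where T: "finite T" "S' \<subseteq> T" "T \<subseteq> V" "card (boundary E T) < 4"
    using disjoint_rays_or_cut[OF S', of 4] unfolding disjoint_ray_family_def by blast
  have "card \<R> \<le> card (boundary E T)"
    using \<R>(1) T by (intro card_disjoint_rays_le_cut) (auto simp: disjoint_ray_family_def S'_def)
  with T \<R>(2) show thesis by (intro that[of T]) (auto simp: S'_def)
qed

section \<open>Spanning double rays and contractions\<close>

text \<open>Under the present hypotheses these are the edge sets of spanning double rays.\<close>

definition ham :: "'a set set \<Rightarrow> bool" where
  "ham L \<longleftrightarrow> L \<subseteq> E \<and> (\<forall>v\<in>V. deg (\<lambda>e. e) L v = 2) \<and>
     (\<forall>W. finite W \<and> W \<subseteq> V \<and> W \<noteq> {} \<longrightarrow> boundary L W \<noteq> {})"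

text \<open>All degrees are 2, so the handshake count leaves an even number of crossing
  edges.\<close>

lemma even_boundary_ham:
  assumes L: "ham L" and W: "finite W" "W \<subseteq> V"
  shows "even (card (boundary L W))"
proof -
  have LE: "L \<subseteq> E" and d: "\<And>v. v \<in> W \<Longrightarrow> deg (\<lambda>e. e) L v = 2"
    using L W by (auto simp: ham_def)
  have fin: "finite {e \<in> L. v \<in> e}" if "v \<in> W" for v
  proof (rule finite_subset[OF _ locally_finite[of v]])
    show "{e \<in> L. v \<in> e} \<subseteq> {e \<in> E. v \<in> e}" using LE by blast
    show "v \<in> V" using that W by blast
  qed
  have "even (\<Sum>v\<in>W. deg (\<lambda>e. e) L v)" by (rule dvd_sum) (simp add: d)
  then show ?thesis
    using even_sum_deg_iff_even_edge_cut[of W L "\<lambda>e. e"] W(1) fin card_edge LE by blast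
qed

definition touching :: "'a set \<Rightarrow> 'a set set" where
  "touching T = {e \<in> E. e \<inter> T \<noteq> {}}"

text \<open>Contracting the complement of \<open>T\<close> to the vertex \<open>None\<close> gives a multigraph with edge set
  \<open>touching T\<close> and the following endvertices.\<close>

definition contract :: "'a set \<Rightarrow> 'a set \<Rightarrow> 'a option set" where
  "contract T e = Some ` (e \<inter> T) \<union> (if e \<subseteq> T then {} else {None})"

definition contracted_verts :: "'a set \<Rightarrow> 'a option set" where
  "contracted_verts T = insert None (Some ` T)"

lemma Some_in_contract: "Some v \<in> contract T e \<longleftrightarrow> v \<in> e \<and> v \<in> T"
  and None_in_contract: "None \<in> contract T e \<longleftrightarrow> \<not> e \<subseteq> T"
  by (auto simp: contract_def)

lemma finite_touching: "finite T \<Longrightarrow> T \<subseteq> V \<Longrightarrow> finite (touching T)"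
  by (rule finite_subset[of _ "\<Union>v\<in>T. {e \<in> E. v \<in> e}"]) (use locally_finite in \<open>auto simp: touching_def\<close>)

lemma contraction:
  assumes T: "finite T" "T \<subseteq> V"
  shows "finite_multigraph (contracted_verts T) (touching T) (contract T)"
proof
  show "finite (contracted_verts T)" using T by (simp add: contracted_verts_def)
  show "finite (touching T)" using T by (rule finite_touching)
  fix e assume "e \<in> touching T"
  then obtain u where u: "u \<in> e" "u \<in> T" "e \<in> E" by (auto simp: touching_def)
  then obtain v where v: "e = {u, v}" "u \<noteq> v" using edge_cases_at by metis
  show "contract T e \<subseteq> contracted_verts T"
    by (auto simp: contract_def contracted_verts_def)
  have "contract T e = {Some u, if v \<in> T then Some v else None}"
    using u v by (auto simp: contract_def)
  then show "card (contract T e) = 2" using v by auto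
qed

lemma deg_contract:
  assumes "F \<subseteq> E"
  shows "v \<in> T \<Longrightarrow> deg (contract T) (F \<inter> touching T) (Some v) = deg (\<lambda>e. e) F v"
    and "deg (contract T) (F \<inter> touching T) None = card (boundary F T)"
proof -
  assume "v \<in> T"
  then have "{e \<in> F \<inter> touching T. Some v \<in> contract T e} = {e \<in> F. v \<in> e}"
    using assms by (auto simp: Some_in_contract touching_def)
  then show "deg (contract T) (F \<inter> touching T) (Some v) = deg (\<lambda>e. e) F v" by (simp add: deg_def)
next
  have "{e \<in> F \<inter> touching T. None \<in> contract T e} = boundary F T"
    using assms by (auto simp: None_in_contract touching_def edge_cut_def)
  then show "deg (contract T) (F \<inter> touching T) None = card (boundary F T)" by (simp add: deg_def)
qed

lemma touching_subset: "touching T \<subseteq> E"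
  by (auto simp: touching_def)

lemma boundary_subset_touching: "F \<subseteq> E \<Longrightarrow> boundary F T \<subseteq> touching T"
  by (auto simp: touching_def edge_cut_def)

lemma boundary_mono: "F \<subseteq> F' \<Longrightarrow> boundary F T \<subseteq> boundary F' T"
  by (auto simp: edge_cut_def)

text \<open>The number is nonzero, even and at most three.\<close>

lemma ham_crosses_twice:
  assumes L: "ham L" and T: "finite T" "T \<subseteq> V" "card (boundary E T) = 3"
  shows "card (boundary L T) = 2"
proof -
  have "boundary L T \<subseteq> boundary E T" using L by (intro boundary_mono) (simp add: ham_def)
  then have "card (boundary L T) \<le> 3" using T finite_boundary[OF T(1)] by (metis card_mono)
  moreover have "T \<noteq> {}" using T(3) by (auto simp: edge_cut_def)
  then have "boundary L T \<noteq> {}" using L T by (simp add: ham_def)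
  moreover have "finite (boundary L T)"
    using \<open>boundary L T \<subseteq> boundary E T\<close> finite_boundary[OF T(1)] finite_subset by blast
  ultimately have "0 < card (boundary L T)" "card (boundary L T) \<le> 3" by (auto simp: card_gt_0_iff)
  moreover have "even (card (boundary L T))" by (rule even_boundary_ham[OF L T(1,2)])
  ultimately show ?thesis by (cases "card (boundary L T) = 1 \<or> card (boundary L T) = 3") auto
qed

lemma ham_contract:
  assumes L: "ham L" and T: "finite T" "T \<subseteq> V" "card (boundary E T) = 3"
  shows "hamiltonian_factor (contract T) (contracted_verts T) (L \<inter> touching T)"
  unfolding hamiltonian_factor_def
proof (intro conjI allI impI ballI)
  have LE: "L \<subseteq> E" using L by (simp add: ham_def)
  fix x assume "x \<in> contracted_verts T"
  then show "deg (contract T) (L \<inter> touching T) x = 2"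
    using deg_contract[OF LE] ham_crosses_twice[OF assms] L T
    by (auto simp: contracted_verts_def ham_def subset_iff)
next
  have LE: "L \<subseteq> E" using L by (simp add: ham_def)
  \<comment> \<open>Without \<open>None\<close>, a vertex set of the contraction is a finite vertex
    set of \<open>G\<close>, and \<open>ham\<close> provides an edge leaving it.\<close>
  have *: "edge_cut (contract T) (L \<inter> touching T) W \<noteq> {}"
    if W: "W \<subseteq> contracted_verts T" "W \<noteq> {}" "None \<notin> W" for W
  proof -
    define W' where "W' = Some -` W"
    have W': "W = Some ` W'" "W' \<subseteq> T" "W' \<noteq> {}"
    proof -
      show 1: "W = Some ` W'"
        unfolding W'_def using W by (auto simp: contracted_verts_def)
      show "W' \<subseteq> T" using W(1) by (auto simp: W'_def contracted_verts_def)
      show "W' \<noteq> {}" using W(2) 1 by auto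
    qed
    have "finite W'" "W' \<subseteq> V" using W'(2) T finite_subset by auto
    then obtain e where e: "e \<in> L" "e \<inter> W' \<noteq> {}" "\<not> e \<subseteq> W'"
      using L W'(3) unfolding ham_def edge_cut_def by blast
    have "e \<in> touching T" using e W'(2) LE by (auto simp: touching_def)
    moreover have "contract T e \<inter> W \<noteq> {}" using e W' by (auto simp: contract_def)
    moreover have "\<not> contract T e \<subseteq> W" using e W' by (auto simp: contract_def)
    ultimately show ?thesis using e by (auto simp: edge_cut_def)
  qed
  fix W assume W: "W \<subseteq> contracted_verts T \<and> W \<noteq> {} \<and> W \<noteq> contracted_verts T"
  show "edge_cut (contract T) (L \<inter> touching T) W \<noteq> {}"
  proof (cases "None \<in> W")
    \<comment> \<open>A set and its complement have the same cut, and the complement avoids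
      \<open>None\<close>.\<close>
    case True
    have "edge_cut (contract T) (L \<inter> touching T) (contracted_verts T - W) \<noteq> {}"
      using W True by (intro *) auto
    then obtain e where e: "e \<in> L \<inter> touching T" "contract T e \<inter> (contracted_verts T - W) \<noteq> {}"
      "\<not> contract T e \<subseteq> contracted_verts T - W" by (auto simp: edge_cut_def)
    have "contract T e \<subseteq> contracted_verts T"
      using finite_multigraph.m_sub[OF contraction[OF T(1,2)], of e] e(1) by simp
    with e have "e \<in> edge_cut (contract T) (L \<inter> touching T) W" unfolding edge_cut_def by blast
    then show ?thesis by blast
  qed (use W * in blast)
qed

text \<open>Agreement of \<open>Q\<close> and \<open>L\<close> on the cut makes all degrees fit. A
  finite set \<open>W\<close> left by no edge of the glued set is excluded by distinguishing whether
  none, both or just one of the two cut edges of \<open>L\<close> lies in \<open>W\<close>.\<close>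

lemma ham_glue:
  assumes L: "ham L" and T: "finite T" "T \<subseteq> V" "card (boundary E T) = 3"
    and Q: "Q \<subseteq> touching T" "hamiltonian_factor (contract T) (contracted_verts T) Q"
    and QL: "Q \<inter> boundary E T = L \<inter> boundary E T"
  shows "ham (Q \<union> (L - touching T))"
  unfolding ham_def
proof (intro conjI allI impI ballI)
  have LE: "L \<subseteq> E" using L by (simp add: ham_def)
  have QE: "Q \<subseteq> E" using Q touching_subset by blast
  let ?M = "Q \<union> (L - touching T)"
  show "?M \<subseteq> E" using LE QE by blast
  fix v assume v: "v \<in> V"
  show "deg (\<lambda>e. e) ?M v = 2"
  proof (cases "v \<in> T")
    case True
    then have "{e \<in> ?M. v \<in> e} = {e \<in> Q. v \<in> e}" using LE by (auto simp: touching_def)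
    then have "deg (\<lambda>e. e) ?M v = deg (\<lambda>e. e) Q v" by (simp add: deg_def)
    also have "\<dots> = deg (contract T) (Q \<inter> touching T) (Some v)" using deg_contract(1)[OF QE True] by simp
    also have "Q \<inter> touching T = Q" using Q by blast
    also have "deg (contract T) Q (Some v) = 2"
      using Q(2) True by (simp add: hamiltonian_factor_def contracted_verts_def)
    finally show ?thesis .
  next
    case False
    have "e \<in> Q \<longleftrightarrow> e \<in> L" if "v \<in> e" "e \<in> touching T" for e
    proof -
      have "e \<in> boundary E T" using that False by (auto simp: touching_def edge_cut_def)
      then show ?thesis using QL by blast
    qed
    then have "{e \<in> ?M. v \<in> e} = {e \<in> L. v \<in> e}" using Q by blast
    then have "deg (\<lambda>e. e) ?M v = deg (\<lambda>e. e) L v" by (simp add: deg_def)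
    then show ?thesis using L v by (simp add: ham_def)
  qed
next
  have LE: "L \<subseteq> E" using L by (simp add: ham_def)
  let ?M = "Q \<union> (L - touching T)"
  fix W assume W: "finite W \<and> W \<subseteq> V \<and> W \<noteq> {}"
  show "boundary ?M W \<noteq> {}"
  proof
    assume "boundary ?M W = {}"
    then have cl: "e \<inter> W = {} \<or> e \<subseteq> W" if "e \<in> ?M" for e using that by (auto simp: edge_cut_def)
    have BM: "e \<in> ?M \<and> e \<in> Q" if "e \<in> L" "e \<in> boundary E T" for e using that QL by blast
    have kinds: "e \<subseteq> T \<or> e \<in> boundary E T \<or> e \<notin> touching T" if "e \<in> E" for e
      using that by (auto simp: touching_def edge_cut_def)
    have QB: "e \<subseteq> T \<or> e \<in> L \<inter> boundary E T" if "e \<in> Q" for e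
      using kinds[of e] that Q QL touching_subset by blast
    have Lcross: "\<exists>e\<in>L. e \<inter> W \<noteq> {} \<and> \<not> e \<subseteq> W"
      using L W unfolding ham_def edge_cut_def by blast
    have conn: "U = {} \<or> U = contracted_verts T" if "U \<subseteq> contracted_verts T"
      "\<And>e. e \<in> Q \<Longrightarrow> contract T e \<inter> U = {} \<or> contract T e \<subseteq> U" for U
      using Q(2) that unfolding hamiltonian_factor_def edge_cut_def by blast
    consider (out) "\<And>e. e \<in> L \<inter> boundary E T \<Longrightarrow> e \<inter> W = {}"
      | (inn) "\<And>e. e \<in> L \<inter> boundary E T \<Longrightarrow> e \<subseteq> W"
      | (split) e e' where "e \<in> L \<inter> boundary E T" "e' \<in> L \<inter> boundary E T" "e \<subseteq> W" "\<not> e' \<subseteq> W"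
        "e' \<inter> W = {}"
      using cl BM by blast
    then show False
    proof cases
      \<comment> \<open>The trace of \<open>W\<close> on \<open>T\<close> is closed under
        \<open>Q\<close>, hence empty; away from \<open>T\<close> the glued set coincides with
        \<open>L\<close>.\<close>
      case out
      have "Some ` (W \<inter> T) = {} \<or> Some ` (W \<inter> T) = contracted_verts T"
      proof (rule conn)
        fix e assume e: "e \<in> Q"
        then show "contract T e \<inter> Some ` (W \<inter> T) = {} \<or> contract T e \<subseteq> Some ` (W \<inter> T)"
          using QB[OF e] cl[of e] out[of e] by (auto simp: contract_def)
      qed (auto simp: contracted_verts_def)
      then have "W \<inter> T = {}" by (auto simp: contracted_verts_def)
      then show False using Lcross kinds cl out LE by blast
    next
      \<comment> \<open>With \<open>None\<close> added, the trace of \<open>W\<close> is closed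
        under \<open>Q\<close>, so \<open>W\<close> contains all of \<open>T\<close> and would be
        closed under \<open>L\<close>.\<close>
      case inn
      let ?U = "insert None (Some ` (W \<inter> T))"
      have "?U = {} \<or> ?U = contracted_verts T"
      proof (rule conn)
        fix e assume e: "e \<in> Q"
        then show "contract T e \<inter> ?U = {} \<or> contract T e \<subseteq> ?U"
          using QB[OF e] cl[of e] inn[of e] by (auto simp: contract_def)
      qed (auto simp: contracted_verts_def)
      then have "T \<subseteq> W" by (auto simp: contracted_verts_def)
      then show False using Lcross kinds cl inn LE by blast
    next
      \<comment> \<open>Here \<open>L\<close> would leave \<open>W - T\<close> through the single
        edge \<open>e\<close>, against parity.\<close>
      case split
      have LB: "L \<inter> boundary E T = boundary L T" using LE by (auto simp: edge_cut_def)
      have "e \<noteq> e'" using split by blast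
      then have "L \<inter> boundary E T = {e, e'}"
        using ham_crosses_twice[OF L T] split(1,2) unfolding LB
        by (intro card_seteq[symmetric]) (auto intro: card_ge_0_finite)
      have "boundary L (W - T) = {e}"
      proof (intro equalityI subsetI)
        fix f assume f: "f \<in> boundary L (W - T)"
        then have fL: "f \<in> L" "f \<inter> (W - T) \<noteq> {}" "\<not> f \<subseteq> W - T" by (auto simp: edge_cut_def)
        have "f \<in> touching T"
        proof (rule ccontr)
          assume "f \<notin> touching T"
          then have "f \<inter> T = {}" "f \<in> ?M" using fL LE by (auto simp: touching_def)
          then show False using cl[of f] fL by blast
        qed
        then have "f \<in> boundary E T" using kinds[of f] fL LE by blast
        then have "f \<in> {e, e'}" using fL \<open>L \<inter> boundary E T = {e, e'}\<close> by blast
        then show "f \<in> {e}" using fL split(5) by blast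
      next
        fix f assume "f \<in> {e}"
        then show "f \<in> boundary L (W - T)" using split(1,3) by (auto simp: edge_cut_def)
      qed
      moreover have "even (card (boundary L (W - T)))" using W by (intro even_boundary_ham[OF L]) auto
      ultimately show False by simp
    qed
  qed
qed

text \<open>The degree at a vertex, the edges leaving a finite set and the absence of
  \<open>e\<close> each depend on finitely many edges, so they pass from the contractions to a
  cluster point of their factors.\<close>

lemma ham_limit:
  assumes "\<And>S. finite S \<Longrightarrow> S \<subseteq> V \<Longrightarrow> \<exists>T X. finite T \<and> S \<subseteq> T \<and> T \<subseteq> V \<and> X \<subseteq> touching T \<and>
    hamiltonian_factor (contract T) (contracted_verts T) X \<and> e \<notin> X"
  shows "\<exists>L. ham L \<and> e \<notin> L"
proof -
  \<comment> \<open>Asking for some \<open>T\<close> containing \<open>S\<close> makes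
    \<open>P\<close> antitone in \<open>S\<close>. The set \<open>S \<inter> V\<close> occurs
    because compactness ranges over all finite sets of the type.\<close>
  define P where "P S X \<longleftrightarrow> (\<exists>T. finite T \<and> S \<inter> V \<subseteq> T \<and> T \<subseteq> V \<and> X \<subseteq> touching T \<and>
    hamiltonian_factor (contract T) (contracted_verts T) X \<and> e \<notin> X)" for S X
  obtain L0 where L0: "\<And>S \<Phi>. finite S \<Longrightarrow> finite \<Phi> \<Longrightarrow> \<exists>X. P S X \<and> X \<inter> \<Phi> = L0 \<inter> \<Phi>"
  proof (rule compactness_sets[of P])
    show "\<exists>X. P S X" if "finite S" for S using assms[of "S \<inter> V"] that unfolding P_def by blast
    show "P S X" if "S \<subseteq> S'" "P S' X" for S S' X using that unfolding P_def by blast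
  qed blast
  define L where "L = L0 \<inter> E"
  have approx: "\<exists>T X. finite T \<and> S \<subseteq> T \<and> T \<subseteq> V \<and> X \<subseteq> touching T \<and> X \<inter> \<Phi> = L \<inter> \<Phi> \<and>
    hamiltonian_factor (contract T) (contracted_verts T) X \<and> e \<notin> X"
    if S: "finite S" "S \<subseteq> V" and \<Phi>: "finite \<Phi>" "\<Phi> \<subseteq> E" for S \<Phi>
  proof -
    obtain X where X: "P S X" "X \<inter> \<Phi> = L0 \<inter> \<Phi>" using L0[OF S(1) \<Phi>(1)] by blast
    have "X \<inter> \<Phi> = L \<inter> \<Phi>" using X(2) \<Phi>(2) by (auto simp: L_def)
    moreover have "S \<inter> V = S" using S(2) by blast
    ultimately show ?thesis using X(1) unfolding P_def by auto
  qed
  have "e \<notin> L"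
  proof
    assume "e \<in> L"
    then have "{e} \<subseteq> E" by (simp add: L_def)
    then show False using approx[of "{}" "{e}"] \<open>e \<in> L\<close> by auto
  qed
  moreover have "ham L"
    unfolding ham_def
  proof (intro conjI ballI allI impI)
    show "L \<subseteq> E" by (simp add: L_def)
    fix v assume v: "v \<in> V"
    obtain T X where TX: "{v} \<subseteq> T" "X \<subseteq> touching T" "X \<inter> {e \<in> E. v \<in> e} = L \<inter> {e \<in> E. v \<in> e}"
      "hamiltonian_factor (contract T) (contracted_verts T) X"
      using approx[of "{v}" "{e \<in> E. v \<in> e}"] v locally_finite[OF v] by auto
    have "{f \<in> X. Some v \<in> contract T f} = X \<inter> {e \<in> E. v \<in> e}"
      using TX(1,2) touching_subset by (auto simp: Some_in_contract)
    also have "\<dots> = {f \<in> L. v \<in> f}" unfolding TX(3) by (auto simp: L_def)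
    finally have "deg (\<lambda>e. e) L v = deg (contract T) X (Some v)" by (simp add: deg_def)
    also have "\<dots> = 2" using TX(1,4) by (simp add: hamiltonian_factor_def contracted_verts_def)
    finally show "deg (\<lambda>e. e) L v = 2" .
  next
    fix W assume W: "finite W \<and> W \<subseteq> V \<and> W \<noteq> {}"
    have "boundary E W \<subseteq> E" by (auto simp: edge_cut_def)
    then obtain T X where TX: "W \<subseteq> T" "X \<subseteq> touching T" "X \<inter> boundary E W = L \<inter> boundary E W"
      "hamiltonian_factor (contract T) (contracted_verts T) X"
      using approx[of W "boundary E W"] W finite_boundary[of W] by auto
    have "edge_cut (contract T) X (Some ` W) \<noteq> {}"
    proof -
      \<comment> \<open>The image of \<open>W\<close> misses \<open>None\<close>, so the cut
        condition applies even if \<open>W = T\<close>.\<close>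
      have "Some ` W \<subseteq> contracted_verts T" "Some ` W \<noteq> {}" "Some ` W \<noteq> contracted_verts T"
        using W TX(1) by (auto simp: contracted_verts_def)
      then show ?thesis using TX(4) by (simp add: hamiltonian_factor_def)
    qed
    then obtain f where f: "f \<in> X" "contract T f \<inter> Some ` W \<noteq> {}" "\<not> contract T f \<subseteq> Some ` W"
      by (auto simp: edge_cut_def)
    have "f \<inter> W \<noteq> {}" using f(2) by (auto simp: Some_in_contract)
    moreover have "\<not> f \<subseteq> W"
    proof
      assume "f \<subseteq> W"
      then have "contract T f \<subseteq> Some ` W" using TX(1) by (auto simp: contract_def)
      then show False using f(3) by simp
    qed
    moreover have "f \<in> E" using f(1) TX(2) touching_subset by blast
    ultimately have "f \<in> X \<inter> boundary E W" using f(1) by (simp add: edge_cut_def)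
    then have "f \<in> L" unfolding TX(3) by simp
    then show "boundary L W \<noteq> {}" using \<open>f \<inter> W \<noteq> {}\<close> \<open>\<not> f \<subseteq> W\<close> by (auto simp: edge_cut_def)
  qed
  ultimately show ?thesis by blast
qed

text \<open>If some contraction has a second Hamiltonian factor with the same edge \<open>f\<close> missing at
  \<open>None\<close>, it can replace \<open>L\<close> inside \<open>T\<close>. Otherwise the number of Hamiltonian factors avoiding \<open>f\<close>
  is always one, hence by Smith's theorem the number of those avoiding any other edge is odd.\<close>

theorem second_ham:
  assumes L: "ham L"
  obtains L' where "ham L'" "L' \<noteq> L"
proof (cases "\<exists>T Q. finite T \<and> T \<subseteq> V \<and> card (boundary E T) = 3 \<and> Q \<subseteq> touching T \<and>
    hamiltonian_factor (contract T) (contracted_verts T) Q \<and>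
    Q \<inter> boundary E T = L \<inter> boundary E T \<and> Q \<noteq> L \<inter> touching T")
  case True
  then obtain T Q where T: "finite T" "T \<subseteq> V" "card (boundary E T) = 3"
    and Q: "Q \<subseteq> touching T" "hamiltonian_factor (contract T) (contracted_verts T) Q"
      "Q \<inter> boundary E T = L \<inter> boundary E T" "Q \<noteq> L \<inter> touching T" by blast
  have "(Q \<union> (L - touching T)) \<inter> touching T = Q" using Q(1) by blast
  then have "Q \<union> (L - touching T) \<noteq> L" using Q(4) by blast
  then show thesis using ham_glue[OF L T Q(1-3)] that by blast
next
  case False
  have LE: "L \<subseteq> E" using L by (simp add: ham_def)
  obtain v where v: "v \<in> V" using infinite_V by (metis finite.emptyI ex_in_conv)
  then have "deg (\<lambda>e. e) L v = 2" using L by (simp add: ham_def)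
  then have "{e \<in> L. v \<in> e} \<noteq> {}" by (intro notI) (simp add: deg_def)
  then obtain e where e: "e \<in> L" "v \<in> e" by blast
  have "\<exists>L'. ham L' \<and> e \<notin> L'"
  proof (rule ham_limit)
    fix S assume S: "finite S" "S \<subseteq> V"
    \<comment> \<open>Enclosing \<open>v\<close> makes \<open>e\<close> an edge of every contraction
      considered.\<close>
    then obtain T where T: "finite T" "insert v S \<subseteq> T" "T \<subseteq> V" "card (boundary E T) = 3"
      using three_cuts[of "insert v S"] v by blast
    interpret finite_multigraph "contracted_verts T" "touching T" "contract T"
      by (rule contraction[OF T(1,3)])
    let ?H = "hamiltonian_factor (contract T) (contracted_verts T)"
    \<comment> \<open>The degree of \<open>None\<close> is the size of the cut, which is why cuts
      with exactly three edges are taken.\<close>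
    have cub: "deg (contract T) (touching T) x = 3" if "x \<in> contracted_verts T" for x
    proof -
      have "E \<inter> touching T = touching T" using touching_subset by blast
      then show ?thesis using that deg_contract(1)[of E _ T] deg_contract(2)[of E T] deg_E T
        by (auto simp: contracted_verts_def subset_iff)
    qed
    have LB: "L \<inter> boundary E T = boundary L T" using LE by (auto simp: edge_cut_def)
    have finB: "finite (boundary E T)" by (rule finite_boundary[OF T(1)])
    have "card (boundary E T - L) = 1"
      using ham_crosses_twice[OF L T(1,3,4)] T(4) card_Int_Diff[OF finB, of L]
      by (simp add: Int_commute LB)
    then obtain f where f: "boundary E T - L = {f}" by (auto simp: card_1_singleton_iff)
    have f_out: "f \<in> boundary E T" "f \<notin> L" using f by auto
    have f_only: "g = f" if "g \<in> boundary E T" "g \<notin> L" for g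
    proof -
      have "g \<in> boundary E T - L" using that by simp
      then show ?thesis by (simp add: f)
    qed
    have f_in: "f \<in> touching T" using f_out(1) boundary_subset_touching[of E T] by blast
    \<comment> \<open>A factor avoiding \<open>f\<close> still has degree 2 at \<open>None\<close>,
      so it uses the same two cut edges as \<open>L\<close>; the assumption of this case then leaves
      only \<open>L\<close>.\<close>
    have "{Q. Q \<subseteq> touching T \<and> ?H Q \<and> f \<notin> Q} = {L \<inter> touching T}"
    proof (intro equalityI subsetI)
      fix Q assume "Q \<in> {Q. Q \<subseteq> touching T \<and> ?H Q \<and> f \<notin> Q}"
      then have Q: "Q \<subseteq> touching T" "?H Q" "f \<notin> Q" by auto
      have QE: "Q \<subseteq> E" using Q(1) touching_subset by blast
      have "Q \<inter> touching T = Q" using Q(1) by blast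
      then have "card (boundary Q T) = 2"
        using deg_contract(2)[OF QE, of T] Q(2) by (simp add: hamiltonian_factor_def contracted_verts_def)
      moreover have "boundary Q T = Q \<inter> boundary E T" using QE by (auto simp: edge_cut_def)
      ultimately have "card (L \<inter> boundary E T) \<le> card (Q \<inter> boundary E T)"
        using ham_crosses_twice[OF L T(1,3,4)] by (simp add: LB)
      moreover have "Q \<inter> boundary E T \<subseteq> L \<inter> boundary E T" using f_only Q(3) by blast
      ultimately have "Q \<inter> boundary E T = L \<inter> boundary E T"
        using finB by (intro card_seteq) auto
      then show "Q \<in> {L \<inter> touching T}" using False Q T by blast
    next
      fix Q assume "Q \<in> {L \<inter> touching T}"
      then show "Q \<in> {Q. Q \<subseteq> touching T \<and> ?H Q \<and> f \<notin> Q}"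
        using ham_contract[OF L T(1,3,4)] f_out(2) by auto
    qed
    then have "odd (card {Q. Q \<subseteq> touching T \<and> ?H Q \<and> f \<notin> Q})" by simp
    moreover have "e \<in> touching T" using e LE T(2) by (auto simp: touching_def)
    ultimately have "odd (card {Q. Q \<subseteq> touching T \<and> ?H Q \<and> e \<notin> Q})"
      using Smith_avoiding[OF cub _ f_in] by blast
    then have "{Q. Q \<subseteq> touching T \<and> ?H Q \<and> e \<notin> Q} \<noteq> {}" by (intro notI) simp
    then obtain Q where "Q \<subseteq> touching T \<and> ?H Q \<and> e \<notin> Q" by blast
    then show "\<exists>T X. finite T \<and> S \<subseteq> T \<and> T \<subseteq> V \<and> X \<subseteq> touching T \<and>
        hamiltonian_factor (contract T) (contracted_verts T) X \<and> e \<notin> X"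
      using T by blast
  qed
  then show thesis using e that by blast
qed


section \<open>Walking along a 2-factor\<close>

lemma ham_neighbours:
  assumes L: "ham L" and v: "v \<in> V"
  obtains a b where "a \<noteq> b" "\<And>w. {v, w} \<in> L \<longleftrightarrow> w = a \<or> w = b"
proof -
  have LE: "L \<subseteq> E" and "card {e \<in> L. v \<in> e} = 2" using L v by (auto simp: ham_def deg_def)
  then obtain e1 e2 where e: "{e \<in> L. v \<in> e} = {e1, e2}" "e1 \<noteq> e2" by (auto simp: card_2_iff)
  then have "e1 \<in> L \<and> v \<in> e1" "e2 \<in> L \<and> v \<in> e2" by blast+
  then obtain a b where ab: "e1 = {v, a}" "e2 = {v, b}" using edge_cases_at LE by (metis subsetD)
  have "{v, w} \<in> L \<longleftrightarrow> {v, w} \<in> {e1, e2}" for w unfolding e(1)[symmetric] by simp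
  then have "{v, w} \<in> L \<longleftrightarrow> w = a \<or> w = b" for w by (auto simp: ab doubleton_eq_iff)
  moreover have "a \<noteq> b" using ab e(2) by blast
  ultimately show thesis using that by blast
qed

lemma ham_other_neighbour:
  assumes L: "ham L" and vu: "{v, u} \<in> L"
  obtains x where "x \<noteq> u" "\<And>w. {v, w} \<in> L \<longleftrightarrow> w = u \<or> w = x"
proof -
  have "v \<in> V" using L vu edge_ends by (auto simp: ham_def)
  then obtain a b where "a \<noteq> b" "\<And>w. {v, w} \<in> L \<longleftrightarrow> w = a \<or> w = b"
    by (rule ham_neighbours[OF L]) (rule that)
  then show thesis using that[of a] that[of b] vu by (cases "u = a") auto
qed

lemma ham_walk:
  assumes L: "ham L" and ab: "{a, b} \<in> L"
  obtains g :: "nat \<Rightarrow> 'a" where "g 0 = a" "g 1 = b" "\<And>i. g i \<noteq> g (Suc (Suc i))"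
    "\<And>i w. {g (Suc i), w} \<in> L \<longleftrightarrow> w = g i \<or> w = g (Suc (Suc i))"
proof -
  \<comment> \<open>A state consists of the last two vertices of the walk, which goes on to the
    neighbour it did not come from.\<close>
  define nx where "nx d = (snd d, SOME x. x \<noteq> fst d \<and> (\<forall>w. {snd d, w} \<in> L \<longleftrightarrow> w = fst d \<or> w = x))"
    for d
  have nx: "snd (nx d) \<noteq> fst d \<and> (\<forall>w. {snd d, w} \<in> L \<longleftrightarrow> w = fst d \<or> w = snd (nx d))"
    if d: "{fst d, snd d} \<in> L" for d
  proof -
    have "{snd d, fst d} \<in> L" using d by (simp add: insert_commute)
    then obtain x where x: "x \<noteq> fst d"
      "\<And>w. {snd d, w} \<in> L \<longleftrightarrow> w = fst d \<or> w = x" by (rule ham_other_neighbour[OF L]) (rule that)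
    have "\<exists>x. x \<noteq> fst d \<and> (\<forall>w. {snd d, w} \<in> L \<longleftrightarrow> w = fst d \<or> w = x)"
      by (intro exI[of _ x] conjI allI x)
    from someI_ex[OF this] show ?thesis unfolding nx_def snd_conv .
  qed
  define D where "D i = (nx ^^ i) (a, b)" for i
  have D: "D 0 = (a, b)" "\<And>i. D (Suc i) = nx (D i)" by (simp_all add: D_def)
  have fst_nx: "fst (nx d) = snd d" for d by (simp add: nx_def)
  have DL: "{fst (D i), snd (D i)} \<in> L" for i
  proof (induction i)
    case (Suc i)
    have "{snd (D i), snd (nx (D i))} \<in> L" using nx[OF Suc] by simp
    then show ?case by (simp only: fst_nx D(2))
  qed (simp add: D ab)
  show thesis
  proof (rule that[of "\<lambda>i. fst (D i)"])
    show "fst (D i) \<noteq> fst (D (Suc (Suc i)))" for i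
      using not_sym[OF conjunct1[OF nx[OF DL[of i]]]] by (simp add: fst_nx D(2))
    show "{fst (D (Suc i)), w} \<in> L \<longleftrightarrow> w = fst (D i) \<or> w = fst (D (Suc (Suc i)))" for i w
      using nx[OF DL[of i]] by (simp add: fst_nx D(2))
    show "fst (D 1) = b" using fst_nx[of "D 0"] D(2)[of 0] D(1) by simp
  qed (simp add: D)
qed

text \<open>Two one-way walks leave \<open>v\<close> through its two edges in \<open>L\<close>;
  nonnegative indices follow one of them, negative indices the other.\<close>

lemma ham_biinfinite_walk:
  assumes L: "ham L"
  obtains f :: "int \<Rightarrow> 'a" where "\<And>i. f (i - 1) \<noteq> f (i + 1)"
    "\<And>i w. {f i, w} \<in> L \<longleftrightarrow> w = f (i - 1) \<or> w = f (i + 1)"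
proof -
  obtain v where v: "v \<in> V" using infinite_V by (metis finite.emptyI ex_in_conv)
  obtain a b where ab: "a \<noteq> b" "\<And>w. {v, w} \<in> L \<longleftrightarrow> w = a \<or> w = b"
    by (rule ham_neighbours[OF L v]) (rule that)
  have "{v, b} \<in> L" "{v, a} \<in> L" using ab by auto
  obtain g where g: "g 0 = v" "g 1 = b" "\<And>i. g i \<noteq> g (Suc (Suc i))"
    "\<And>i w. {g (Suc i), w} \<in> L \<longleftrightarrow> w = g i \<or> w = g (Suc (Suc i))"
    by (rule ham_walk[OF L \<open>{v, b} \<in> L\<close>]) (rule that)
  obtain h where h: "h 0 = v" "h 1 = a" "\<And>i. h i \<noteq> h (Suc (Suc i))"
    "\<And>i w. {h (Suc i), w} \<in> L \<longleftrightarrow> w = h i \<or> w = h (Suc (Suc i))"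
    by (rule ham_walk[OF L \<open>{v, a} \<in> L\<close>]) (rule that)
  define f where "f i = (if i \<ge> 0 then g (nat i) else h (nat (- i)))" for i :: int
  have fg: "f (int n) = g n" for n by (simp add: f_def)
  have fh: "f (- int n) = h n" for n using g(1) h(1) by (cases "n = 0") (auto simp: f_def)
  have *: "f (i - 1) \<noteq> f (i + 1) \<and> (\<forall>w. {f i, w} \<in> L \<longleftrightarrow> w = f (i - 1) \<or> w = f (i + 1))" for i
  proof -
    consider n where "i = int (Suc n)" | "i = 0" | n where "i = - int (Suc n)"
      by (cases i rule: int_cases2) (metis not0_implies_Suc of_nat_0 minus_zero)+
    then show ?thesis
    proof cases
      case 1
      then have "i - 1 = int n" "i + 1 = int (Suc (Suc n))" by auto
      then show ?thesis unfolding 1 by (metis fg g(3,4))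
    next
      case 2
      have "f (i - 1) = a" "f (i + 1) = b" "f i = v"
        using fh[of 1] fg[of 1] fg[of 0] 2 g h by auto
      then show ?thesis using ab by auto
    next
      case 3
      then have "i - 1 = - int (Suc (Suc n))" "i + 1 = - int n" by auto
      then show ?thesis unfolding 3 by (metis fh h(3,4))
    qed
  qed
  then show thesis using that by blast
qed

text \<open>A shortest repetition on the walk would close a finite cycle that no edge of
  \<open>L\<close> leaves. A missed vertex would split some set with a 3-edge cut into two parts,
  each left by at least two edges of \<open>L\<close>, whereas only two are available.\<close>

theorem ham_double_ray:
  assumes L: "ham L"
  obtains f :: "int \<Rightarrow> 'a" where "inj f" "range f = V" "L = {{f i, f (i + 1)} | i. True}"
proof -
  obtain f :: "int \<Rightarrow> 'a" where f_ne: "\<And>i. f (i - 1) \<noteq> f (i + 1)"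
    and f_nb: "\<And>i w. {f i, w} \<in> L \<longleftrightarrow> w = f (i - 1) \<or> w = f (i + 1)"
    by (rule ham_biinfinite_walk[OF L]) (rule that)
  have LE: "L \<subseteq> E" using L by (simp add: ham_def)
  have fL: "{f i, f (i + 1)} \<in> L" for i using f_nb by blast
  have fE: "f i \<in> V \<and> f (i + 1) \<in> V \<and> f i \<noteq> f (i + 1)" for i
    by (rule edge_ends[OF subsetD[OF LE fL]])
  have fV: "f i \<in> V" and f_step: "f i \<noteq> f (i + 1)" for i using fE[of i] by simp_all
  have at: "\<exists>w. e = {f i, w} \<and> (w = f (i - 1) \<or> w = f (i + 1))" if e: "e \<in> L" "f i \<in> e" for e i
  proof -
    obtain w where "e = {f i, w}" by (rule edge_cases_at[OF subsetD[OF LE e(1)] e(2)])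
    moreover from this have "w = f (i - 1) \<or> w = f (i + 1)" using e(1) by (simp only: f_nb)
    ultimately show ?thesis by blast
  qed
  have "inj f"
  proof (rule ccontr)
    assume "\<not> inj f"
    then obtain i0 j0 where "f i0 = f j0" "i0 < j0" unfolding inj_def by (metis (no_types) less_linear)
    then have ex: "\<exists>d i. 0 < d \<and> f i = f (i + int d)"
      by (intro exI[of _ "nat (j0 - i0)"] exI[of _ i0]) auto
    define d where "d = (LEAST d. \<exists>i. 0 < d \<and> f i = f (i + int d))"
    obtain i where d: "0 < d" and i: "f i = f (i + int d)"
      using LeastI_ex[OF ex] unfolding d_def by blast
    have min: "f k \<noteq> f (k + int c)" if "0 < c" "c < d" for c k
      using not_less_Least[of c "\<lambda>d. \<exists>i. 0 < d \<and> f i = f (i + int d)"] that unfolding d_def by blast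
    define W where "W = f ` {i..<i + int d}"
    have inW: "f k \<in> W" if "i \<le> k" "k < i + int d" for k using that by (auto simp: W_def)
    \<comment> \<open>The two neighbours of \<open>f i\<close> on the closed walk differ;
      \<open>d = 2\<close> would mean turning back at once, which \<open>f_ne\<close>
      forbids.\<close>
    have "f (i + 1) \<noteq> f (i + int d - 1)"
    proof -
      consider "d = 1" | "d = 2" | "d > 2" using d by linarith
      then show ?thesis
      proof cases
        case 1
        then show ?thesis using f_step[of i] by auto
      next
        case 2
        then show ?thesis using f_ne[of "i + 1"] i by (simp add: algebra_simps)
      next
        case 3
        have "i + 1 + int (d - 2) = i + int d - 1" using 3 by simp
        then show ?thesis using min[of "d - 2" "i + 1"] 3 by simp
      qed
    qed
    moreover have "{f i, f (i + int d - 1)} \<in> L"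
      unfolding i using f_nb[of "i + int d" "f (i + int d - 1)"] by simp
    \<comment> \<open>Only two neighbours of \<open>f i\<close> in \<open>L\<close> exist, so the
      vertex before \<open>f i\<close> already lies on the cycle.\<close>
    ultimately have "f (i + int d - 1) = f (i - 1)" by (simp only: f_nb) simp
    then have prev: "f (i - 1) \<in> W" using inW[of "i + int d - 1"] d by simp
    have "boundary L W = {}"
    proof (rule ccontr)
      assume "boundary L W \<noteq> {}"
      then obtain e x where ex: "e \<in> L" "x \<in> e" "\<not> e \<subseteq> W" "x \<in> W"
        unfolding edge_cut_def by blast
      obtain k where "x = f k" "k \<in> {i..<i + int d}" using ex(4) unfolding W_def by (rule imageE)
      with ex have e: "e \<in> L" "f k \<in> e" "\<not> e \<subseteq> W" and k: "i \<le> k" "k < i + int d" by simp_all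
      obtain w where w: "e = {f k, w}" "w = f (k - 1) \<or> w = f (k + 1)" using at[OF e(1,2)] by blast
      have "f (k - 1) \<in> W" using prev inW[of "k - 1"] k by (cases "k = i") auto
      moreover have "f (k + 1) \<in> W" using inW[of "k + 1"] inW[of i] i d k by (cases "k + 1 = i + int d") auto
      ultimately show False using w e(3) inW[OF k] by auto
    qed
    moreover have "finite W" "W \<noteq> {}" "W \<subseteq> V" using d fV by (auto simp: W_def)
    ultimately show False using L by (simp add: ham_def)
  qed
  moreover have "range f = V"
  proof (rule ccontr)
    assume "range f \<noteq> V"
    then obtain v where v: "v \<in> V" "v \<notin> range f" using fV by blast
    obtain T where T: "finite T" "{f 0, v} \<subseteq> T" "T \<subseteq> V" "card (boundary E T) = 3"
      using three_cuts[of "{f 0, v}"] v fV by auto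
    define A B where "A = T \<inter> range f" and "B = T - range f"
    have closed: "e \<subseteq> range f \<or> e \<inter> range f = {}" if "e \<in> L" for e
      using at[OF that] by blast
    \<comment> \<open>Parity turns one leaving edge into two.\<close>
    have two: "2 \<le> card (boundary L W)" if "W \<subseteq> T" "W \<noteq> {}" for W
    proof -
      have W: "finite W" "W \<subseteq> V" using that T finite_subset by auto
      have "finite (boundary L W)"
        using finite_subset[OF boundary_mono[OF LE] finite_boundary[OF W(1)]] .
      moreover have "boundary L W \<noteq> {}" using L W that by (simp add: ham_def)
      ultimately have "card (boundary L W) \<noteq> 0" by simp
      moreover have "even (card (boundary L W))" by (rule even_boundary_ham[OF L W])
      ultimately show ?thesis by (cases "card (boundary L W) = 1") auto
    qed
    have sub: "boundary L A \<subseteq> boundary L T" "boundary L B \<subseteq> boundary L T" "boundary L A \<inter> boundary L B = {}"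
      using closed by (fastforce simp: edge_cut_def A_def B_def)+
    have finL: "finite (boundary L T)"
      using finite_subset[OF boundary_mono[OF LE] finite_boundary[OF T(1)]] .
    have "card (boundary L A) + card (boundary L B) = card (boundary L A \<union> boundary L B)"
      using sub finL by (intro card_Un_disjoint[symmetric]) (auto intro: finite_subset)
    also have "\<dots> \<le> card (boundary L T)" using sub finL by (intro card_mono) auto
    finally have "card (boundary L A) + card (boundary L B) \<le> 2"
      using ham_crosses_twice[OF L T(1,3,4)] by simp
    moreover have "f 0 \<in> A" "v \<in> B" "A \<subseteq> T" "B \<subseteq> T" using T(2) v(2) by (auto simp: A_def B_def)
    then have "2 \<le> card (boundary L A)" "2 \<le> card (boundary L B)" using two by blast+
    ultimately show False by linarith
  qed
  moreover have "L = {{f i, f (i + 1)} | i. True}"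
  proof (intro equalityI subsetI)
    fix e assume e: "e \<in> L"
    then have "e \<in> E" using LE by blast
    then obtain u where "u \<in> e" "u \<in> V" by (rule edge_cases) auto
    then have "u \<in> range f" by (simp only: \<open>range f = V\<close>)
    then obtain i where "f i \<in> e" using \<open>u \<in> e\<close> by blast
    from at[OF e this] consider "e = {f i, f (i + 1)}" | "e = {f (i - 1), f (i - 1 + 1)}"
      by (auto simp: insert_commute)
    then show "e \<in> {{f i, f (i + 1)} | i. True}" by cases blast+
  qed (use fL in blast)
  ultimately show thesis using that by blast
qed

end

section \<open>The topology of the compactification\<close>

lemma edge_point_commute: "u \<noteq> v \<Longrightarrow> edge_point u v t = edge_point v u (1 - t)"
  by (auto simp: edge_point_def)

lemma edge_point_simps:
  "edge_point u v t u = 1 - t" "u \<noteq> v \<Longrightarrow> edge_point u v t v = t"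
  "x \<noteq> u \<Longrightarrow> x \<noteq> v \<Longrightarrow> edge_point u v t x = 0"
  by (auto simp: edge_point_def)

lemma continuous_on_edge_point: "continuous_on A (\<lambda>t. edge_point u v t x)"
  unfolding edge_point_def by (cases "x = u"; cases "x = v") (auto intro!: continuous_intros)

lemma open_in_complex_Union:
  assumes "\<And>W. W \<in> \<W> \<Longrightarrow> open_in_complex G W"
  shows "open_in_complex G (\<Union>\<W>)"
  unfolding open_in_complex_def
proof (intro conjI allI impI)
  show "\<Union>\<W> \<subseteq> one_complex G" using assms by (auto simp: open_in_complex_def)
  fix u v assume "{u, v} \<in> edges G"
  then have "openin (top_of_set {0..1}) (\<Union>W\<in>\<W>. {t \<in> {0..1}. edge_point u v t \<in> W})"
    using assms by (intro openin_Union) (auto simp: open_in_complex_def)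
  moreover have "(\<Union>W\<in>\<W>. {t \<in> {0..1}. edge_point u v t \<in> W}) = {t \<in> {0..1}. edge_point u v t \<in> \<Union>\<W>}"
    by auto
  ultimately show "openin (top_of_set {0..1}) {t \<in> {0..1}. edge_point u v t \<in> \<Union>\<W>}" by simp
qed

lemma open_in_complex_Un: "open_in_complex G A \<Longrightarrow> open_in_complex G B \<Longrightarrow> open_in_complex G (A \<union> B)"
  using open_in_complex_Union[of "{A, B}" G] by auto

lemma open_in_complex_Int:
  assumes "open_in_complex G A" "open_in_complex G B"
  shows "open_in_complex G (A \<inter> B)"
  unfolding open_in_complex_def
proof (intro conjI allI impI)
  show "A \<inter> B \<subseteq> one_complex G" using assms by (auto simp: open_in_complex_def)
  fix u v assume "{u, v} \<in> edges G"
  then have "openin (top_of_set {0..1})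
    ({t \<in> {0..1}. edge_point u v t \<in> A} \<inter> {t \<in> {0..1}. edge_point u v t \<in> B})"
    using assms by (intro openin_Int) (auto simp: open_in_complex_def)
  moreover have "{t \<in> {0..1}. edge_point u v t \<in> A} \<inter> {t \<in> {0..1}. edge_point u v t \<in> B} =
    {t \<in> {0..1}. edge_point u v t \<in> A \<inter> B}" by auto
  ultimately show "openin (top_of_set {0..1}) {t \<in> {0..1}. edge_point u v t \<in> A \<inter> B}" by simp
qed

lemma edge_point_in_complex: "{u, v} \<in> edges G \<Longrightarrow> t \<in> {0..1} \<Longrightarrow> edge_point u v t \<in> one_complex G"
  by (auto simp: one_complex_def closed_edge_def)

lemma open_in_complex_coord:
  assumes "open A"
  shows "open_in_complex G {p \<in> one_complex G. p x \<in> A}"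
  unfolding open_in_complex_def
proof (intro conjI allI impI)
  fix u v assume uv: "{u, v} \<in> edges G"
  have "{t \<in> {0..1}. edge_point u v t \<in> {p \<in> one_complex G. p x \<in> A}} =
    {0..1} \<inter> (\<lambda>t. edge_point u v t x) -` A"
    using edge_point_in_complex[OF uv] by auto
  moreover have "openin (top_of_set {0..1}) ({0..1} \<inter> (\<lambda>t. edge_point u v t x) -` A)"
    by (rule continuous_openin_preimage_gen[OF continuous_on_edge_point assms])
  ultimately show "openin (top_of_set {0..1})
    {t \<in> {0..1}. edge_point u v t \<in> {p \<in> one_complex G. p x \<in> A}}" by simp
qed auto

lemma open_in_complex_gt: "open_in_complex G {p \<in> one_complex G. a < p x}"
  and open_in_complex_lt: "open_in_complex G {p \<in> one_complex G. p x < a}"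
  using open_in_complex_coord[of "{a<..}" G x] open_in_complex_coord[of "{..<a}" G x] by auto

lemma open_in_complex_support: "open_in_complex G {p \<in> one_complex G. \<exists>v\<in>C. p v > 0}"
proof -
  have "{p \<in> one_complex G. \<exists>v\<in>C. p v > 0} = \<Union> ((\<lambda>v. {p \<in> one_complex G. 0 < p v}) ` C)" by auto
  then show ?thesis
    by (simp only:) (rule open_in_complex_Union, auto intro: open_in_complex_gt)
qed

lemma openin_freudenthal_Point: "open_in_complex G W \<Longrightarrow> openin (freudenthal G) (Point ` W)"
  unfolding freudenthal_def by (rule topology_generated_by_Basis) blast

text \<open>The end neighbourhoods meet the 1-complex in weakly open sets, so adding the end creates
  no new open sets there.\<close>

lemma open_in_complex_restrict:
  assumes "openin (freudenthal G) U"
  shows "open_in_complex G {p. Point p \<in> U}"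
proof -
  from assms have "generate_topology_on ({Point ` W | W. open_in_complex G W} \<union>
      {end_nbhd G C | C \<omega> S. finite S \<and> S \<subseteq> verts G \<and> \<omega> \<in> ends G \<and>
         C \<in> graph_components (delete_verts G S) \<and> lives_in \<omega> C}) U" (is "generate_topology_on ?B U")
    unfolding freudenthal_def by (rule openin_topology_generated_by)
  then show ?thesis
  proof induction
    case Empty
    show ?case using open_in_complex_Union[of "{}"] by simp
  next
    case (Int a b)
    have "{p. Point p \<in> a \<inter> b} = {p. Point p \<in> a} \<inter> {p. Point p \<in> b}" by auto
    then show ?case using open_in_complex_Int[OF Int.IH] by simp
  next
    case (UN K)
    have "{p. Point p \<in> \<Union>K} = \<Union> ((\<lambda>k. {p. Point p \<in> k}) ` K)" by auto
    then show ?case using UN.IH by (simp only:) (rule open_in_complex_Union, auto)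
  next
    case (Basis s)
    then consider W where "s = Point ` W" "open_in_complex G W" | C where "s = end_nbhd G C" by auto
    then show ?case
    proof cases
      case 1
      have "{p. Point p \<in> Point ` W} = W" by auto
      then show ?thesis using 1 by simp
    next
      case 2
      have "{p. Point p \<in> end_nbhd G C} = {p \<in> one_complex G. \<exists>v\<in>C. p v > 0}"
        by (auto simp: end_nbhd_def)
      then show ?thesis using 2 open_in_complex_support by simp
    qed
  qed
qed

context one_ended_cubic
begin

abbreviation "X \<equiv> freudenthal G"

lemma exists_edge_at:
  assumes "v \<in> V"
  obtains w where "{v, w} \<in> E" "v \<noteq> w"
proof -
  have "{e \<in> E. v \<in> e} \<noteq> {}" using deg_E[OF assms] by (intro notI) (simp add: deg_def)
  then obtain e where "e \<in> E" "v \<in> e" by blast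
  then show thesis using that edge_cases_at by metis
qed

text \<open>Vertices need no separate case, since each of them lies on an edge.\<close>

lemma one_complex_iff: "p \<in> one_complex G \<longleftrightarrow> (\<exists>u v t. {u, v} \<in> E \<and> t \<in> {0..1} \<and> p = edge_point u v t)"
proof
  assume "p \<in> one_complex G"
  then consider v where "v \<in> V" "p = vertex_point v" | "\<exists>u v t. {u, v} \<in> E \<and> t \<in> {0..1} \<and> p = edge_point u v t"
    by (force simp: one_complex_def closed_edge_def)
  then show "\<exists>u v t. {u, v} \<in> E \<and> t \<in> {0..1} \<and> p = edge_point u v t"
  proof cases
    case 1
    obtain w where w: "{v, w} \<in> E" "v \<noteq> w" using exists_edge_at[OF 1(1)] .
    have "p = edge_point v w 0" using 1(2) w(2) by (auto simp: vertex_point_def edge_point_def)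
    then show ?thesis using w(1) by (intro exI[of _ v] exI[of _ w] exI[of _ 0]) simp
  qed
next
  assume "\<exists>u v t. {u, v} \<in> E \<and> t \<in> {0..1} \<and> p = edge_point u v t"
  then show "p \<in> one_complex G" by (elim exE conjE) (simp only: edge_point_in_complex)
qed

lemma one_complex_cases:
  assumes "p \<in> one_complex G"
  obtains u v t where "{u, v} \<in> E" "u \<noteq> v" "0 \<le> t" "t \<le> 1" "p = edge_point u v t"
  using assms edge_ends unfolding one_complex_iff by fastforce

lemma coord_nonneg: "p \<in> one_complex G \<Longrightarrow> 0 \<le> p x"
  by (erule one_complex_cases) (auto simp: edge_point_def)

lemma exists_pos_coord:
  assumes "p \<in> one_complex G"
  obtains v where "v \<in> V" "p v > 0"
proof -
  from assms obtain u v t where uv: "{u, v} \<in> E" "u \<noteq> v" "0 \<le> t" "t \<le> 1" "p = edge_point u v t"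
    by (rule one_complex_cases)
  then show thesis using that[of u] that[of v] edge_ends[OF uv(1)]
    by (cases "t = 1") (auto simp: edge_point_def)
qed

text \<open>Only inner points of an edge have two positive coordinates, and these reveal both the
  edge and the position on it.\<close>

lemma two_pos_coords:
  assumes p: "p \<in> one_complex G" and "p u > 0" "p v > 0" "u \<noteq> v"
  shows "{u, v} \<in> E" "p = edge_point u v (p v)" "p u = 1 - p v"
proof -
  from p obtain a b t where ab: "{a, b} \<in> E" "a \<noteq> b" "0 \<le> t" "t \<le> 1" "p = edge_point a b t"
    by (rule one_complex_cases)
  then have "u \<in> {a, b}" "v \<in> {a, b}" using assms by (auto simp: edge_point_def split: if_splits)
  then consider "u = a" "v = b" | "u = b" "v = a" using assms(4) by auto
  then have "{u, v} \<in> E \<and> p = edge_point u v (p v) \<and> p u = 1 - p v"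
  proof cases
    case 1
    then show ?thesis using ab by (simp add: edge_point_simps)
  next
    case 2
    then show ?thesis using ab edge_point_commute[OF ab(2), of t]
      by (simp add: edge_point_simps insert_commute)
  qed
  then show "{u, v} \<in> E" "p = edge_point u v (p v)" "p u = 1 - p v" by blast+
qed

lemma coord_between:
  assumes p: "p \<in> one_complex G" and "0 < p v" "p v < 1"
  obtains w where "w \<noteq> v" "p w = 1 - p v"
proof -
  from p obtain a b t where ab: "{a, b} \<in> E" "a \<noteq> b" "0 \<le> t" "t \<le> 1" "p = edge_point a b t"
    by (rule one_complex_cases)
  then have "v = a \<or> v = b" using assms by (auto simp: edge_point_def split: if_splits)
  then show thesis using that[of a] that[of b] ab by (auto simp: edge_point_simps)
qed

lemma topspace_X: "topspace X = Point ` one_complex G \<union> {End \<omega>}"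
proof
  show "topspace X \<subseteq> Point ` one_complex G \<union> {End \<omega>}"
    unfolding freudenthal_def topology_generated_by_topspace
    by (rule Union_least, elim UnE CollectE exE conjE)
      (auto simp: open_in_complex_def end_nbhd_def ends_G)
  have "open_in_complex G (one_complex G)"
    using open_in_complex_coord[of UNIV G] by simp
  then have "Point ` one_complex G \<subseteq> topspace X"
    by (rule openin_subset[OF openin_freudenthal_Point])
  moreover have "End \<omega> \<in> topspace X"
  proof -
    obtain C where C: "C \<in> graph_components (delete_verts G {})" "lives_in \<omega> C"
      using end_lives[of "{}"] by auto
    then have "openin X (end_nbhd G C)" unfolding freudenthal_def
      by (intro topology_generated_by_Basis) (use ends_G in blast)
    moreover have "End \<omega> \<in> end_nbhd G C" using C by (simp add: end_nbhd_def ends_G)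
    ultimately show ?thesis by (meson openin_subset subsetD)
  qed
  ultimately show "Point ` one_complex G \<union> {End \<omega>} \<subseteq> topspace X" by blast
qed

text \<open>For a single end, this replaces the components in the definition of its neighbourhoods
  by a condition on coordinates that is easy to check.\<close>

lemma openin_X_End:
  assumes W: "open_in_complex G W" and S: "finite S" "S \<subseteq> V"
    and far: "\<And>p. p \<in> one_complex G \<Longrightarrow> (\<And>v. v \<in> S \<Longrightarrow> p v = 0) \<Longrightarrow> p \<in> W"
  shows "openin X (insert (End \<omega>) (Point ` W))"
proof -
  \<comment> \<open>Deleting the neighbours of \<open>S\<close> as well keeps the edges at
    \<open>C\<close> away from \<open>S\<close>, so all points of the resulting neighbourhood vanish
    on \<open>S\<close>.\<close>
  define S' where "S' = S \<union> (\<Union>v\<in>S. {w. {v, w} \<in> E})"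
  have S': "finite S'" "S' \<subseteq> V" using S finite_nbrs edge_ends by (auto simp: S'_def)
  obtain C where C: "C \<in> graph_components (delete_verts G S')" "lives_in \<omega> C" "C \<subseteq> V - S'"
    by (rule end_lives[OF S'])
  have "openin X (end_nbhd G C)" unfolding freudenthal_def
    by (rule topology_generated_by_Basis) (use ends_G C S' in blast)
  moreover have "end_nbhd G C = insert (End \<omega>) (Point ` {p \<in> one_complex G. \<exists>v\<in>C. p v > 0})"
    using C by (auto simp: end_nbhd_def ends_G)
  moreover have "{p \<in> one_complex G. \<exists>v\<in>C. p v > 0} \<subseteq> W"
  proof
    fix p assume "p \<in> {p \<in> one_complex G. \<exists>v\<in>C. p v > 0}"
    then obtain v where p: "p \<in> one_complex G" "v \<in> C" "p v > 0" by blast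
    have "p w = 0" if w: "w \<in> S" for w
    proof (rule ccontr)
      assume "p w \<noteq> 0"
      then have "p w > 0" using coord_nonneg[OF p(1), of w] by simp
      moreover have "v \<notin> S'" using p(2) C(3) by blast
      moreover then have "w \<noteq> v" using w by (auto simp: S'_def)
      ultimately have "{w, v} \<in> E" using two_pos_coords(1)[OF p(1)] p(3) by blast
      then show False using w \<open>v \<notin> S'\<close> by (auto simp: S'_def)
    qed
    then show "p \<in> W" by (rule far[OF p(1)])
  qed
  ultimately have "insert (End \<omega>) (Point ` W) = Point ` W \<union> end_nbhd G C" by blast
  then show ?thesis using openin_freudenthal_Point[OF W] \<open>openin X (end_nbhd G C)\<close>
    by (simp add: openin_Un)
qed

text \<open>Coordinates separate: two points of the 1-complex by a level between different values, a
  point and the end by half of a positive coordinate.\<close>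

lemma Hausdorff_X: "Hausdorff_space X"
proof -
  have *: "\<exists>U U'. openin X U \<and> openin X U' \<and> Point p \<in> U \<and> Point q \<in> U' \<and> disjnt U U'"
    if pq: "p \<in> one_complex G" "q \<in> one_complex G" "p v < q v" for p q v
  proof -
    define c where "c = (p v + q v) / 2"
    have c: "p v < c" "c < q v" using pq(3) by (auto simp: c_def)
    have "disjnt (Point ` {p \<in> one_complex G. p v < c}) (Point ` {p \<in> one_complex G. c < p v})"
      by (auto simp: disjnt_def)
    moreover have "Point p \<in> Point ` {p \<in> one_complex G. p v < c}" "Point q \<in> Point ` {p \<in> one_complex G. c < p v}"
      using pq c by auto
    moreover have "openin X (Point ` {p \<in> one_complex G. p v < c})"
      by (rule openin_freudenthal_Point, rule open_in_complex_lt)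
    moreover have "openin X (Point ` {p \<in> one_complex G. c < p v})"
      by (rule openin_freudenthal_Point, rule open_in_complex_gt)
    ultimately show ?thesis by (intro exI conjI)
  qed
  have E: "\<exists>U U'. openin X U \<and> openin X U' \<and> Point p \<in> U \<and> End \<omega> \<in> U' \<and> disjnt U U'"
    if p: "p \<in> one_complex G" for p
  proof -
    obtain v where v: "v \<in> V" "p v > 0" using exists_pos_coord[OF p] .
    define c where "c = p v / 2"
    have c: "0 < c" "c < p v" using v by (auto simp: c_def)
    have "openin X (insert (End \<omega>) (Point ` {p \<in> one_complex G. p v < c}))"
      by (rule openin_X_End[OF open_in_complex_lt, of "{v}"]) (use v c in auto)
    moreover have "openin X (Point ` {p \<in> one_complex G. c < p v})"
      by (rule openin_freudenthal_Point[OF open_in_complex_gt])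
    moreover have "disjnt (Point ` {p \<in> one_complex G. c < p v}) (insert (End \<omega>) (Point ` {p \<in> one_complex G. p v < c}))"
      by (auto simp: disjnt_def)
    moreover have "Point p \<in> Point ` {p \<in> one_complex G. c < p v}" using p c by auto
    ultimately show ?thesis by blast
  qed
  show ?thesis
    unfolding Hausdorff_space_def
  proof (intro allI impI)
    fix x y assume xy: "x \<in> topspace X \<and> y \<in> topspace X \<and> x \<noteq> y"
    show "\<exists>U U'. openin X U \<and> openin X U' \<and> x \<in> U \<and> y \<in> U' \<and> disjnt U U'"
    proof (cases "x = End \<omega> \<or> y = End \<omega>")
      case True
      then show ?thesis using E xy unfolding topspace_X by (metis (no_types) UnE disjnt_sym imageE singletonD)
    next
      case False
      then obtain p q where pq: "x = Point p" "y = Point q" "p \<in> one_complex G" "q \<in> one_complex G" "p \<noteq> q"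
        using xy unfolding topspace_X by blast
      then obtain v where "p v < q v \<or> q v < p v" by (metis ext less_linear)
      then show ?thesis using *[OF pq(3,4)] *[OF pq(4,3)] pq(1,2) by (metis (no_types) disjnt_sym)
    qed
  qed
qed

lemma continuous_map_edge:
  assumes "{u, v} \<in> E"
  shows "continuous_map (top_of_set {0..1}) X (\<lambda>t. Point (edge_point u v t))"
  unfolding continuous_map_def
proof (intro conjI allI impI)
  show "(\<lambda>t. Point (edge_point u v t)) \<in> topspace (top_of_set {0..1}) \<rightarrow> topspace X"
    using edge_point_in_complex[OF assms] by (auto simp: topspace_X)
  fix U assume "openin X U"
  from open_in_complex_restrict[OF this] assms
  show "openin (top_of_set {0..1}) {t \<in> topspace (top_of_set {0..1}). Point (edge_point u v t) \<in> U}"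
    by (auto simp: open_in_complex_def)
qed

end

section \<open>From spanning double rays to Hamilton circles\<close>

definition double_ray_point :: "(int \<Rightarrow> 'a) \<Rightarrow> real \<Rightarrow> 'a \<Rightarrow> real" where
  "double_ray_point f x = edge_point (f \<lfloor>x\<rfloor>) (f (\<lfloor>x\<rfloor> + 1)) (frac x)"

text \<open>As a function of \<open>x\<close>, each coordinate is a tent centred at the index of its
  vertex. Injectivity and the edges on the circle are read off from these tents.\<close>

lemma double_ray_point_coord:
  assumes "inj f"
  shows "double_ray_point f x (f j) = max 0 (1 - \<bar>x - of_int j\<bar>)"
proof -
  define i where "i = \<lfloor>x\<rfloor>"
  have i: "of_int i \<le> x" "x < of_int i + 1" unfolding i_def by linarith+
  have fr: "frac x = x - of_int i" by (simp add: frac_def i_def)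
  have eq: "double_ray_point f x (f j) = (if j = i then 1 - (x - of_int i) else if j = i + 1 then x - of_int i else 0)"
    using assms by (simp add: double_ray_point_def edge_point_def fr i_def[symmetric] inj_eq)
  consider "j = i" | "j = i + 1" | "j \<le> i - 1" | "j \<ge> i + 2" by linarith
  then show ?thesis
  proof cases
    case 3
    then have "of_int j \<le> (of_int (i - 1) :: real)" by (simp only: of_int_le_iff)
    then show ?thesis unfolding eq using 3 i by simp
  next
    case 4
    then have "(of_int (i + 2) :: real) \<le> of_int j" by (simp only: of_int_le_iff)
    then show ?thesis unfolding eq using 4 i by simp
  qed (use eq i in auto)
qed

text \<open>The right end is included: there the floor jumps to \<open>n + 1\<close>, but both edges
  give the same vertex.\<close>

lemma double_ray_point_segment:
  assumes f: "inj f" and x: "of_int n \<le> x" "x \<le> of_int n + 1"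
  shows "double_ray_point f x = edge_point (f n) (f (n + 1)) (x - of_int n)"
proof (cases "x = of_int n + 1")
  case True
  then have "\<lfloor>x\<rfloor> = n + 1" "frac x = 0" by (auto simp: frac_def)
  then show ?thesis using f True
    by (auto simp: double_ray_point_def edge_point_def inj_eq fun_eq_iff)
next
  case False
  then have "\<lfloor>x\<rfloor> = n" using x by (intro floor_unique) auto
  then show ?thesis by (simp add: double_ray_point_def frac_def)
qed

text \<open>With \<open>n\<close> the floor of \<open>x\<close>, the tent at \<open>n\<close> gives
  the distance of \<open>y\<close> from \<open>n\<close>, and the tent at \<open>n + 1\<close>
  decides the side.\<close>

lemma inj_double_ray_point:
  assumes f: "inj f"
  shows "inj (double_ray_point f)"
proof (rule injI)
  fix x y assume eq: "double_ray_point f x = double_ray_point f y"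
  define n where "n = \<lfloor>x\<rfloor>"
  have n: "of_int n \<le> x" "x < of_int n + 1" unfolding n_def by linarith+
  have *: "max 0 (1 - \<bar>x - of_int j\<bar>) = max 0 (1 - \<bar>y - of_int j\<bar>)" for j
    using arg_cong[OF eq, of "\<lambda>p. p (f j)"] by (simp add: double_ray_point_coord[OF f])
  have 1: "\<bar>y - of_int n\<bar> = x - of_int n" using *[of n] n by (auto simp: max_def split: if_splits)
  have 2: "max 0 (1 - \<bar>y - of_int n - 1\<bar>) = x - of_int n"
    using *[of "n + 1"] n by (auto simp: max_def algebra_simps split: if_splits)
  show "x = y" using 1 2 n by (auto simp: max_def split: if_splits)
qed

lemma double_ray_point_vertex: "inj f \<Longrightarrow> double_ray_point f (of_int i) = vertex_point (f i)"
  by (auto simp: double_ray_point_def vertex_point_def edge_point_def inj_eq fun_eq_iff)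

text \<open>Stereographic projection of the unit circle from the point 1.\<close>

definition stereo :: "complex \<Rightarrow> real" where
  "stereo z = Im z / (1 - Re z)"

lemma unit_circle_iff: "z \<in> sphere 0 1 \<longleftrightarrow> (Re z)\<^sup>2 + (Im z)\<^sup>2 = 1"
  by (simp add: cmod_def)

lemma Re_less_1:
  assumes "z \<in> sphere 0 1" "z \<noteq> 1"
  shows "Re z < 1"
proof (rule ccontr)
  assume "\<not> Re z < 1"
  moreover have "(Re z)\<^sup>2 + (Im z)\<^sup>2 = 1" using assms(1) unit_circle_iff by blast
  moreover have "Re z \<le> 1" using complex_Re_le_cmod[of z] assms(1) by simp
  ultimately have "Re z = 1" by simp
  with \<open>(Re z)\<^sup>2 + (Im z)\<^sup>2 = 1\<close> have "Im z = 0" by simp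
  with \<open>Re z = 1\<close> assms(2) show False by (simp add: complex_eq_iff)
qed

text \<open>On the circle \<open>(Im z)^2 = (1 - Re z) * (1 + Re z)\<close>. This recovers
  \<open>Re z\<close> from the projection, both for injectivity and for estimates near 1.\<close>

lemma stereo_square:
  assumes "z \<in> sphere 0 1" "z \<noteq> 1"
  shows "(stereo z)\<^sup>2 * (1 - Re z) = 1 + Re z"
proof -
  have r: "Re z < 1" using Re_less_1[OF assms] .
  have "(Im z)\<^sup>2 = (1 - Re z) * (1 + Re z)"
    using assms(1) unfolding unit_circle_iff by (simp add: algebra_simps power2_eq_square)
  then show ?thesis using r by (simp add: stereo_def power_divide power2_eq_square)
qed

lemma inj_on_stereo: "inj_on stereo (sphere 0 1 - {1})"
proof (rule inj_onI)
  fix z w assume z: "z \<in> sphere 0 1 - {1}" and w: "w \<in> sphere 0 1 - {1}" and eq: "stereo z = stereo w"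
  have rz: "Re z < 1" and rw: "Re w < 1" using Re_less_1 z w by auto
  have "(1 + Re z) * (1 - Re w) = (stereo z)\<^sup>2 * (1 - Re z) * (1 - Re w)"
    using stereo_square[of z] z by simp
  also have "\<dots> = (stereo w)\<^sup>2 * (1 - Re w) * (1 - Re z)" unfolding eq by (simp only: mult_ac)
  also have "\<dots> = (1 + Re w) * (1 - Re z)" using stereo_square[of w] w by simp
  finally have re: "Re z = Re w" by (simp add: algebra_simps)
  have "Im z = stereo z * (1 - Re z)" "Im w = stereo w * (1 - Re w)"
    using rz rw by (simp_all add: stereo_def)
  then have "Im z = Im w" using eq re by simp
  with re show "z = w" by (simp add: complex_eq_iff)
qed

lemma stereo_surj: "\<exists>z\<in>sphere 0 1 - {1}. stereo z = x"
proof -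
  define d where "d = x\<^sup>2 + 1"
  have d: "d > 0" unfolding d_def by (rule add_nonneg_pos) simp_all
  \<comment> \<open>The rational parametrisation of the circle, inverse to
    \<open>stereo\<close>.\<close>
  define z where "z = Complex ((x\<^sup>2 - 1) / d) (2 * x / d)"
  have "(x\<^sup>2 - 1)\<^sup>2 + (2 * x)\<^sup>2 = d\<^sup>2" by (simp add: d_def power2_eq_square algebra_simps)
  then have "((x\<^sup>2 - 1) / d)\<^sup>2 + (2 * x / d)\<^sup>2 = 1"
    using d by (simp add: power_divide add_divide_distrib[symmetric])
  then have "z \<in> sphere 0 1" unfolding unit_circle_iff by (simp add: z_def)
  moreover have 1: "1 - Re z = 2 / d" using d by (simp add: z_def d_def field_simps)
  then have "z \<noteq> 1" using d by auto
  moreover have "stereo z = x" unfolding stereo_def 1 using d by (simp add: z_def)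
  ultimately show ?thesis by blast
qed

lemma continuous_on_stereo: "continuous_on (sphere 0 1 - {1}) stereo"
  unfolding stereo_def by (intro continuous_intros) (use Re_less_1 in fastforce)

text \<open>The threshold is the real part of the two points projecting to \<open>B\<close> and
  \<open>-B\<close>. It describes neighbourhoods of 1 by half-planes.\<close>

lemma stereo_large:
  assumes z: "z \<in> sphere 0 1" "z \<noteq> 1" and B: "0 \<le> B" "(B\<^sup>2 - 1) / (B\<^sup>2 + 1) < Re z"
  shows "B < \<bar>stereo z\<bar>"
proof -
  have r: "Re z < 1" using Re_less_1[OF z] .
  have "B\<^sup>2 + 1 > 0" by (rule add_nonneg_pos) simp_all
  then have "B\<^sup>2 - 1 < Re z * (B\<^sup>2 + 1)" using B(2) by (simp add: divide_less_eq)
  then have "B\<^sup>2 * (1 - Re z) < (stereo z)\<^sup>2 * (1 - Re z)"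
    unfolding stereo_square[OF z] by (simp add: algebra_simps)
  then have "B\<^sup>2 < (stereo z)\<^sup>2" using r by simp
  then show ?thesis using B(1) by (metis abs_ge_zero power2_abs power_less_imp_less_base)
qed

section \<open>The circle formed by a spanning double ray and the end\<close>

locale spanning_double_ray = one_ended_cubic G \<omega> for G :: "'a ugraph" and \<omega> +
  fixes f :: "int \<Rightarrow> 'a"
  assumes inj_f: "inj f" and range_f: "range f = verts G" and f_edge: "{f i, f (i + 1)} \<in> edges G"
begin

abbreviation "\<gamma> \<equiv> double_ray_point f"

lemma gamma_in_complex: "\<gamma> x \<in> one_complex G"
  unfolding double_ray_point_def
  by (rule edge_point_in_complex[OF f_edge]) (auto simp: frac_lt_1 less_imp_le)

text \<open>In the weak topology the preimage is open in each closed unit interval; around an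
  integer the two adjacent intervals must be joined.\<close>

lemma open_gamma_preimage:
  assumes W: "open_in_complex G W"
  shows "open {x. \<gamma> x \<in> W}"
proof -
  have "\<exists>U. open U \<and> (\<forall>t\<in>{0..1}. edge_point (f n) (f (n + 1)) t \<in> W \<longleftrightarrow> t \<in> U)" for n
  proof -
    have "openin (top_of_set {0..1}) {t \<in> {0..1}. edge_point (f n) (f (n + 1)) t \<in> W}"
      using W f_edge by (auto simp: open_in_complex_def)
    then obtain U where "open U" "{t \<in> {0..1}. edge_point (f n) (f (n + 1)) t \<in> W} = {0..1} \<inter> U"
      unfolding openin_open by blast
    then show ?thesis by blast
  qed
  then obtain U where U: "\<And>n. open (U n)"
    "\<And>n t. t \<in> {0..1} \<Longrightarrow> edge_point (f n) (f (n + 1)) t \<in> W \<longleftrightarrow> t \<in> U n" by metis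
  have seg: "\<gamma> y \<in> W \<longleftrightarrow> y - of_int n \<in> U n" if "of_int n \<le> y" "y \<le> of_int n + 1" for n y
    using double_ray_point_segment[OF inj_f that] U(2)[of "y - of_int n" n] that by auto
  have opn: "open ((\<lambda>y. y - c) -` U n)" for c :: real and n
    by (rule open_vimage[OF U(1)]) (intro continuous_intros)
  have "\<exists>T. open T \<and> x \<in> T \<and> T \<subseteq> {x. \<gamma> x \<in> W}" if x: "\<gamma> x \<in> W" for x
  proof -
    define n where "n = \<lfloor>x\<rfloor>"
    have n: "of_int n \<le> x" "x < of_int n + 1" unfolding n_def by linarith+
    have xU: "x - of_int n \<in> U n" using seg[of n x] n x by simp
    show ?thesis
    proof (cases "x = of_int n")
      case False
      let ?T = "(\<lambda>y. y - of_int n) -` U n \<inter> {of_int n <..< of_int n + 1}"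
      have "open ?T" by (intro open_Int opn open_greaterThanLessThan)
      moreover have "x \<in> ?T" using xU n False by simp
      moreover have "?T \<subseteq> {x. \<gamma> x \<in> W}" using seg[of n] by auto
      ultimately show ?thesis by blast
    next
      case True
      let ?T = "(\<lambda>y. y - of_int n) -` U n \<inter> (\<lambda>y. y - of_int (n - 1)) -` U (n - 1)
        \<inter> {of_int n - 1 <..< of_int n + 1}"
      have "open ?T" by (intro open_Int opn open_greaterThanLessThan)
      moreover have "x \<in> ?T" using xU seg[of "n - 1" x] x True by simp
      moreover have "?T \<subseteq> {x. \<gamma> x \<in> W}"
      proof
        fix y assume y: "y \<in> ?T"
        show "y \<in> {x. \<gamma> x \<in> W}"
          using seg[of n y] seg[of "n - 1" y] y by (cases "of_int n \<le> y") auto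
      qed
      ultimately show ?thesis by blast
    qed
  qed
  then show ?thesis unfolding open_subopen[of "{x. \<gamma> x \<in> W}"] by blast
qed

lemma double_ray_tails: "ray G (\<lambda>n. f (int n))" "ray G (\<lambda>n. f (- int n))"
proof -
  have V: "f i \<in> verts G" for i using range_f by blast
  have "{f (int n), f (int (Suc n))} \<in> edges G" for n
    using f_edge[of "int n"] by (simp add: add.commute)
  moreover have "{f (- int n), f (- int (Suc n))} \<in> edges G" for n
    using f_edge[of "- int (Suc n)"] by (simp add: insert_commute)
  ultimately show "ray G (\<lambda>n. f (int n))" "ray G (\<lambda>n. f (- int n))"
    using inj_eq[OF inj_f] V by (auto simp: ray_def intro!: injI)
qed

text \<open>Both halves of the double ray belong to the only end, so they eventually stay in each of
  its basic neighbourhoods; intersections and unions follow by induction on how \<open>U\<close> is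
  generated. This is continuity at the point 1 of the circle.\<close>

lemma gamma_tails:
  assumes "openin X U" "End \<omega> \<in> U"
  shows "\<exists>B. \<forall>x. B < \<bar>x\<bar> \<longrightarrow> Point (\<gamma> x) \<in> U"
proof -
  have "generate_topology_on ({Point ` W | W. open_in_complex G W} \<union>
      {end_nbhd G C | C \<omega> S. finite S \<and> S \<subseteq> verts G \<and> \<omega> \<in> ends G \<and>
         C \<in> graph_components (delete_verts G S) \<and> lives_in \<omega> C}) U"
    using assms(1) unfolding freudenthal_def by (rule openin_topology_generated_by)
  then show ?thesis using assms(2)
  proof induction
    case (Int a b)
    then obtain A B where "\<forall>x. A < \<bar>x\<bar> \<longrightarrow> Point (\<gamma> x) \<in> a" "\<forall>x. B < \<bar>x\<bar> \<longrightarrow> Point (\<gamma> x) \<in> b"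
      by auto
    then show ?case by (intro exI[of _ "max A B"]) simp
  next
    case (UN K)
    then obtain k where "k \<in> K" "End \<omega> \<in> k" by blast
    with UN.IH obtain B where "\<forall>x. B < \<bar>x\<bar> \<longrightarrow> Point (\<gamma> x) \<in> k" by blast
    with \<open>k \<in> K\<close> show ?case by blast
  next
    case (Basis s)
    then obtain C where C: "s = end_nbhd G C" "lives_in \<omega> C" by (auto simp: ends_G)
    have "has_tail_in (\<lambda>n. f (int n)) C" "has_tail_in (\<lambda>n. f (- int n)) C"
      using C(2) ray_in_end(1) double_ray_tails by (auto simp: lives_in_def)
    then obtain k l where k: "\<And>n. n \<ge> k \<Longrightarrow> f (int n) \<in> C" and l: "\<And>n. n \<ge> l \<Longrightarrow> f (- int n) \<in> C"
      unfolding has_tail_in_def by blast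
    \<comment> \<open>The summand 1 compensates the rounding of \<open>x\<close> to
      \<open>n\<close>; the coordinate at \<open>f n\<close> is positive because
      \<open>x < n + 1\<close>.\<close>
    have "Point (\<gamma> x) \<in> s" if x: "real k + real l + 1 < \<bar>x\<bar>" for x
    proof -
      define n where "n = \<lfloor>x\<rfloor>"
      have n: "of_int n \<le> x" "x < of_int n + 1" unfolding n_def by linarith+
      have "f n \<in> C"
      proof (cases "x \<ge> 0")
        case True
        then have "int k \<le> n" unfolding n_def using x by linarith
        then show ?thesis using k[of "nat n"] by simp
      next
        case False
        then have "int l \<le> - n" unfolding n_def using x by linarith
        then show ?thesis using l[of "nat (- n)"] by simp
      qed
      moreover have "\<gamma> x (f n) > 0" using n by (simp add: double_ray_point_coord[OF inj_f])
      ultimately show ?thesis unfolding C(1) end_nbhd_def using gamma_in_complex by blast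
    qed
    then show ?case by blast
  qed simp
qed

definition circle_param :: "complex \<Rightarrow> 'a gpoint" where
  "circle_param z = (if z = 1 then End \<omega> else Point (\<gamma> (stereo z)))"

lemma circle_param_image: "circle_param ` sphere 0 1 = insert (End \<omega>) (Point ` range \<gamma>)"
proof (intro equalityI subsetI)
  fix y assume "y \<in> insert (End \<omega>) (Point ` range \<gamma>)"
  then consider "y = End \<omega>" | x where "y = Point (\<gamma> x)" by blast
  then show "y \<in> circle_param ` sphere 0 1"
  proof cases
    case 1
    then show ?thesis by (intro image_eqI[of _ _ 1]) (auto simp: circle_param_def)
  next
    case 2
    obtain z where "z \<in> sphere 0 1 - {1}" "stereo z = x" using stereo_surj by blast
    with 2 show ?thesis by (intro image_eqI[of _ _ z]) (auto simp: circle_param_def)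
  qed
qed (auto simp: circle_param_def)

lemma continuous_circle_param: "continuous_map (top_of_set (sphere 0 1)) X circle_param"
  unfolding continuous_map_def
proof (intro conjI allI impI)
  show "circle_param \<in> topspace (top_of_set (sphere 0 1)) \<rightarrow> topspace X"
    using gamma_in_complex by (auto simp: circle_param_def topspace_X)
  fix U assume U: "openin X U"
  let ?S = "sphere 0 1 :: complex set"
  define R where "R = {x. Point (\<gamma> x) \<in> U}"
  have "open R" using open_gamma_preimage[OF open_in_complex_restrict[OF U]] by (simp add: R_def)
  then have "openin (top_of_set (?S - {1})) ((?S - {1}) \<inter> stereo -` R)"
    by (rule continuous_openin_preimage_gen[OF continuous_on_stereo])
  moreover have "openin (top_of_set ?S) (?S - {1})" by (intro openin_delete) simp
  ultimately have P: "openin (top_of_set ?S) ((?S - {1}) \<inter> stereo -` R)" by (rule openin_trans)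
  show "openin (top_of_set ?S) {z \<in> topspace (top_of_set ?S). circle_param z \<in> U}"
  proof (cases "End \<omega> \<in> U")
    case False
    then have "{z \<in> topspace (top_of_set ?S). circle_param z \<in> U} = (?S - {1}) \<inter> stereo -` R"
      by (auto simp: circle_param_def R_def)
    with P show ?thesis by simp
  next
    case True
    then obtain B0 where "\<forall>x. B0 < \<bar>x\<bar> \<longrightarrow> Point (\<gamma> x) \<in> U" using gamma_tails[OF U] by blast
    define B where "B = max 0 B0"
    have B: "0 \<le> B" "\<And>x. B < \<bar>x\<bar> \<Longrightarrow> x \<in> R"
      using \<open>\<forall>x. B0 < \<bar>x\<bar> \<longrightarrow> Point (\<gamma> x) \<in> U\<close> by (auto simp: B_def R_def)
    \<comment> \<open>Circle points other than 1 with a larger real part project outside the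
      interval from \<open>-B\<close> to \<open>B\<close>, so this half-plane cuts out a
      neighbourhood of 1 that is mapped into \<open>U\<close>.\<close>
    let ?c = "(B\<^sup>2 - 1) / (B\<^sup>2 + 1)"
    have "B\<^sup>2 + 1 > 0" by (rule add_nonneg_pos) simp_all
    then have "?c < 1" by (simp add: divide_less_eq)
    have "{z \<in> topspace (top_of_set ?S). circle_param z \<in> U} =
      (?S - {1}) \<inter> stereo -` R \<union> ?S \<inter> {z. ?c < Re z}"
    proof (intro equalityI subsetI)
      fix z assume "z \<in> {z \<in> topspace (top_of_set ?S). circle_param z \<in> U}"
      then show "z \<in> (?S - {1}) \<inter> stereo -` R \<union> ?S \<inter> {z. ?c < Re z}"
        using \<open>?c < 1\<close> by (cases "z = 1") (auto simp: circle_param_def R_def)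
    next
      fix z assume "z \<in> (?S - {1}) \<inter> stereo -` R \<union> ?S \<inter> {z. ?c < Re z}"
      then show "z \<in> {z \<in> topspace (top_of_set ?S). circle_param z \<in> U}"
        using True B(2)[of "stereo z"] stereo_large[of z B] B(1)
        by (cases "z = 1") (auto simp: circle_param_def R_def)
    qed
    moreover have "openin (top_of_set ?S) (?S \<inter> {z. ?c < Re z})"
      by (rule openin_open_Int) (rule open_halfspace_Re_gt)
    ultimately show ?thesis using P by (simp add: openin_Un)
  qed
qed

lemma inj_on_circle_param: "inj_on circle_param (sphere 0 1)"
proof (rule inj_onI)
  fix z w :: complex assume zw: "z \<in> sphere 0 1" "w \<in> sphere 0 1" "circle_param z = circle_param w"
  show "z = w"
  proof (cases "z = 1 \<or> w = 1")
    case True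
    then show ?thesis using zw(3) by (auto simp: circle_param_def split: if_splits)
  next
    case False
    then have "stereo z = stereo w"
      using zw(3) inj_double_ray_point[OF inj_f] by (simp add: circle_param_def inj_eq)
    then show ?thesis using inj_on_stereo zw False by (auto simp: inj_on_def)
  qed
qed

definition "circle_points = insert (End \<omega>) (Point ` range \<gamma>)"

text \<open>The parametrisation is a continuous bijection from a compact space onto a Hausdorff
  space, so its inverse is continuous.\<close>

lemma hamilton_circle_points: "hamilton_circle G circle_points"
proof -
  let ?S = "sphere 0 1 :: complex set"
  have sub: "circle_points \<subseteq> topspace X"
    using gamma_in_complex by (auto simp: circle_points_def topspace_X)
  have "homeomorphic_map (top_of_set ?S) (subtopology X circle_points) circle_param"
  proof (rule continuous_imp_homeomorphic_map)
    show "continuous_map (top_of_set ?S) (subtopology X circle_points) circle_param"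
      using continuous_circle_param circle_param_image
      by (auto simp: continuous_map_in_subtopology circle_points_def)
    show "compact_space (top_of_set ?S)" by (simp add: compact_space_subtopology)
    show "Hausdorff_space (subtopology X circle_points)"
      by (rule Hausdorff_space_subtopology[OF Hausdorff_X])
    show "circle_param ` topspace (top_of_set ?S) = topspace (subtopology X circle_points)"
      using circle_param_image sub by (simp add: circle_points_def Int_absorb1)
    show "inj_on circle_param (topspace (top_of_set ?S))" using inj_on_circle_param by simp
  qed
  then have "subtopology X circle_points homeomorphic_space top_of_set ?S"
    using homeomorphic_map_imp_homeomorphic_space homeomorphic_space_sym by blast
  moreover have "Point (vertex_point v) \<in> circle_points" if "v \<in> verts G" for v
  proof -
    have "v \<in> range f" by (simp only: range_f that)
    then obtain i where "v = f i" by (rule rangeE)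
    then show ?thesis using double_ray_point_vertex[OF inj_f, of i, symmetric]
      by (auto simp: circle_points_def)
  qed
  ultimately show ?thesis
    using sub by (simp add: hamilton_circle_def circle_in_def ends_G) (simp add: circle_points_def)
qed

lemma edges_circle_points: "edges (subgraph_in G circle_points) = {{f i, f (i + 1)} | i. True}"
proof (intro equalityI subsetI)
  fix e assume "e \<in> {{f i, f (i + 1)} | i. True}"
  then obtain i where e: "e = {f i, f (i + 1)}" by blast
  have "p \<in> range \<gamma>" if p: "p \<in> closed_edge e" for p
  proof -
    obtain u v t where t: "e = {u, v}" "0 \<le> t" "t \<le> 1" "p = edge_point u v t"
      using p by (auto simp: closed_edge_def)
    have ne: "f i \<noteq> f (i + 1)" using inj_f by (simp add: inj_eq)
    have seg: "edge_point (f i) (f (i + 1)) s = \<gamma> (of_int i + s)" if "0 \<le> s" "s \<le> 1" for s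
      using double_ray_point_segment[OF inj_f, of i "of_int i + s"] that by simp
    from t(1) e consider "u = f i" "v = f (i + 1)" | "u = f (i + 1)" "v = f i"
      by (auto simp: doubleton_eq_iff)
    then show ?thesis
    proof cases
      case 1
      then show ?thesis using seg[OF t(2,3)] t(4) by simp
    next
      case 2
      then have "p = edge_point (f i) (f (i + 1)) (1 - t)"
        using t(4) edge_point_commute[OF ne, of "1 - t"] by simp
      then show ?thesis using seg[of "1 - t"] t by simp
    qed
  qed
  then show "e \<in> edges (subgraph_in G circle_points)"
    using e f_edge by (auto simp: subgraph_in_def circle_points_def)
next
  fix e assume "e \<in> edges (subgraph_in G circle_points)"
  then have e: "e \<in> edges G" "Point ` closed_edge e \<subseteq> circle_points" by (auto simp: subgraph_in_def)
  obtain u v where uv: "e = {u, v}" "u \<noteq> v" "u \<in> verts G" "v \<in> verts G" by (rule edge_cases[OF e(1)])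
  have "u \<in> range f" "v \<in> range f" by (simp_all only: range_f uv(3,4))
  then obtain a b where ab: "u = f a" "v = f b" by blast
  \<comment> \<open>The midpoint has coordinate 1/2 at both ends. By the tents, \<open>x\<close> has
    distance 1/2 from both indices, so these differ by one.\<close>
  have "edge_point u v (1 / 2) \<in> closed_edge e" using uv(1) by (force simp: closed_edge_def)
  then obtain x where x: "edge_point u v (1 / 2) = \<gamma> x" using e(2) by (auto simp: circle_points_def)
  have "1 / 2 = \<gamma> x (f a)" "1 / 2 = \<gamma> x (f b)"
    unfolding x[symmetric] ab[symmetric] using uv(2) by (simp_all add: edge_point_simps)
  then have "1 / 2 = max 0 (1 - \<bar>x - of_int a\<bar>)" "1 / 2 = max 0 (1 - \<bar>x - of_int b\<bar>)"
    by (simp_all only: double_ray_point_coord[OF inj_f])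
  moreover have "\<bar>t\<bar> = 1 / 2" if "1 / 2 = max 0 (1 - \<bar>t\<bar>)" for t :: real
    using that by (cases "0 \<le> 1 - \<bar>t\<bar>") (simp_all add: max_def)
  ultimately have "\<bar>x - of_int a\<bar> = 1 / 2" "\<bar>x - of_int b\<bar> = 1 / 2" by blast+
  moreover have "a \<noteq> b" using uv(2) ab by blast
  ultimately have "of_int b - of_int a = (1 :: real) \<or> of_int b - of_int a = (-1 :: real)" by (auto simp: abs_if split: if_splits)
  then have "b = a + 1 \<or> a = b + 1" by linarith
  then show "e \<in> {{f i, f (i + 1)} | i. True}" using uv(1) ab by (auto simp: insert_commute)
qed

end

lemma (in one_ended_cubic) ham_imp_hamilton_circle:
  assumes "ham L"
  shows "\<exists>K. hamilton_circle G K \<and> edges (subgraph_in G K) = L"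
proof -
  obtain f :: "int \<Rightarrow> 'a" where f: "inj f" "range f = V" "L = {{f i, f (i + 1)} | i. True}"
    by (rule ham_double_ray[OF assms])
  interpret spanning_double_ray G \<omega> f
    by unfold_locales (use f assms in \<open>auto simp: ham_def\<close>)
  have "edges (subgraph_in G circle_points) = L" by (simp only: edges_circle_points f(3))
  with hamilton_circle_points show ?thesis by blast
qed

section \<open>From Hamilton circles to spanning double rays\<close>

text \<open>Used in two ways: the rest of the circle is connected, and its order as a line limits
  the degrees at a vertex.\<close>

lemma circle_minus_point:
  assumes K: "circle_in Y K" and p: "p \<in> K"
  shows "subtopology Y (K - {p}) homeomorphic_space euclideanreal"
proof -
  let ?S = "sphere 0 1 :: complex set"
  obtain h where h: "homeomorphic_map (subtopology Y K) (top_of_set ?S) h" and sub: "K \<subseteq> topspace Y"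
    using K unfolding circle_in_def homeomorphic_space by blast
  have tK: "topspace (subtopology Y K) = K" using sub by auto
  have im: "h ` K = ?S" "inj_on h K"
    using homeomorphic_imp_surjective_map[OF h] homeomorphic_imp_injective_map[OF h] tK by auto
  have "homeomorphic_map (subtopology (subtopology Y K) (K - {p})) (subtopology (top_of_set ?S) (?S - {h p})) h"
  proof (rule homeomorphic_map_subtopologies[OF h])
    have "h ` (K - {p}) = h ` K - {h p}" using im(2) p by (auto simp: inj_on_def)
    then show "h ` (topspace (subtopology Y K) \<inter> (K - {p})) = topspace (top_of_set ?S) \<inter> (?S - {h p})"
      using im(1) tK by (simp add: Int_absorb1 Int_absorb2 Diff_subset)
  qed
  moreover have "subtopology (subtopology Y K) (K - {p}) = subtopology Y (K - {p})"
    "subtopology (top_of_set ?S) (?S - {h p}) = top_of_set (?S - {h p})"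
    by (simp_all add: subtopology_subtopology Int_absorb1 Diff_subset)
  ultimately have 1: "subtopology Y (K - {p}) homeomorphic_space top_of_set (?S - {h p})"
    using homeomorphic_map_imp_homeomorphic_space by metis
  have "(?S - {h p}) homeomorphic (UNIV :: real set)"
  proof -
    have "h p \<in> ?S" using im p by blast
    \<comment> \<open>A punctured sphere is homeomorphic to an affine set of one dimension less than
      the space; here this is the imaginary axis.\<close>
    moreover have "aff_dim {z. Re z = 0} + 1 = 2"
    proof -
      have "{z. Re z = 0} = {z. 1 \<bullet> z = (0::real)}" by (simp add: inner_complex_def)
      moreover have "aff_dim {z. (1::complex) \<bullet> z = (0::real)} = int (DIM(complex) - 1)"
        by (subst aff_dim_hyperplane) auto
      ultimately show ?thesis by simp
    qed
    moreover have aff: "affine {z. Re z = 0}" by (auto simp: affine_def)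
    ultimately have "(?S - {h p}) homeomorphic {z. Re z = 0}"
      by (intro homeomorphic_punctured_sphere_affine) auto
    also have "{z. Re z = 0} homeomorphic (UNIV :: real set)"
      unfolding homeomorphic_def homeomorphism_def
    proof (intro exI[of _ Im] exI[of _ "\<lambda>t. Complex 0 t"] conjI)
      show "Im ` {z. Re z = 0} = UNIV"
      proof (intro equalityI subsetI)
        fix t :: real
        show "t \<in> Im ` {z. Re z = 0}" by (intro image_eqI[of _ _ "Complex 0 t"]) auto
      qed auto
      have "(\<lambda>t. Complex 0 t) = (\<lambda>t. \<i> * of_real t)" by (auto simp: complex_eq_iff)
      then show "continuous_on UNIV (\<lambda>t. Complex 0 t)" by (simp add: continuous_intros)
    qed (auto simp: complex_eq_iff intro!: continuous_intros)
    finally show ?thesis .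
  qed
  then obtain f g where "homeomorphism (?S - {h p}) (UNIV :: real set) f g"
    unfolding homeomorphic_def by blast
  then have "homeomorphic_maps (top_of_set (?S - {h p})) euclideanreal f g"
    by (auto simp: homeomorphic_maps_def homeomorphism_def continuous_map_in_subtopology image_subset_iff)
  then have "top_of_set (?S - {h p}) homeomorphic_space euclideanreal"
    unfolding homeomorphic_space_def by blast
  with 1 show ?thesis by (rule homeomorphic_space_trans)
qed

lemma connectedin_circle_minus_point:
  assumes K: "circle_in Y K" and p: "p \<in> K"
  shows "connectedin Y (K - {p})"
proof -
  have "connected_space euclideanreal"
    using connectedin_topspace[of euclideanreal] by (simp add: connectedin_iff_connected)
  then have "connected_space (subtopology Y (K - {p}))"
    using homeomorphic_connected_space[OF circle_minus_point[OF assms]] by simp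
  moreover have "K - {p} \<subseteq> topspace Y" using K by (auto simp: circle_in_def)
  ultimately show ?thesis by (simp add: connectedin_def)
qed

lemma connectedin_circle:
  assumes "circle_in Y K"
  shows "connectedin Y K"
proof -
  have "connected_space (top_of_set (sphere (0::complex) 1))"
    using connected_sphere[of "0 :: complex" 1] by (simp add: connectedin_iff_connected[symmetric] connectedin_def)
  then have "connected_space (subtopology Y K)"
    using assms homeomorphic_connected_space unfolding circle_in_def by blast
  then show ?thesis using assms by (simp add: connectedin_def circle_in_def)
qed

text \<open>Three arcs from a common point cannot be embedded in the real line: two of them would
  leave it in the same direction, and so meet again by the intermediate value theorem.\<close>

lemma arcs_meet:
  fixes c d :: "real \<Rightarrow> real"
  assumes cont: "continuous_on {0..1/2} c" "continuous_on {0..1/2} d" and start: "c 0 = d 0"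
    and up: "c 0 < c (1/2)" "d 0 < d (1/2)"
  shows "\<exists>s\<in>{0<..1/2}. \<exists>t\<in>{0<..1/2}. c s = d t"
proof -
  \<comment> \<open>The lower of the two final heights is attained on both curves.\<close>
  define m where "m = min (c (1/2)) (d (1/2))"
  have m: "c 0 < m" "d 0 < m" "m \<le> c (1/2)" "m \<le> d (1/2)" using start up by (auto simp: m_def)
  obtain s where s: "0 \<le> s" "s \<le> 1/2" "c s = m"
    using IVT'[of c 0 m "1/2"] m cont by auto
  obtain t where t: "0 \<le> t" "t \<le> 1/2" "d t = m"
    using IVT'[of d 0 m "1/2"] m cont by auto
  have "s \<noteq> 0" "t \<noteq> 0" using s t m by auto
  with s t have "s \<in> {0<..1/2}" "t \<in> {0<..1/2}" "c s = d t" by simp_all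
  then show ?thesis by blast
qed

section \<open>The edges contained in a Hamilton circle\<close>

locale hamilton_circle_in = one_ended_cubic G \<omega> for G :: "'a ugraph" and \<omega> +
  fixes K :: "'a gpoint set"
  assumes hamilton: "hamilton_circle G K"
begin

lemma circle: "circle_in X K"
  and vertex_in_K: "v \<in> verts G \<Longrightarrow> Point (vertex_point v) \<in> K"
  and End_in_K: "End \<omega> \<in> K"
  using hamilton by (auto simp: hamilton_circle_def ends_G)

lemma K_cases:
  assumes "x \<in> K"
  obtains "x = End \<omega>" | p where "x = Point p" "p \<in> one_complex G"
  using assms circle by (auto simp: circle_in_def topspace_X)

text \<open>The form in which connectedness is used: \<open>Q\<close> contains all points far from
  the finite set \<open>S\<close>, so it stays open when the end is added to its side.\<close>

lemma not_separated:
  assumes conn: "connectedin X A" and "A \<subseteq> K"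
    and P: "open_in_complex G P" and Q: "open_in_complex G Q"
    and S: "finite S" "S \<subseteq> verts G" "\<And>p. p \<in> one_complex G \<Longrightarrow> (\<And>v. v \<in> S \<Longrightarrow> p v = 0) \<Longrightarrow> p \<in> Q"
    and cover: "\<And>p. Point p \<in> A \<Longrightarrow> p \<in> one_complex G \<Longrightarrow> p \<in> P \<or> p \<in> Q"
    and disj: "\<And>p. Point p \<in> A \<Longrightarrow> p \<in> P \<Longrightarrow> p \<notin> Q"
    and p: "p \<in> P" "Point p \<in> A" and "End \<omega> \<in> A"
  shows False
proof -
  have "openin X (Point ` P)" "openin X (insert (End \<omega>) (Point ` Q))"
    using openin_freudenthal_Point[OF P] openin_X_End[OF Q S] by auto
  moreover have "A \<subseteq> Point ` P \<union> insert (End \<omega>) (Point ` Q)"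
  proof
    fix x assume "x \<in> A"
    then have "x \<in> K" using \<open>A \<subseteq> K\<close> by blast
    then show "x \<in> Point ` P \<union> insert (End \<omega>) (Point ` Q)"
      by (rule K_cases) (use cover \<open>x \<in> A\<close> in auto)
  qed
  moreover have "Point ` P \<inter> insert (End \<omega>) (Point ` Q) \<inter> A = {}" using disj by auto
  moreover have "Point ` P \<inter> A \<noteq> {}" "insert (End \<omega>) (Point ` Q) \<inter> A \<noteq> {}"
    using p \<open>End \<omega> \<in> A\<close> by auto
  ultimately show False using conn unfolding connectedin by blast
qed

text \<open>The part of an edge after the point at \<open>s\<close> and before a missing point at \<open>b\<close> would be
  separated from the rest by removing the point at \<open>s\<close>.\<close>

lemma no_point_between:
  assumes uv: "{u, v} \<in> edges G" and s: "0 < s" "b < 1"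
    and b: "Point (edge_point u v b) \<notin> K" and sK: "Point (edge_point u v s) \<in> K"
    and t: "s < t" "t < b"
  shows "Point (edge_point u v t) \<notin> K"
proof
  assume tK: "Point (edge_point u v t) \<in> K"
  have ne: "u \<noteq> v" "u \<in> verts G" "v \<in> verts G" using edge_ends[OF uv] by auto
  \<comment> \<open>\<open>?P\<close> is the open piece between \<open>s\<close> and
    \<open>b\<close>. The condition \<open>p u < 1 - b\<close> puts into \<open>?Q\<close> the
    points of other edges with the same coordinate at \<open>v\<close>; only the points at
    \<open>s\<close> and \<open>b\<close> escape both sets.\<close>
  let ?P = "{p \<in> one_complex G. 0 < p u} \<inter> ({p \<in> one_complex G. s < p v} \<inter> {p \<in> one_complex G. p v < b})"
  let ?Q = "{p \<in> one_complex G. p v < s} \<union> {p \<in> one_complex G. b < p v} \<union> {p \<in> one_complex G. p u < 1 - b}"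
  show False
  proof (rule not_separated[of "K - {Point (edge_point u v s)}" ?P ?Q "{v}" "edge_point u v t"])
    show "connectedin X (K - {Point (edge_point u v s)})"
      by (rule connectedin_circle_minus_point[OF circle sK])
    show "open_in_complex G ?P" "open_in_complex G ?Q"
      by (intro open_in_complex_Int open_in_complex_Un open_in_complex_gt open_in_complex_lt)+
    show "p \<in> ?Q" if "p \<in> one_complex G" "\<And>x. x \<in> {v} \<Longrightarrow> p x = 0" for p using that s by simp
    show "p \<in> ?P \<or> p \<in> ?Q" if p: "Point p \<in> K - {Point (edge_point u v s)}" "p \<in> one_complex G" for p
    proof (rule ccontr)
      assume n: "\<not> (p \<in> ?P \<or> p \<in> ?Q)"
      then have *: "s \<le> p v" "p v \<le> b" "1 - b \<le> p u" using p(2) by auto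
      then have "p = edge_point u v (p v)" using two_pos_coords(2)[OF p(2), of u v] s ne by simp
      moreover have "p v = s \<or> p v = b" using n * p(2) s by auto
      ultimately show False using p(1) b by auto
    qed
    show "p \<notin> ?Q" if p: "Point p \<in> K - {Point (edge_point u v s)}" "p \<in> ?P" for p
      using two_pos_coords(3)[of p u v] that s ne by auto
    have "edge_point u v t \<in> one_complex G" using uv s t by (intro edge_point_in_complex) auto
    then show "edge_point u v t \<in> ?P" using ne s t by (simp add: edge_point_simps)
    have "edge_point u v t v \<noteq> edge_point u v s v" using ne t by (simp add: edge_point_simps)
    then have "edge_point u v t \<noteq> edge_point u v s" by metis
    then show "Point (edge_point u v t) \<in> K - {Point (edge_point u v s)}" using tK by simp
  qed (use ne End_in_K in auto)
qed

text \<open>By \<open>no_point_between\<close>, started at \<open>a\<close> or at an earlier point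
  of \<open>K\<close>, the point at \<open>a\<close> would be the only one of \<open>K\<close> on
  the open edge before \<open>b\<close>. Being isolated contradicts the connectedness of
  \<open>K\<close>.\<close>

lemma interior_before_missing:
  assumes uv: "{u, v} \<in> edges G" and a: "0 < a" "a < b" "b < 1"
    and b: "Point (edge_point u v b) \<notin> K"
  shows "Point (edge_point u v a) \<notin> K"
proof
  assume aK: "Point (edge_point u v a) \<in> K"
  have ne: "u \<noteq> v" "u \<in> verts G" "v \<in> verts G" using edge_ends[OF uv] by auto
  let ?P = "{p \<in> one_complex G. 0 < p u} \<inter> ({p \<in> one_complex G. 0 < p v} \<inter> {p \<in> one_complex G. p v < b})"
  let ?Q = "{p \<in> one_complex G. p v < a} \<union> {p \<in> one_complex G. a < p v} \<union> {p \<in> one_complex G. p u < 1 - a}"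
  show False
  proof (rule not_separated[of K ?P ?Q "{v}" "edge_point u v a"])
    show "connectedin X K" by (rule connectedin_circle[OF circle])
    show "open_in_complex G ?P" "open_in_complex G ?Q"
      by (intro open_in_complex_Int open_in_complex_Un open_in_complex_gt open_in_complex_lt)+
    show "p \<in> ?Q" if "p \<in> one_complex G" "\<And>x. x \<in> {v} \<Longrightarrow> p x = 0" for p using that a by simp
    have "edge_point u v a \<in> one_complex G" using uv a by (intro edge_point_in_complex) auto
    then show aP: "edge_point u v a \<in> ?P" using ne a by (simp add: edge_point_simps)
    show "p \<in> ?P \<or> p \<in> ?Q" if p: "Point p \<in> K" "p \<in> one_complex G" for p
    proof (rule ccontr)
      assume n: "\<not> (p \<in> ?P \<or> p \<in> ?Q)"
      then have *: "p v = a" "1 - a \<le> p u" using p(2) by auto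
      then show False using n p(2) a by auto
    qed
    show "p \<notin> ?Q" if p: "Point p \<in> K" "p \<in> ?P" for p
    proof -
      have pv: "p \<in> one_complex G" "0 < p u" "0 < p v" "p v < b" using p(2) by auto
      have e: "p = edge_point u v (p v)" "p u = 1 - p v" using two_pos_coords(2,3)[OF pv(1-3) ne(1)] .
      have "\<not> a < p v"
        using no_point_between[OF uv a(1,3) b aK, of "p v"] pv(4) p(1) e(1) by auto
      moreover have "\<not> p v < a"
        using no_point_between[OF uv pv(3) a(3) b, of a] p(1) e(1) aK a(2) by auto
      ultimately show ?thesis using e(2) by simp
    qed
    show "Point (edge_point u v a) \<in> K" by (rule aK)
  qed (use ne End_in_K in auto)
qed

text \<open>A missing inner point empties the edge on both sides of it, by
  \<open>interior_before_missing\<close> in the two orientations, so one inner point in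
  \<open>K\<close> leaves no room for a gap.\<close>

lemma edge_in_K:
  assumes uv: "{u, v} \<in> edges G" and a: "0 < a" "a < 1" and aK: "Point (edge_point u v a) \<in> K"
  shows "Point ` closed_edge {u, v} \<subseteq> K"
proof -
  have ne: "u \<noteq> v" "u \<in> verts G" "v \<in> verts G" using edge_ends[OF uv] by auto
  have t: "Point (edge_point u v t) \<in> K" if t01: "0 \<le> t" "t \<le> 1" for t
  proof -
    have e01: "edge_point u v 0 = vertex_point u" "edge_point u v 1 = vertex_point v"
      using ne by (auto simp: edge_point_def vertex_point_def)
    consider "t = 0" | "t = 1" | "t = a" | "0 < t" "t < a" | "a < t" "t < 1" using t01 by linarith
    then show ?thesis
    proof cases
      \<comment> \<open>A gap before \<open>a\<close> lies after it on the reversed edge.\<close>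
      case 4
      show ?thesis
      proof (rule ccontr)
        assume "Point (edge_point u v t) \<notin> K"
        then have "Point (edge_point v u (1 - t)) \<notin> K" using edge_point_commute[OF ne(1)] by simp
        then have "Point (edge_point v u (1 - a)) \<notin> K"
          using interior_before_missing[of v u "1 - a" "1 - t"] uv 4 a by (simp add: insert_commute)
        then show False using aK edge_point_commute[OF ne(1)] by simp
      qed
    next
      case 5
      then show ?thesis using interior_before_missing[OF uv, of a t] a aK by blast
    qed (use aK e01 vertex_in_K ne in auto)
  qed
  show ?thesis
  proof
    fix x assume "x \<in> Point ` closed_edge {u, v}"
    then obtain u' v' s where x: "{u, v} = {u', v'}" "0 \<le> s" "s \<le> 1" "x = Point (edge_point u' v' s)"
      by (auto simp: closed_edge_def)
    then consider "u' = u" "v' = v" | "u' = v" "v' = u" by (auto simp: doubleton_eq_iff)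
    then show "x \<in> K"
    proof cases
      case 1
      then show ?thesis using t[OF x(2,3)] x(4) by simp
    next
      case 2
      then have "x = Point (edge_point u v (1 - s))" using x(4) edge_point_commute[OF ne(1), of "1 - s"] by simp
      then show ?thesis using t[of "1 - s"] x by simp
    qed
  qed
qed

definition "L = edges (subgraph_in G K)"

lemma L_iff: "e \<in> L \<longleftrightarrow> e \<in> edges G \<and> Point ` closed_edge e \<subseteq> K"
  by (simp add: L_def subgraph_in_def)

lemma interior_in_L:
  assumes p: "p \<in> one_complex G" "Point p \<in> K" and uv: "0 < p u" "0 < p v" "u \<noteq> v"
  shows "{u, v} \<in> L"
proof -
  note e = two_pos_coords[OF p(1) uv]
  have "Point (edge_point u v (p v)) \<in> K"
    by (rule subst[OF e(2), of "\<lambda>q. Point q \<in> K", OF p(2)])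
  then have "Point ` closed_edge {u, v} \<subseteq> K"
    using e(3) uv(1) by (intro edge_in_K[OF e(1) uv(2)]) simp_all
  with e(1) show ?thesis by (simp only: L_iff)
qed

text \<open>Otherwise the points of \<open>K\<close> with a positive coordinate in \<open>W\<close>
  and those with one outside \<open>W\<close> would separate \<open>K\<close>, since a point of both
  kinds lies inside a crossing edge.\<close>

lemma L_crosses:
  assumes W: "finite W" "W \<subseteq> verts G" "W \<noteq> {}"
  shows "boundary L W \<noteq> {}"
proof
  assume none: "boundary L W = {}"
  obtain w where w: "w \<in> W" using W by blast
  let ?P = "{p \<in> one_complex G. \<exists>v\<in>W. p v > 0}"
  let ?Q = "{p \<in> one_complex G. \<exists>v\<in>verts G - W. p v > 0}"
  show False
  proof (rule not_separated[of K ?P ?Q W "vertex_point w"])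
    show "connectedin X K" by (rule connectedin_circle[OF circle])
    show "open_in_complex G ?P" "open_in_complex G ?Q" by (rule open_in_complex_support)+
    show "p \<in> ?Q" if p: "p \<in> one_complex G" "\<And>v. v \<in> W \<Longrightarrow> p v = 0" for p
    proof -
      obtain v where v: "v \<in> V" "p v > 0" by (rule exists_pos_coord[OF p(1)])
      then have "v \<notin> W" using p(2)[of v] by auto
      with v p(1) show ?thesis by blast
    qed
    show "p \<in> ?P \<or> p \<in> ?Q" if p: "p \<in> one_complex G" for p
    proof -
      obtain v where "v \<in> V" "p v > 0" by (rule exists_pos_coord[OF p])
      then show ?thesis using p by blast
    qed
    show "p \<notin> ?Q" if p: "Point p \<in> K" "p \<in> ?P" for p
    proof
      assume "p \<in> ?Q"
      then obtain u v where uv: "u \<in> W" "v \<notin> W" "0 < p u" "0 < p v" "p \<in> one_complex G" using p(2) by blast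
      then have "u \<noteq> v" by blast
      then have "{u, v} \<in> L" using interior_in_L[OF uv(5) p(1) uv(3,4)] by blast
      then have "{u, v} \<in> boundary L W" using uv by (auto simp: edge_cut_def)
      with none show False by simp
    qed
    have "vertex_point w \<in> one_complex G" using w W by (auto simp: one_complex_def)
    then show "vertex_point w \<in> ?P" using w by (auto simp: vertex_point_def)
    show "Point (vertex_point w) \<in> K" using w W vertex_in_K by blast
  qed (use W End_in_K in auto)
qed

text \<open>Deleting the midpoint of the only edge at \<open>v\<close> would separate
  \<open>v\<close> from the end, but a circle minus a point is connected.\<close>

lemma deg_L_not_1:
  assumes v: "v \<in> verts G"
  shows "deg (\<lambda>e. e) L v \<noteq> 1"
proof
  assume "deg (\<lambda>e. e) L v = 1"
  then obtain e where e: "{e \<in> L. v \<in> e} = {e}" by (auto simp: deg_def card_1_singleton_iff)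
  then have "e \<in> L" "v \<in> e" by auto
  then have "e \<in> edges G" by (simp add: L_iff)
  then obtain w where w: "e = {v, w}" "v \<noteq> w" by (rule edge_cases_at[OF _ \<open>v \<in> e\<close>])
  let ?m = "edge_point v w (1/2)"
  have "?m \<in> closed_edge e" using w(1) by (force simp: closed_edge_def)
  then have mK: "Point ?m \<in> K" using \<open>e \<in> L\<close> unfolding L_iff by blast
  let ?P = "{p \<in> one_complex G. 1/2 < p v}" and ?Q = "{p \<in> one_complex G. p v < 1/2}"
  show False
  proof (rule not_separated[of "K - {Point ?m}" ?P ?Q "{v}" "vertex_point v"])
    show "connectedin X (K - {Point ?m})" by (rule connectedin_circle_minus_point[OF circle mK])
    show "open_in_complex G ?P" by (rule open_in_complex_gt)
    show "open_in_complex G ?Q" by (rule open_in_complex_lt)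
    show "p \<in> ?P \<or> p \<in> ?Q" if p: "Point p \<in> K - {Point ?m}" "p \<in> one_complex G" for p
    proof (rule ccontr)
      assume "\<not> (p \<in> ?P \<or> p \<in> ?Q)"
      then have pv: "p v = 1/2" using p(2) by auto
      obtain y where y: "y \<noteq> v" "p y = 1 - p v"
        by (rule coord_between[OF p(2), of v]) (use pv in auto)
      have "{y, v} \<in> L" by (rule interior_in_L[OF p(2)]) (use p y pv in auto)
      then have "{y, v} \<in> {e \<in> L. v \<in> e}" by simp
      then have "{y, v} = e" unfolding e by simp
      then have "y = w" using w by (auto simp: doubleton_eq_iff)
      then have pw: "p w = 1/2" using y(2) pv by simp
      have "p = edge_point v w (p w)" by (rule two_pos_coords(2)[OF p(2)]) (use pv pw w in auto)
      then have "p = ?m" by (simp only: pw)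
      then show False using p(1) by blast
    qed
    have "vertex_point v \<in> one_complex G" using v by (auto simp: one_complex_def)
    then show "vertex_point v \<in> ?P" by (simp add: vertex_point_def)
    have "vertex_point v v \<noteq> ?m v" by (simp add: vertex_point_def edge_point_simps)
    then have "vertex_point v \<noteq> ?m" by metis
    then show "Point (vertex_point v) \<in> K - {Point ?m}" using vertex_in_K[OF v] by simp
  qed (use v End_in_K in auto)
qed

text \<open>Without the end the circle is a line, in which three half-edges at \<open>v\<close>
  would be arcs that share only their first point; two of them go in the same direction.\<close>

lemma deg_L_not_3:
  assumes v: "v \<in> verts G"
  shows "\<not> 3 \<le> deg (\<lambda>e. e) L v"
proof
  assume "3 \<le> deg (\<lambda>e. e) L v"
  then obtain T where T: "T \<subseteq> {e \<in> L. v \<in> e}" "card T = 3"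
    unfolding deg_def by (metis obtain_subset_with_card_n)
  then obtain e1 e2 e3 where e: "T = {e1, e2, e3}" "e1 \<noteq> e2" "e1 \<noteq> e3" "e2 \<noteq> e3"
    by (auto simp: card_3_iff)
  have eL: "e1 \<in> L" "e2 \<in> L" "e3 \<in> L" "v \<in> e1" "v \<in> e2" "v \<in> e3" using T(1) e(1) by auto
  have eE: "e1 \<in> edges G" "e2 \<in> edges G" "e3 \<in> edges G" using eL by (auto simp: L_iff)
  obtain a where a: "e1 = {v, a}" "v \<noteq> a" by (rule edge_cases_at[OF eE(1) eL(4)])
  obtain b where b: "e2 = {v, b}" "v \<noteq> b" by (rule edge_cases_at[OF eE(2) eL(5)])
  obtain c where c: "e3 = {v, c}" "v \<noteq> c" by (rule edge_cases_at[OF eE(3) eL(6)])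
  have ne: "a \<noteq> b" "a \<noteq> c" "b \<noteq> c" using e a b c by auto
  obtain k where k: "homeomorphic_map (subtopology X (K - {End \<omega>})) euclideanreal k"
    using circle_minus_point[OF circle End_in_K] unfolding homeomorphic_space by blast
  have top: "topspace (subtopology X (K - {End \<omega>})) = K - {End \<omega>}"
    using circle by (auto simp: circle_in_def)
  have inj: "inj_on k (K - {End \<omega>})" using homeomorphic_imp_injective_map[OF k] by (simp only: top)
  define arm where "arm w s = k (Point (edge_point v w s))" for w s
  have inK: "Point (edge_point v w s) \<in> K - {End \<omega>}" if "{v, w} \<in> L" "0 \<le> s" "s \<le> 1" for w s
  proof -
    have "edge_point v w s \<in> closed_edge {v, w}" using that(2,3) by (force simp: closed_edge_def)
    then show ?thesis using that(1) unfolding L_iff by blast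
  qed
  have cont: "continuous_on {0..1/2} (arm w)" if w: "{v, w} \<in> L" for w
  proof -
    have "{v, w} \<in> edges G" using w by (simp add: L_iff)
    then have "continuous_map (top_of_set {0..1}) X (\<lambda>t. Point (edge_point v w t))"
      by (rule continuous_map_edge)
    then have "continuous_map (top_of_set {0..1}) (subtopology X (K - {End \<omega>})) (\<lambda>t. Point (edge_point v w t))"
      using inK[OF w] by (auto simp: continuous_map_in_subtopology)
    then have "continuous_map (top_of_set {0..1}) euclideanreal (k \<circ> (\<lambda>t. Point (edge_point v w t)))"
      using homeomorphic_imp_continuous_map[OF k] by (rule continuous_map_compose)
    then have "continuous_on {0..1} (arm w)" by (simp add: arm_def o_def)
    then show ?thesis by (rule continuous_on_subset) auto
  qed
  have start: "arm w 0 = k (Point (vertex_point v))" if "v \<noteq> w" for w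
  proof -
    have "edge_point v w 0 = vertex_point v" using that by (auto simp: edge_point_def vertex_point_def)
    then show ?thesis by (simp add: arm_def)
  qed
  have apart: "arm w s \<noteq> arm w' t"
    if w: "{v, w} \<in> L" "{v, w'} \<in> L" "v \<noteq> w" "v \<noteq> w'" "w \<noteq> w'" and s: "s \<in> {0<..1/2}" and t: "t \<in> {0<..1/2}"
    for w w' s t
  proof
    assume "arm w s = arm w' t"
    then have "edge_point v w s = edge_point v w' t"
      using inj_onD[OF inj, OF _ inK inK, of w s w' t] w s t by (simp add: arm_def)
    then have "edge_point v w s w = edge_point v w' t w" by simp
    then show False using w s by (simp add: edge_point_simps)
  qed
  have leave: "arm w (1/2) \<noteq> k (Point (vertex_point v))" if w: "{v, w} \<in> L" "v \<noteq> w" for w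
  proof
    assume "arm w (1/2) = k (Point (vertex_point v))"
    then have "arm w (1/2) = arm w 0" using start[OF w(2)] by simp
    then have "edge_point v w (1/2) = edge_point v w 0"
      using inj_onD[OF inj, OF _ inK inK, of w "1/2" w 0] w by (simp add: arm_def)
    then have "edge_point v w (1/2) w = edge_point v w 0 w" by simp
    then show False using w by (simp add: edge_point_simps)
  qed
  let ?t = "k (Point (vertex_point v))"
  have up: "\<not> (?t < arm w (1/2) \<and> ?t < arm w' (1/2))"
    and down: "\<not> (arm w (1/2) < ?t \<and> arm w' (1/2) < ?t)"
    if w: "{v, w} \<in> L" "{v, w'} \<in> L" "v \<noteq> w" "v \<noteq> w'" "w \<noteq> w'" for w w'
  proof -
    show "\<not> (?t < arm w (1/2) \<and> ?t < arm w' (1/2))"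
      using arcs_meet[OF cont[OF w(1)] cont[OF w(2)]] apart[OF w] start w by metis
    \<comment> \<open>Negation turns downward arms into upward ones.\<close>
    have "continuous_on {0..1/2} (\<lambda>s. - arm w s)" "continuous_on {0..1/2} (\<lambda>s. - arm w' s)"
      using cont w by (auto intro: continuous_on_minus)
    from arcs_meet[OF this] show "\<not> (arm w (1/2) < ?t \<and> arm w' (1/2) < ?t)"
      using apart[OF w] start w by (metis neg_less_iff_less neg_equal_iff_equal)
  qed
  have L3: "{v, a} \<in> L" "{v, b} \<in> L" "{v, c} \<in> L" using eL a b c by auto
  show False
    using up[OF L3(1,2) a(2) b(2) ne(1)] up[OF L3(1,3) a(2) c(2) ne(2)] up[OF L3(2,3) b(2) c(2) ne(3)]
      down[OF L3(1,2) a(2) b(2) ne(1)] down[OF L3(1,3) a(2) c(2) ne(2)] down[OF L3(2,3) b(2) c(2) ne(3)]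
      leave[OF L3(1) a(2)] leave[OF L3(2) b(2)] leave[OF L3(3) c(2)] by linarith
qed

text \<open>Degree 0 is ruled out by an edge leaving \<open>{v}\<close>, so 2 is the only degree
  left.\<close>

lemma ham_L: "ham L"
  unfolding ham_def
proof (intro conjI ballI allI impI)
  show "L \<subseteq> E" by (auto simp: L_iff)
  fix v assume v: "v \<in> V"
  have "boundary L {v} \<noteq> {}" using v by (intro L_crosses) auto
  then have "{e \<in> L. v \<in> e} \<noteq> {}" by (auto simp: edge_cut_def)
  moreover have "finite {e \<in> L. v \<in> e}"
    by (rule finite_subset[OF _ locally_finite[OF v]]) (auto simp: L_iff)
  ultimately have "deg (\<lambda>e. e) L v \<noteq> 0" by (simp add: deg_def)
  then show "deg (\<lambda>e. e) L v = 2" using deg_L_not_1[OF v] deg_L_not_3[OF v] by linarith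
next
  fix W assume "finite W \<and> W \<subseteq> V \<and> W \<noteq> {}"
  then show "boundary L W \<noteq> {}" using L_crosses by blast
qed

end

theorem theorem3p5:
  fixes G :: "'a ugraph" and \<omega> :: "(nat \<Rightarrow> 'a) set"
  assumes "simple_graph G"
    and "connected_graph G"
    and "cubic G"
    and "ends G = {\<omega>}"
    and "end_degree \<omega> = 3"
    and "\<exists>H. hamilton_cycle G H"
  shows "\<exists>H1 H2. hamilton_cycle G H1 \<and> hamilton_cycle G H2 \<and> H1 \<noteq> H2"
proof -
  obtain K where K: "hamilton_circle G K" using assms(6) by (auto simp: hamilton_cycle_def)
  interpret hamilton_circle_in G \<omega> K
    by unfold_locales (fact assms K)+
  obtain L' where L': "ham L'" "L' \<noteq> L" by (rule second_ham[OF ham_L])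
  then obtain K' where K': "hamilton_circle G K'" "edges (subgraph_in G K') = L'"
    using ham_imp_hamilton_circle by blast
  then have "subgraph_in G K \<noteq> subgraph_in G K'" using L'(2) by (auto simp: L_def)
  with K K'(1) show ?thesis unfolding hamilton_cycle_def by blast
qed

end
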